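(* Let $R$ be a commutative ring and let $\mathscr{A}$ be a finitely cocomplete $R$-linear category. Then $\mathscr{A}$ is ind-abelian if and only if the category $\operatorname{Ind}(\mathscr{A})$ of ind-objects of $\mathscr{A}$ is abelian.
   Context: An $R$-linear category (a category enriched in $R$-modules) is finitely cocomplete if it has all finite colimits, equivalently if it has finite direct sums and cokernels. A sequence $W \xrightarrow{p} V \xrightarrow{q} U \to 0$ is right exact if $q$ is a cokernel of $p$. A finitely cocomplete $R$-linear category $\mathscr{A}$ is called ind-abelian if: (i) every epimorphism in $\mathscr{A}$ is regular, i.e. is a cokernel of some morphism; (ii) for every right exact sequence $W \xrightarrow{p} V \xrightarrow{q} U \to 0$ in $\mathscr{A}$ and every morphism $f \colon A \to V$ with $qf=0$, there exist an epimorphism $p' \colon B \to A$ and a morphism $f' \colon B \to W$ in $\mathscr{A}$ such that $f p' = p f'$. *)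

theory Defs
  imports "HOL-Algebra.Module" "HOL-Library.Equipollence"
begin

text \<open>
  Categories are given by a set of objects and a family of hom-sets. Different hom-sets need not be
  disjoint, so composition carries the three objects involved:
  \<open>Comp C a b c g f\<close> is the composite of \<open>f : a \<rightarrow> b\<close> followed by \<open>g : b \<rightarrow> c\<close>.
\<close>

record ('o, 'm) cat =
  Obj :: "'o set"
  Hom :: "'o \<Rightarrow> 'o \<Rightarrow> 'm set"
  Comp :: "'o \<Rightarrow> 'o \<Rightarrow> 'o \<Rightarrow> 'm \<Rightarrow> 'm \<Rightarrow> 'm"
  Id :: "'o \<Rightarrow> 'm"

locale category =
  fixes C :: "('o, 'm, 'z) cat_scheme"
  assumes comp_closed: "\<lbrakk>a \<in> Obj C; b \<in> Obj C; c \<in> Obj C; f \<in> Hom C a b; g \<in> Hom C b c\<rbrakk>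
      \<Longrightarrow> Comp C a b c g f \<in> Hom C a c"
    and id_closed: "a \<in> Obj C \<Longrightarrow> Id C a \<in> Hom C a a"
    and comp_assoc: "\<lbrakk>a \<in> Obj C; b \<in> Obj C; c \<in> Obj C; d \<in> Obj C;
        f \<in> Hom C a b; g \<in> Hom C b c; h \<in> Hom C c d\<rbrakk>
      \<Longrightarrow> Comp C a c d h (Comp C a b c g f) = Comp C a b d (Comp C b c d h g) f"
    and id_left: "\<lbrakk>a \<in> Obj C; b \<in> Obj C; f \<in> Hom C a b\<rbrakk> \<Longrightarrow> Comp C a b b (Id C b) f = f"
    and id_right: "\<lbrakk>a \<in> Obj C; b \<in> Obj C; f \<in> Hom C a b\<rbrakk> \<Longrightarrow> Comp C a a b f (Id C a) = f"

definition is_mono :: "('o, 'm, 'z) cat_scheme \<Rightarrow> 'o \<Rightarrow> 'o \<Rightarrow> 'm \<Rightarrow> bool" where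
  "is_mono C a b f \<longleftrightarrow> f \<in> Hom C a b \<and>
     (\<forall>c\<in>Obj C. \<forall>g\<in>Hom C c a. \<forall>h\<in>Hom C c a. Comp C c a b f g = Comp C c a b f h \<longrightarrow> g = h)"

definition is_epi :: "('o, 'm, 'z) cat_scheme \<Rightarrow> 'o \<Rightarrow> 'o \<Rightarrow> 'm \<Rightarrow> bool" where
  "is_epi C a b f \<longleftrightarrow> f \<in> Hom C a b \<and>
     (\<forall>c\<in>Obj C. \<forall>g\<in>Hom C b c. \<forall>h\<in>Hom C b c. Comp C a b c g f = Comp C a b c h f \<longrightarrow> g = h)"


section \<open>Diagrams and colimits\<close>

text \<open>A functor has an object part \<open>D i\<close> and an arrow part \<open>E i j u : D i \<rightarrow> D j\<close> for \<open>u : i \<rightarrow> j\<close>.\<close>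

definition is_functor ::
    "('i, 'j, 'y) cat_scheme \<Rightarrow> ('o, 'm, 'z) cat_scheme \<Rightarrow> ('i \<Rightarrow> 'o) \<Rightarrow> ('i \<Rightarrow> 'i \<Rightarrow> 'j \<Rightarrow> 'm) \<Rightarrow> bool" where
  "is_functor I C D E \<longleftrightarrow>
     (\<forall>i\<in>Obj I. D i \<in> Obj C) \<and>
     (\<forall>i\<in>Obj I. \<forall>j\<in>Obj I. \<forall>u\<in>Hom I i j. E i j u \<in> Hom C (D i) (D j)) \<and>
     (\<forall>i\<in>Obj I. E i i (Id I i) = Id C (D i)) \<and>
     (\<forall>i\<in>Obj I. \<forall>j\<in>Obj I. \<forall>k\<in>Obj I. \<forall>u\<in>Hom I i j. \<forall>v\<in>Hom I j k.
        E i k (Comp I i j k v u) = Comp C (D i) (D j) (D k) (E j k v) (E i j u))"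

definition is_cocone ::
    "('i, 'j, 'y) cat_scheme \<Rightarrow> ('o, 'm, 'z) cat_scheme \<Rightarrow> ('i \<Rightarrow> 'o) \<Rightarrow> ('i \<Rightarrow> 'i \<Rightarrow> 'j \<Rightarrow> 'm) \<Rightarrow>
      'o \<Rightarrow> ('i \<Rightarrow> 'm) \<Rightarrow> bool" where
  "is_cocone I C D E c l \<longleftrightarrow> c \<in> Obj C \<and>
     (\<forall>i\<in>Obj I. l i \<in> Hom C (D i) c) \<and>
     (\<forall>i\<in>Obj I. \<forall>j\<in>Obj I. \<forall>u\<in>Hom I i j. Comp C (D i) (D j) c (l j) (E i j u) = l i)"

definition is_colimit ::
    "('i, 'j, 'y) cat_scheme \<Rightarrow> ('o, 'm, 'z) cat_scheme \<Rightarrow> ('i \<Rightarrow> 'o) \<Rightarrow> ('i \<Rightarrow> 'i \<Rightarrow> 'j \<Rightarrow> 'm) \<Rightarrow>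
      'o \<Rightarrow> ('i \<Rightarrow> 'm) \<Rightarrow> bool" where
  "is_colimit I C D E c l \<longleftrightarrow> is_cocone I C D E c l \<and>
     (\<forall>d m. is_cocone I C D E d m \<longrightarrow>
        (\<exists>!h. h \<in> Hom C c d \<and> (\<forall>i\<in>Obj I. Comp C (D i) c d h (l i) = m i)))"

definition finite_cat :: "('i, 'j, 'y) cat_scheme \<Rightarrow> bool" where
  "finite_cat I \<longleftrightarrow> category I \<and> finite (Obj I) \<and> (\<forall>i\<in>Obj I. \<forall>j\<in>Obj I. finite (Hom I i j))"

definition filtered_cat :: "('i, 'j, 'y) cat_scheme \<Rightarrow> bool" where
  "filtered_cat I \<longleftrightarrow> category I \<and> Obj I \<noteq> {} \<and>
     (\<forall>i\<in>Obj I. \<forall>j\<in>Obj I. \<exists>k\<in>Obj I. Hom I i k \<noteq> {} \<and> Hom I j k \<noteq> {}) \<and>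
     (\<forall>i\<in>Obj I. \<forall>j\<in>Obj I. \<forall>u\<in>Hom I i j. \<forall>v\<in>Hom I i j.
        \<exists>k\<in>Obj I. \<exists>w\<in>Hom I j k. Comp I i j k w u = Comp I i j k w v)"

text \<open>
  Every finite category is isomorphic to one whose objects and arrows are natural numbers, so
  diagrams of that form are enough.
\<close>

definition finitely_cocomplete :: "('o, 'm, 'z) cat_scheme \<Rightarrow> bool" where
  "finitely_cocomplete C \<longleftrightarrow>
     (\<forall>(I :: (nat, nat) cat) D E. finite_cat I \<and> is_functor I C D E \<longrightarrow> (\<exists>c l. is_colimit I C D E c l))"


section \<open>Linear categories\<close>

text \<open>
  The hom-sets carry module structures. The type of modules in the library extends that of rings,
  but the multiplication and the unit it records are not part of the module structure.
\<close>

record ('o, 'm, 'r) lcat = "('o, 'm) cat" +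
  HomMod :: "'o \<Rightarrow> 'o \<Rightarrow> ('r, 'm) module"

locale linear_category = cring R + category C
  for R :: "('r, 'k) ring_scheme" (structure) and C :: "('o, 'm, 'r, 'z) lcat_scheme" +
  assumes hom_module: "\<lbrakk>a \<in> Obj C; b \<in> Obj C\<rbrakk> \<Longrightarrow> module R (HomMod C a b)"
    and carrier_hom: "\<lbrakk>a \<in> Obj C; b \<in> Obj C\<rbrakk> \<Longrightarrow> carrier (HomMod C a b) = Hom C a b"
    and comp_add_left: "\<lbrakk>a \<in> Obj C; b \<in> Obj C; c \<in> Obj C;
        f \<in> Hom C a b; g \<in> Hom C b c; g' \<in> Hom C b c\<rbrakk>
      \<Longrightarrow> Comp C a b c (g \<oplus>\<^bsub>HomMod C b c\<^esub> g') f
          = Comp C a b c g f \<oplus>\<^bsub>HomMod C a c\<^esub> Comp C a b c g' f"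
    and comp_add_right: "\<lbrakk>a \<in> Obj C; b \<in> Obj C; c \<in> Obj C;
        f \<in> Hom C a b; f' \<in> Hom C a b; g \<in> Hom C b c\<rbrakk>
      \<Longrightarrow> Comp C a b c g (f \<oplus>\<^bsub>HomMod C a b\<^esub> f')
          = Comp C a b c g f \<oplus>\<^bsub>HomMod C a c\<^esub> Comp C a b c g f'"
    and comp_smult_left: "\<lbrakk>a \<in> Obj C; b \<in> Obj C; c \<in> Obj C;
        f \<in> Hom C a b; g \<in> Hom C b c; r \<in> carrier R\<rbrakk>
      \<Longrightarrow> Comp C a b c (r \<odot>\<^bsub>HomMod C b c\<^esub> g) f = r \<odot>\<^bsub>HomMod C a c\<^esub> Comp C a b c g f"
    and comp_smult_right: "\<lbrakk>a \<in> Obj C; b \<in> Obj C; c \<in> Obj C;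
        f \<in> Hom C a b; g \<in> Hom C b c; r \<in> carrier R\<rbrakk>
      \<Longrightarrow> Comp C a b c g (r \<odot>\<^bsub>HomMod C a b\<^esub> f) = r \<odot>\<^bsub>HomMod C a c\<^esub> Comp C a b c g f"

definition is_kernel :: "('o, 'm, 'r, 'z) lcat_scheme \<Rightarrow> 'o \<Rightarrow> 'o \<Rightarrow> 'o \<Rightarrow> 'm \<Rightarrow> 'm \<Rightarrow> bool" where
  "is_kernel C k a b i f \<longleftrightarrow> i \<in> Hom C k a \<and> f \<in> Hom C a b \<and> Comp C k a b f i = \<zero>\<^bsub>HomMod C k b\<^esub> \<and>
     (\<forall>d\<in>Obj C. \<forall>g\<in>Hom C d a. Comp C d a b f g = \<zero>\<^bsub>HomMod C d b\<^esub> \<longrightarrow>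
        (\<exists>!h. h \<in> Hom C d k \<and> Comp C d k a i h = g))"

text \<open>
  \<open>is_cokernel C w v u p q\<close>: the arrow \<open>q : v \<rightarrow> u\<close> is a cokernel of \<open>p : w \<rightarrow> v\<close>; that is, the
  sequence \<open>w \<rightarrow> v \<rightarrow> u \<rightarrow> 0\<close> is right exact.
\<close>

definition is_cokernel :: "('o, 'm, 'r, 'z) lcat_scheme \<Rightarrow> 'o \<Rightarrow> 'o \<Rightarrow> 'o \<Rightarrow> 'm \<Rightarrow> 'm \<Rightarrow> bool" where
  "is_cokernel C w v u p q \<longleftrightarrow> p \<in> Hom C w v \<and> q \<in> Hom C v u \<and> Comp C w v u q p = \<zero>\<^bsub>HomMod C w u\<^esub> \<and>
     (\<forall>d\<in>Obj C. \<forall>g\<in>Hom C v d. Comp C w v d g p = \<zero>\<^bsub>HomMod C w d\<^esub> \<longrightarrow>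
        (\<exists>!h. h \<in> Hom C u d \<and> Comp C v u d h q = g))"

definition is_zero_object :: "('o, 'm, 'z) cat_scheme \<Rightarrow> 'o \<Rightarrow> bool" where
  "is_zero_object C z \<longleftrightarrow> z \<in> Obj C \<and>
     (\<forall>a\<in>Obj C. (\<exists>!f. f \<in> Hom C z a) \<and> (\<exists>!f. f \<in> Hom C a z))"

definition is_biproduct ::
    "('o, 'm, 'r, 'z) lcat_scheme \<Rightarrow> 'o \<Rightarrow> 'o \<Rightarrow> 'o \<Rightarrow> 'm \<Rightarrow> 'm \<Rightarrow> 'm \<Rightarrow> 'm \<Rightarrow> bool" where
  "is_biproduct C a b s i j p q \<longleftrightarrow> s \<in> Obj C \<and>
     i \<in> Hom C a s \<and> j \<in> Hom C b s \<and> p \<in> Hom C s a \<and> q \<in> Hom C s b \<and>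
     Comp C a s a p i = Id C a \<and> Comp C b s b q j = Id C b \<and>
     Comp C s a s i p \<oplus>\<^bsub>HomMod C s s\<^esub> Comp C s b s j q = Id C s"

definition abelian :: "('r, 'k) ring_scheme \<Rightarrow> ('o, 'm, 'r, 'z) lcat_scheme \<Rightarrow> bool" where
  "abelian R C \<longleftrightarrow> linear_category R C \<and>
     (\<exists>z. is_zero_object C z) \<and>
     (\<forall>a\<in>Obj C. \<forall>b\<in>Obj C. \<exists>s i j p q. is_biproduct C a b s i j p q) \<and>
     (\<forall>a\<in>Obj C. \<forall>b\<in>Obj C. \<forall>f\<in>Hom C a b. \<exists>k\<in>Obj C. \<exists>i. is_kernel C k a b i f) \<and>
     (\<forall>a\<in>Obj C. \<forall>b\<in>Obj C. \<forall>f\<in>Hom C a b. \<exists>c\<in>Obj C. \<exists>q. is_cokernel C a b c f q) \<and>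
     (\<forall>a\<in>Obj C. \<forall>b\<in>Obj C. \<forall>f. is_mono C a b f \<longrightarrow> (\<exists>c\<in>Obj C. \<exists>g. is_kernel C a b c f g)) \<and>
     (\<forall>a\<in>Obj C. \<forall>b\<in>Obj C. \<forall>f. is_epi C a b f \<longrightarrow> (\<exists>c\<in>Obj C. \<exists>g. is_cokernel C c a b g f))"

definition ind_abelian :: "('r, 'k) ring_scheme \<Rightarrow> ('o, 'm, 'r, 'z) lcat_scheme \<Rightarrow> bool" where
  "ind_abelian R C \<longleftrightarrow> linear_category R C \<and> finitely_cocomplete C \<and>
     (\<forall>v\<in>Obj C. \<forall>u\<in>Obj C. \<forall>q. is_epi C v u q \<longrightarrow> (\<exists>w\<in>Obj C. \<exists>p. is_cokernel C w v u p q)) \<and>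
     (\<forall>w\<in>Obj C. \<forall>v\<in>Obj C. \<forall>u\<in>Obj C. \<forall>p q. is_cokernel C w v u p q \<longrightarrow>
        (\<forall>a\<in>Obj C. \<forall>f\<in>Hom C a v. Comp C a v u q f = \<zero>\<^bsub>HomMod C a u\<^esub> \<longrightarrow>
           (\<exists>b\<in>Obj C. \<exists>p' f'. is_epi C b a p' \<and> f' \<in> Hom C b w \<and>
              Comp C b a v f p' = Comp C b w v p f')))"


section \<open>Ind-objects\<close>

text \<open>
  Ind-objects are those linear presheaves that are small filtered colimits of representable ones.
  The type \<open>'u\<close> in which the presheaves take their values plays the role of the universe: a set or
  category is small if it can be placed on (a subset of) \<open>'u\<close>.
\<close>

definition mod_hom ::
    "('r, 'k) ring_scheme \<Rightarrow> ('r, 'a, 'y) module_scheme \<Rightarrow> ('r, 'b, 'z) module_scheme \<Rightarrow> ('a \<Rightarrow> 'b) set" where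
  "mod_hom R M N = {h \<in> carrier M \<rightarrow> carrier N.
     (\<forall>x\<in>carrier M. \<forall>y\<in>carrier M. h (x \<oplus>\<^bsub>M\<^esub> y) = h x \<oplus>\<^bsub>N\<^esub> h y) \<and>
     (\<forall>r\<in>carrier R. \<forall>x\<in>carrier M. h (r \<odot>\<^bsub>M\<^esub> x) = r \<odot>\<^bsub>N\<^esub> h x)}"

text \<open>For \<open>f : a \<rightarrow> b\<close>, the map \<open>Act F a b f\<close> goes from \<open>Val F b\<close> to \<open>Val F a\<close>.\<close>

record ('o, 'm, 'r, 'u) presheaf =
  Val :: "'o \<Rightarrow> ('r, 'u) module"
  Act :: "'o \<Rightarrow> 'o \<Rightarrow> 'm \<Rightarrow> 'u \<Rightarrow> 'u"

locale linear_presheaf = linear_category R C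
  for R :: "('r, 'k) ring_scheme" (structure) and C :: "('o, 'm, 'r, 'z) lcat_scheme" +
  fixes F :: "('o, 'm, 'r, 'u) presheaf"
  assumes val_module: "a \<in> Obj C \<Longrightarrow> module R (Val F a)"
    and act_hom: "\<lbrakk>a \<in> Obj C; b \<in> Obj C; f \<in> Hom C a b\<rbrakk>
      \<Longrightarrow> Act F a b f \<in> mod_hom R (Val F b) (Val F a)"
    and act_id: "\<lbrakk>a \<in> Obj C; x \<in> carrier (Val F a)\<rbrakk> \<Longrightarrow> Act F a a (Id C a) x = x"
    and act_comp: "\<lbrakk>a \<in> Obj C; b \<in> Obj C; c \<in> Obj C; f \<in> Hom C a b; g \<in> Hom C b c;
        x \<in> carrier (Val F c)\<rbrakk>
      \<Longrightarrow> Act F a c (Comp C a b c g f) x = Act F a b f (Act F b c g x)"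
    and act_add: "\<lbrakk>a \<in> Obj C; b \<in> Obj C; f \<in> Hom C a b; f' \<in> Hom C a b; x \<in> carrier (Val F b)\<rbrakk>
      \<Longrightarrow> Act F a b (f \<oplus>\<^bsub>HomMod C a b\<^esub> f') x = Act F a b f x \<oplus>\<^bsub>Val F a\<^esub> Act F a b f' x"
    and act_smult: "\<lbrakk>a \<in> Obj C; b \<in> Obj C; f \<in> Hom C a b; r \<in> carrier R; x \<in> carrier (Val F b)\<rbrakk>
      \<Longrightarrow> Act F a b (r \<odot>\<^bsub>HomMod C a b\<^esub> f) x = r \<odot>\<^bsub>Val F a\<^esub> Act F a b f x"

text \<open>
  Natural transformations are made extensional (\<open>undefined\<close> off the objects and off the carriers),
  so that equality of functions is equality of natural transformations.
\<close>

definition nat_trans ::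
    "('r, 'k) ring_scheme \<Rightarrow> ('o, 'm, 'r, 'z) lcat_scheme \<Rightarrow> ('o, 'm, 'r, 'u) presheaf \<Rightarrow>
      ('o, 'm, 'r, 'u) presheaf \<Rightarrow> ('o \<Rightarrow> 'u \<Rightarrow> 'u) set" where
  "nat_trans R C F G =
     {t \<in> (\<Pi>\<^sub>E a\<in>Obj C. mod_hom R (Val F a) (Val G a) \<inter> extensional (carrier (Val F a))).
        \<forall>a\<in>Obj C. \<forall>b\<in>Obj C. \<forall>f\<in>Hom C a b. \<forall>x\<in>carrier (Val F b).
          t a (Act F a b f x) = Act G a b f (t b x)}"

definition nat_trans_module ::
    "('r, 'k) ring_scheme \<Rightarrow> ('o, 'm, 'r, 'z) lcat_scheme \<Rightarrow> ('o, 'm, 'r, 'u) presheaf \<Rightarrow>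
      ('o, 'm, 'r, 'u) presheaf \<Rightarrow> ('r, 'o \<Rightarrow> 'u \<Rightarrow> 'u) module" where
  "nat_trans_module R C F G =
     \<lparr>carrier = nat_trans R C F G, mult = undefined, one = undefined,
      zero = (\<lambda>a\<in>Obj C. \<lambda>x\<in>carrier (Val F a). \<zero>\<^bsub>Val G a\<^esub>),
      add = (\<lambda>s t. \<lambda>a\<in>Obj C. \<lambda>x\<in>carrier (Val F a). s a x \<oplus>\<^bsub>Val G a\<^esub> t a x),
      smult = (\<lambda>r t. \<lambda>a\<in>Obj C. \<lambda>x\<in>carrier (Val F a). r \<odot>\<^bsub>Val G a\<^esub> t a x)\<rparr>"

definition presheaf_cat ::
    "('r, 'k) ring_scheme \<Rightarrow> ('o, 'm, 'r, 'z) lcat_scheme \<Rightarrow>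
      (('o, 'm, 'r, 'u) presheaf, 'o \<Rightarrow> 'u \<Rightarrow> 'u, 'r) lcat" where
  "presheaf_cat R C =
     \<lparr>Obj = {F. linear_presheaf R C F},
      Hom = nat_trans R C,
      Comp = (\<lambda>F G H t s. \<lambda>a\<in>Obj C. \<lambda>x\<in>carrier (Val F a). t a (s a x)),
      Id = (\<lambda>F. \<lambda>a\<in>Obj C. \<lambda>x\<in>carrier (Val F a). x),
      HomMod = nat_trans_module R C\<rparr>"

definition representable ::
    "('r, 'k) ring_scheme \<Rightarrow> ('o, 'm, 'r, 'z) lcat_scheme \<Rightarrow> ('o, 'm, 'r, 'u) presheaf \<Rightarrow> bool" where
  "representable R C F \<longleftrightarrow>
     (\<exists>c\<in>Obj C. \<exists>t.
        (\<forall>a\<in>Obj C. t a \<in> mod_hom R (HomMod C a c) (Val F a) \<and>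
           bij_betw (t a) (Hom C a c) (carrier (Val F a))) \<and>
        (\<forall>a\<in>Obj C. \<forall>b\<in>Obj C. \<forall>f\<in>Hom C a b. \<forall>g\<in>Hom C b c.
           t a (Comp C a b c g f) = Act F a b f (t b g)))"

definition ind_object ::
    "('r, 'k) ring_scheme \<Rightarrow> ('o, 'm, 'r, 'z) lcat_scheme \<Rightarrow> ('o, 'm, 'r, 'u) presheaf \<Rightarrow> bool" where
  "ind_object R C F \<longleftrightarrow>
     (\<exists>(I :: ('u, 'u) cat) D E l.
        filtered_cat I \<and> is_functor I (presheaf_cat R C) D E \<and>
        (\<forall>i\<in>Obj I. representable R C (D i)) \<and>
        is_colimit I (presheaf_cat R C) D E F l)"

definition Ind ::
    "('r, 'k) ring_scheme \<Rightarrow> ('o, 'm, 'r, 'z) lcat_scheme \<Rightarrow>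
      (('o, 'm, 'r, 'u) presheaf, 'o \<Rightarrow> 'u \<Rightarrow> 'u, 'r) lcat" where
  "Ind R C = (presheaf_cat R C)\<lparr>Obj := {F. ind_object R C F}\<rparr>"

text \<open>
  Smallness relative to \<open>'u\<close>, which is required to be infinite. Then every representable presheaf has
  an isomorphic copy with values in \<open>'u\<close>, and colimits over index categories on \<open>'u\<close> can be formed
  pointwise within \<open>'u\<close>.
\<close>

definition small_cat :: "'u itself \<Rightarrow> ('o, 'm, 'z) cat_scheme \<Rightarrow> bool" where
  "small_cat U C \<longleftrightarrow> infinite (UNIV :: 'u set) \<and> Obj C \<lesssim> (UNIV :: 'u set) \<and>
     (\<forall>a\<in>Obj C. \<forall>b\<in>Obj C. Hom C a b \<lesssim> (UNIV :: 'u set))"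

end

theory Submission
  imports Defs
begin

text \<open>
  Over a finitely cocomplete category an ind-object is the same as a left exact presheaf, i.e. a linear
  presheaf turning right exact sequences into left exact ones: such a presheaf is the colimit of the
  representables over its category of elements, which is then filtered. Kernels of ind-objects are
  computed pointwise, and the cokernel of \<open>\<alpha> : F \<rightarrow> G\<close> is the filtered colimit of the cokernels of all
  \<open>p : v \<rightarrow> u\<close> in \<open>A\<close> that fit into a commutative square with \<open>\<alpha>\<close>.

  If \<open>A\<close> is ind-abelian, its epimorphisms behave like the coverings of a Grothendieck topology, whose
  sheaves are the left exact presheaves, and by condition (ii) an element of \<open>G\<close> that becomes zero in
  the cokernel of \<open>\<alpha>\<close> lifts along \<open>\<alpha>\<close> after restriction to a covering. Descent along coverings then
  shows that monomorphisms are kernels and epimorphisms are cokernels.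

  Conversely, let \<open>Ind(A)\<close> be abelian. The Yoneda embedding preserves cokernels and epimorphisms. Hence
  an epimorphism \<open>q : v \<rightarrow> u\<close> of \<open>A\<close> is the cokernel in \<open>Ind(A)\<close> of a map \<open>F \<rightarrow> Y v\<close>, and in the situation
  of (ii) the pullback of \<open>Y w \<rightarrow> Y v \<leftarrow> Y a\<close> maps to \<open>Y a\<close> by an epimorphism, whose cokernel is zero.
  The map \<open>p\<close>, respectively the epimorphism \<open>p'\<close>, required in \<open>A\<close> is found at some stage of the filtered
  colimit that computes these cokernels.
\<close>

lemma lepoll_UNIV_iff: "A \<lesssim> (UNIV :: 'u set) \<longleftrightarrow> (\<exists>f :: 'a \<Rightarrow> 'u. inj_on f A)"
  by (simp add: lepoll_def)

lemma Times_lepoll_infinite: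
  assumes "infinite (UNIV :: 'u set)"
  shows "(UNIV :: ('u \<times> 'u) set) \<lesssim> (UNIV :: 'u set)"
proof -
  have "(UNIV :: 'u set) \<times> (UNIV :: 'u set) \<approx> (UNIV :: 'u set)"
    unfolding eqpoll_iff_card_of_ordIso by (rule card_of_Times_same_infinite[OF assms])
  then show ?thesis by (simp add: eqpoll_imp_lepoll)
qed

lemma Sigma_lepoll_infinite:
  assumes inf: "infinite (UNIV :: 'u set)" and A: "A \<lesssim> (UNIV :: 'u set)"
    and B: "\<And>a. a \<in> A \<Longrightarrow> B a \<lesssim> (UNIV :: 'u set)"
  shows "Sigma A B \<lesssim> (UNIV :: 'u set)"
proof -
  obtain f :: "_ \<Rightarrow> 'u" where f: "inj_on f A" using A by (auto simp: lepoll_UNIV_iff)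
  obtain g :: "_ \<Rightarrow> _ \<Rightarrow> 'u" where g: "\<And>a. a \<in> A \<Longrightarrow> inj_on (g a) (B a)"
    using B unfolding lepoll_UNIV_iff by metis
  have "inj_on (\<lambda>(a, b). (f a, g a b)) (Sigma A B)"
    using f g by (auto simp: inj_on_def)
  then have "Sigma A B \<lesssim> (UNIV :: ('u \<times> 'u) set)"
    by (auto simp: lepoll_def)
  then show ?thesis using Times_lepoll_infinite[OF inf] by (rule lepoll_trans)
qed

lemma Times_lepoll_UNIV:
  assumes inf: "infinite (UNIV :: 'u set)" and "A \<lesssim> (UNIV :: 'u set)" "B \<lesssim> (UNIV :: 'u set)"
  shows "A \<times> B \<lesssim> (UNIV :: 'u set)"
  by (rule Sigma_lepoll_infinite) (use assms in auto)


section \<open>Modules and linear categories\<close>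

lemma mod_homI:
  assumes "\<And>x. x \<in> carrier M \<Longrightarrow> h x \<in> carrier N"
    and "\<And>x y. \<lbrakk>x \<in> carrier M; y \<in> carrier M\<rbrakk> \<Longrightarrow> h (x \<oplus>\<^bsub>M\<^esub> y) = h x \<oplus>\<^bsub>N\<^esub> h y"
    and "\<And>r x. \<lbrakk>r \<in> carrier R; x \<in> carrier M\<rbrakk> \<Longrightarrow> h (r \<odot>\<^bsub>M\<^esub> x) = r \<odot>\<^bsub>N\<^esub> h x"
  shows "h \<in> mod_hom R M N"
  using assms by (auto simp: mod_hom_def)

lemma mod_hom_closed: "\<lbrakk>h \<in> mod_hom R M N; x \<in> carrier M\<rbrakk> \<Longrightarrow> h x \<in> carrier N"
  and mod_hom_add: "\<lbrakk>h \<in> mod_hom R M N; x \<in> carrier M; y \<in> carrier M\<rbrakk> \<Longrightarrow> h (x \<oplus>\<^bsub>M\<^esub> y) = h x \<oplus>\<^bsub>N\<^esub> h y"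
  and mod_hom_smult: "\<lbrakk>h \<in> mod_hom R M N; r \<in> carrier R; x \<in> carrier M\<rbrakk> \<Longrightarrow> h (r \<odot>\<^bsub>M\<^esub> x) = r \<odot>\<^bsub>N\<^esub> h x"
  by (auto simp: mod_hom_def)

lemma module_zero_closed: "module R M \<Longrightarrow> \<zero>\<^bsub>M\<^esub> \<in> carrier M"
  by (simp add: module_def abelian_group_def abelian_monoid.zero_closed)

lemma module_add_closed: "\<lbrakk>module R M; x \<in> carrier M; y \<in> carrier M\<rbrakk> \<Longrightarrow> x \<oplus>\<^bsub>M\<^esub> y \<in> carrier M"
  by (simp add: module_def abelian_group_def abelian_monoid.a_closed)

lemma module_smult_zero: "\<lbrakk>module R M; x \<in> carrier M\<rbrakk> \<Longrightarrow> \<zero>\<^bsub>R\<^esub> \<odot>\<^bsub>M\<^esub> x = \<zero>\<^bsub>M\<^esub>"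
  by (simp add: module.smult_l_null)

lemma module_l_zero: "\<lbrakk>module R M; x \<in> carrier M\<rbrakk> \<Longrightarrow> \<zero>\<^bsub>M\<^esub> \<oplus>\<^bsub>M\<^esub> x = x"
  and module_r_zero: "\<lbrakk>module R M; x \<in> carrier M\<rbrakk> \<Longrightarrow> x \<oplus>\<^bsub>M\<^esub> \<zero>\<^bsub>M\<^esub> = x"
  by (simp_all add: module_def abelian_group_def abelian_monoid.l_zero abelian_monoid.r_zero)

lemma mod_hom_zero:
  assumes "module R M" "module R N" "h \<in> mod_hom R M N"
  shows "h \<zero>\<^bsub>M\<^esub> = \<zero>\<^bsub>N\<^esub>"
proof -
  have c: "\<zero>\<^bsub>R\<^esub> \<in> carrier R"
    using assms(1) by (simp add: module_def cring_def ring.ring_simprules(2))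
  have "h \<zero>\<^bsub>M\<^esub> = h (\<zero>\<^bsub>R\<^esub> \<odot>\<^bsub>M\<^esub> \<zero>\<^bsub>M\<^esub>)"
    using assms by (simp add: module_smult_zero module_zero_closed)
  also have "\<dots> = \<zero>\<^bsub>R\<^esub> \<odot>\<^bsub>N\<^esub> h \<zero>\<^bsub>M\<^esub>"
    using assms c by (simp add: mod_hom_smult module_zero_closed)
  also have "\<dots> = \<zero>\<^bsub>N\<^esub>"
    using assms by (simp add: module_smult_zero module_zero_closed mod_hom_closed)
  finally show ?thesis .
qed

text \<open>
  Subtraction in terms of the two module operations, so that a map commuting with these two
  commutes with it.
\<close>

definition mdiff :: "('r, 'k) ring_scheme \<Rightarrow> ('r, 'a, 'y) module_scheme \<Rightarrow> 'a \<Rightarrow> 'a \<Rightarrow> 'a" where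
  "mdiff R M x y = x \<oplus>\<^bsub>M\<^esub> (\<ominus>\<^bsub>R\<^esub> \<one>\<^bsub>R\<^esub>) \<odot>\<^bsub>M\<^esub> y"

lemma module_minus_one: "module R M \<Longrightarrow> \<ominus>\<^bsub>R\<^esub> \<one>\<^bsub>R\<^esub> \<in> carrier R"
  by (simp add: module_def cring_def ring.ring_simprules)

lemma mdiff_closed: "\<lbrakk>module R M; x \<in> carrier M; y \<in> carrier M\<rbrakk> \<Longrightarrow> mdiff R M x y \<in> carrier M"
  by (simp add: mdiff_def module_minus_one module_add_closed module.smult_closed)

lemma mdiff_eq_zero_iff:
  assumes "module R M" "x \<in> carrier M" "y \<in> carrier M"
  shows "mdiff R M x y = \<zero>\<^bsub>M\<^esub> \<longleftrightarrow> x = y"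
proof -
  interpret module R M by fact
  have "mdiff R M x y = x \<ominus>\<^bsub>M\<^esub> y"
    using assms by (simp add: mdiff_def smult_l_minus a_minus_def)
  then show ?thesis using assms
    by (metis M.minus_equality a_minus_def M.minus_minus M.a_inv_closed M.r_neg)
qed

lemma mod_hom_mdiff:
  assumes "module R M" "h \<in> mod_hom R M N" "x \<in> carrier M" "y \<in> carrier M"
  shows "h (mdiff R M x y) = mdiff R N (h x) (h y)"
  using assms module.smult_closed[OF assms(1) module_minus_one[OF assms(1)]]
  by (simp add: mdiff_def mod_hom_add mod_hom_smult[OF assms(2) module_minus_one[OF assms(1)]])

lemma mod_hom_injD:
  assumes M: "module R M" and N: "module R N" and h: "h \<in> mod_hom R M N"
    and ker: "\<And>x. \<lbrakk>x \<in> carrier M; h x = \<zero>\<^bsub>N\<^esub>\<rbrakk> \<Longrightarrow> x = \<zero>\<^bsub>M\<^esub>"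
    and xy: "x \<in> carrier M" "y \<in> carrier M" "h x = h y"
  shows "x = y"
proof -
  have "h (mdiff R M x y) = \<zero>\<^bsub>N\<^esub>"
    using xy by (simp add: mod_hom_mdiff[OF M h] mdiff_eq_zero_iff[OF N] mod_hom_closed[OF h])
  then have "mdiff R M x y = \<zero>\<^bsub>M\<^esub>" by (rule ker[OF mdiff_closed[OF M xy(1,2)]])
  then show ?thesis by (simp add: mdiff_eq_zero_iff[OF M xy(1,2)])
qed

context linear_category
begin

lemma cring_R: "cring R" by (rule cring_axioms)

abbreviation hzero :: "'o \<Rightarrow> 'o \<Rightarrow> 'm" where "hzero a b \<equiv> \<zero>\<^bsub>HomMod C a b\<^esub>"

lemma zero_hom: "\<lbrakk>a \<in> Obj C; b \<in> Obj C\<rbrakk> \<Longrightarrow> hzero a b \<in> Hom C a b"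
  using module_zero_closed[OF hom_module] by (simp add: carrier_hom)

lemma add_hom: "\<lbrakk>a \<in> Obj C; b \<in> Obj C; f \<in> Hom C a b; g \<in> Hom C a b\<rbrakk> \<Longrightarrow> f \<oplus>\<^bsub>HomMod C a b\<^esub> g \<in> Hom C a b"
  using module_add_closed[OF hom_module] by (simp add: carrier_hom)

lemma smult_hom: "\<lbrakk>a \<in> Obj C; b \<in> Obj C; f \<in> Hom C a b; r \<in> carrier R\<rbrakk> \<Longrightarrow> r \<odot>\<^bsub>HomMod C a b\<^esub> f \<in> Hom C a b"
  using module.smult_closed[OF hom_module] by (simp add: carrier_hom)

lemma postcomp_mod_hom:
  "\<lbrakk>a \<in> Obj C; b \<in> Obj C; c \<in> Obj C; g \<in> Hom C b c\<rbrakk>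
    \<Longrightarrow> Comp C a b c g \<in> mod_hom R (HomMod C a b) (HomMod C a c)"
  by (rule mod_homI) (simp_all add: carrier_hom comp_closed comp_add_right comp_smult_right)

lemma precomp_mod_hom:
  "\<lbrakk>a \<in> Obj C; b \<in> Obj C; c \<in> Obj C; f \<in> Hom C a b\<rbrakk>
    \<Longrightarrow> (\<lambda>g. Comp C a b c g f) \<in> mod_hom R (HomMod C b c) (HomMod C a c)"
  by (rule mod_homI) (simp_all add: carrier_hom comp_closed comp_add_left comp_smult_left)

lemma comp_zero_right:
  "\<lbrakk>a \<in> Obj C; b \<in> Obj C; c \<in> Obj C; g \<in> Hom C b c\<rbrakk> \<Longrightarrow> Comp C a b c g (hzero a b) = hzero a c"
  by (rule mod_hom_zero[OF hom_module hom_module postcomp_mod_hom])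

lemma comp_zero_left:
  "\<lbrakk>a \<in> Obj C; b \<in> Obj C; c \<in> Obj C; f \<in> Hom C a b\<rbrakk> \<Longrightarrow> Comp C a b c (hzero b c) f = hzero a c"
  using mod_hom_zero[OF hom_module hom_module precomp_mod_hom] by blast

definition hdiff :: "'o \<Rightarrow> 'o \<Rightarrow> 'm \<Rightarrow> 'm \<Rightarrow> 'm" where
  "hdiff a b f g = mdiff R (HomMod C a b) f g"

lemma hdiff_closed:
  "\<lbrakk>a \<in> Obj C; b \<in> Obj C; f \<in> Hom C a b; g \<in> Hom C a b\<rbrakk> \<Longrightarrow> hdiff a b f g \<in> Hom C a b"
  using mdiff_closed[OF hom_module] by (simp add: hdiff_def carrier_hom)

lemma hdiff_zero_iff:
  "\<lbrakk>a \<in> Obj C; b \<in> Obj C; f \<in> Hom C a b; g \<in> Hom C a b\<rbrakk> \<Longrightarrow> hdiff a b f g = hzero a b \<longleftrightarrow> f = g"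
  using mdiff_eq_zero_iff[OF hom_module] by (simp add: hdiff_def carrier_hom)

lemma comp_hdiff_right:
  "\<lbrakk>a \<in> Obj C; b \<in> Obj C; c \<in> Obj C; f \<in> Hom C a b; f' \<in> Hom C a b; g \<in> Hom C b c\<rbrakk>
    \<Longrightarrow> Comp C a b c g (hdiff a b f f') = hdiff a c (Comp C a b c g f) (Comp C a b c g f')"
  unfolding hdiff_def
  by (rule mod_hom_mdiff[OF hom_module postcomp_mod_hom]) (simp_all add: carrier_hom)

lemma comp_hdiff_left:
  "\<lbrakk>a \<in> Obj C; b \<in> Obj C; c \<in> Obj C; f \<in> Hom C a b; g \<in> Hom C b c; g' \<in> Hom C b c\<rbrakk>
    \<Longrightarrow> Comp C a b c (hdiff b c g g') f = hdiff a c (Comp C a b c g f) (Comp C a b c g' f)"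
  unfolding hdiff_def
  by (rule mod_hom_mdiff[where h = "\<lambda>g. Comp C a b c g f", OF hom_module precomp_mod_hom])
    (simp_all add: carrier_hom)

lemma hom_l_zero: "\<lbrakk>a \<in> Obj C; b \<in> Obj C; f \<in> Hom C a b\<rbrakk> \<Longrightarrow> hzero a b \<oplus>\<^bsub>HomMod C a b\<^esub> f = f"
  and hom_r_zero: "\<lbrakk>a \<in> Obj C; b \<in> Obj C; f \<in> Hom C a b\<rbrakk> \<Longrightarrow> f \<oplus>\<^bsub>HomMod C a b\<^esub> hzero a b = f"
  by (simp_all add: module_l_zero[OF hom_module] module_r_zero[OF hom_module] carrier_hom)

lemma is_epiI:
  assumes "a \<in> Obj C" "b \<in> Obj C" "f \<in> Hom C a b"
    and "\<And>c g. \<lbrakk>c \<in> Obj C; g \<in> Hom C b c; Comp C a b c g f = hzero a c\<rbrakk> \<Longrightarrow> g = hzero b c"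
  shows "is_epi C a b f"
  unfolding is_epi_def
proof (intro conjI ballI impI)
  fix c g h
  assume *: "c \<in> Obj C" "g \<in> Hom C b c" "h \<in> Hom C b c" "Comp C a b c g f = Comp C a b c h f"
  have "Comp C a b c (hdiff b c g h) f = hzero a c"
    using assms * by (simp add: comp_hdiff_left hdiff_zero_iff comp_closed)
  then have "hdiff b c g h = hzero b c" using assms * by (simp add: hdiff_closed)
  then show "g = h" using assms * by (simp add: hdiff_zero_iff)
qed (rule assms)

lemma is_epiD:
  "\<lbrakk>is_epi C a b f; a \<in> Obj C; b \<in> Obj C; c \<in> Obj C; g \<in> Hom C b c; Comp C a b c g f = hzero a c\<rbrakk>
    \<Longrightarrow> g = hzero b c"
  by (metis is_epi_def comp_zero_left zero_hom)

lemma is_monoD: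
  "\<lbrakk>is_mono C a b f; a \<in> Obj C; b \<in> Obj C; c \<in> Obj C; g \<in> Hom C c a; Comp C c a b f g = hzero c b\<rbrakk>
    \<Longrightarrow> g = hzero c a"
  by (metis is_mono_def comp_zero_right zero_hom)

lemma is_monoI:
  assumes "a \<in> Obj C" "b \<in> Obj C" "f \<in> Hom C a b"
    and "\<And>c g. \<lbrakk>c \<in> Obj C; g \<in> Hom C c a; Comp C c a b f g = hzero c b\<rbrakk> \<Longrightarrow> g = hzero c a"
  shows "is_mono C a b f"
  unfolding is_mono_def
proof (intro conjI ballI impI)
  fix c g h
  assume *: "c \<in> Obj C" "g \<in> Hom C c a" "h \<in> Hom C c a" "Comp C c a b f g = Comp C c a b f h"
  have "Comp C c a b f (hdiff c a g h) = hzero c b"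
    using assms * by (simp add: comp_hdiff_right hdiff_zero_iff comp_closed)
  then have "hdiff c a g h = hzero c a" using assms * by (simp add: hdiff_closed)
  then show "g = h" using assms * by (simp add: hdiff_zero_iff)
qed (rule assms)

lemma cokernelD:
  assumes "is_cokernel C w v u p q"
  shows "p \<in> Hom C w v" "q \<in> Hom C v u" "Comp C w v u q p = hzero w u"
  using assms by (auto simp: is_cokernel_def)

lemma cokernel_factor:
  assumes "is_cokernel C w v u p q" "d \<in> Obj C" "g \<in> Hom C v d" "Comp C w v d g p = hzero w d"
  obtains h where "h \<in> Hom C u d" "Comp C v u d h q = g"
  using assms unfolding is_cokernel_def by blast

lemma cokernel_cancel:
  assumes "is_cokernel C w v u p q" "w \<in> Obj C" "v \<in> Obj C" "u \<in> Obj C" "d \<in> Obj C"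
    "g \<in> Hom C u d" "h \<in> Hom C u d" "Comp C v u d g q = Comp C v u d h q"
  shows "g = h"
proof -
  note c = cokernelD[OF assms(1)]
  have "Comp C w v d (Comp C v u d g q) p = hzero w d"
    using assms c by (simp flip: comp_assoc add: comp_zero_right)
  moreover have "Comp C v u d g q \<in> Hom C v d" using assms c by (simp add: comp_closed)
  ultimately have "\<exists>!h. h \<in> Hom C u d \<and> Comp C v u d h q = Comp C v u d g q"
    using assms(1,5) unfolding is_cokernel_def by blast
  then show ?thesis using assms(6-8) by auto
qed

lemma cokernel_epi:
  "\<lbrakk>is_cokernel C w v u p q; w \<in> Obj C; v \<in> Obj C; u \<in> Obj C\<rbrakk> \<Longrightarrow> is_epi C v u q"
  unfolding is_epi_def using cokernel_cancel cokernelD by blast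

lemma is_cokernelI:
  assumes "w \<in> Obj C" "v \<in> Obj C" "u \<in> Obj C" "p \<in> Hom C w v" "Comp C w v u q p = hzero w u"
    and "is_epi C v u q"
    and "\<And>d g. \<lbrakk>d \<in> Obj C; g \<in> Hom C v d; Comp C w v d g p = hzero w d\<rbrakk> \<Longrightarrow>
      \<exists>h. h \<in> Hom C u d \<and> Comp C v u d h q = g"
  shows "is_cokernel C w v u p q"
  unfolding is_cokernel_def
proof (intro conjI ballI impI)
  show "q \<in> Hom C v u" using assms(6) by (simp add: is_epi_def)
  fix d g assume *: "d \<in> Obj C" "g \<in> Hom C v d" "Comp C w v d g p = hzero w d"
  from assms(7)[OF *] obtain h where h: "h \<in> Hom C u d" "Comp C v u d h q = g" by auto
  show "\<exists>!h. h \<in> Hom C u d \<and> Comp C v u d h q = g"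
  proof (rule ex1I)
    show "h' = h" if "h' \<in> Hom C u d \<and> Comp C v u d h' q = g" for h'
      using assms(6) h that *(1) unfolding is_epi_def by auto
  qed (use h in auto)
qed (rule assms)+

lemma kernelD:
  assumes "is_kernel C k a b i f"
  shows "i \<in> Hom C k a" "f \<in> Hom C a b" "Comp C k a b f i = hzero k b"
  using assms by (auto simp: is_kernel_def)

lemma kernel_factor:
  assumes "is_kernel C k a b i f" "d \<in> Obj C" "g \<in> Hom C d a" "Comp C d a b f g = hzero d b"
  obtains h where "h \<in> Hom C d k" "Comp C d k a i h = g"
  using assms unfolding is_kernel_def by blast

lemma kernel_mono:
  assumes "is_kernel C k a b i f" "k \<in> Obj C" "a \<in> Obj C" "b \<in> Obj C"
  shows "is_mono C k a i"
  unfolding is_mono_def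
proof (intro conjI ballI impI)
  note c = kernelD[OF assms(1)]
  show "i \<in> Hom C k a" by (rule c)
  fix d g h assume *: "d \<in> Obj C" "g \<in> Hom C d k" "h \<in> Hom C d k" "Comp C d k a i g = Comp C d k a i h"
  have "Comp C d a b f (Comp C d k a i g) = hzero d b"
    using assms c * by (simp add: comp_assoc comp_zero_left)
  moreover have "Comp C d k a i g \<in> Hom C d a" using assms c * by (simp add: comp_closed)
  ultimately have "\<exists>!h. h \<in> Hom C d k \<and> Comp C d k a i h = Comp C d k a i g"
    using assms(1) *(1) unfolding is_kernel_def by blast
  then show "g = h" using * by auto
qed

lemma is_kernelI:
  assumes "k \<in> Obj C" "a \<in> Obj C" "b \<in> Obj C" "f \<in> Hom C a b" "Comp C k a b f i = hzero k b"
    and "is_mono C k a i"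
    and "\<And>d g. \<lbrakk>d \<in> Obj C; g \<in> Hom C d a; Comp C d a b f g = hzero d b\<rbrakk> \<Longrightarrow>
      \<exists>h. h \<in> Hom C d k \<and> Comp C d k a i h = g"
  shows "is_kernel C k a b i f"
  unfolding is_kernel_def
proof (intro conjI ballI impI)
  show "i \<in> Hom C k a" using assms(6) by (simp add: is_mono_def)
  fix d g assume *: "d \<in> Obj C" "g \<in> Hom C d a" "Comp C d a b f g = hzero d b"
  from assms(7)[OF *] obtain h where h: "h \<in> Hom C d k" "Comp C d k a i h = g" by auto
  show "\<exists>!h. h \<in> Hom C d k \<and> Comp C d k a i h = g"
  proof (rule ex1I)
    show "h' = h" if "h' \<in> Hom C d k \<and> Comp C d k a i h' = g" for h'
      using assms(6) h that *(1) unfolding is_mono_def by auto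
  qed (use h in auto)
qed (rule assms)+

end

section \<open>Presheaves and filtered colimits\<close>

abbreviation el :: "('o, 'm, 'r, 'v) presheaf \<Rightarrow> 'o \<Rightarrow> 'v set" where
  "el F a \<equiv> carrier (Val F a)"

abbreviation elzero :: "('o, 'm, 'r, 'v) presheaf \<Rightarrow> 'o \<Rightarrow> 'v" where
  "elzero F a \<equiv> \<zero>\<^bsub>Val F a\<^esub>"

context linear_presheaf
begin

lemma act_closed: "\<lbrakk>a \<in> Obj C; b \<in> Obj C; f \<in> Hom C a b; x \<in> el F b\<rbrakk> \<Longrightarrow> Act F a b f x \<in> el F a"
  by (rule mod_hom_closed[OF act_hom])

lemma act_zero: "\<lbrakk>a \<in> Obj C; b \<in> Obj C; f \<in> Hom C a b\<rbrakk> \<Longrightarrow> Act F a b f (elzero F b) = elzero F a"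
  by (rule mod_hom_zero[OF val_module val_module act_hom])

lemma act_el_add:
  "\<lbrakk>a \<in> Obj C; b \<in> Obj C; f \<in> Hom C a b; x \<in> el F b; y \<in> el F b\<rbrakk>
    \<Longrightarrow> Act F a b f (x \<oplus>\<^bsub>Val F b\<^esub> y) = Act F a b f x \<oplus>\<^bsub>Val F a\<^esub> Act F a b f y"
  by (rule mod_hom_add[OF act_hom])

lemma act_el_smult:
  "\<lbrakk>a \<in> Obj C; b \<in> Obj C; f \<in> Hom C a b; r \<in> carrier R; x \<in> el F b\<rbrakk>
    \<Longrightarrow> Act F a b f (r \<odot>\<^bsub>Val F b\<^esub> x) = r \<odot>\<^bsub>Val F a\<^esub> Act F a b f x"
  by (rule mod_hom_smult[OF act_hom])

lemma el_zero: "a \<in> Obj C \<Longrightarrow> elzero F a \<in> el F a"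
  by (rule module_zero_closed[OF val_module])

lemma el_add: "\<lbrakk>a \<in> Obj C; x \<in> el F a; y \<in> el F a\<rbrakk> \<Longrightarrow> x \<oplus>\<^bsub>Val F a\<^esub> y \<in> el F a"
  by (rule module_add_closed[OF val_module])

lemma el_smult: "\<lbrakk>a \<in> Obj C; r \<in> carrier R; x \<in> el F a\<rbrakk> \<Longrightarrow> r \<odot>\<^bsub>Val F a\<^esub> x \<in> el F a"
  by (rule module.smult_closed[OF val_module])

lemma act_mod_hom:
  "\<lbrakk>a \<in> Obj C; b \<in> Obj C; x \<in> el F b\<rbrakk> \<Longrightarrow> (\<lambda>f. Act F a b f x) \<in> mod_hom R (HomMod C a b) (Val F a)"
  by (rule mod_homI) (simp_all add: carrier_hom act_closed act_add act_smult)

lemma act_hzero: "\<lbrakk>a \<in> Obj C; b \<in> Obj C; x \<in> el F b\<rbrakk> \<Longrightarrow> Act F a b (hzero a b) x = elzero F a"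
  using mod_hom_zero[OF hom_module val_module act_mod_hom] by blast

lemma act_hdiff:
  "\<lbrakk>a \<in> Obj C; b \<in> Obj C; f \<in> Hom C a b; g \<in> Hom C a b; x \<in> el F b\<rbrakk>
    \<Longrightarrow> Act F a b (hdiff a b f g) x = mdiff R (Val F a) (Act F a b f x) (Act F a b g x)"
  unfolding hdiff_def
  by (rule mod_hom_mdiff[where h = "\<lambda>f. Act F a b f x", OF hom_module act_mod_hom])
    (simp_all add: carrier_hom)

end

context linear_category
begin

definition presheaf_map ::
    "('o, 'm, 'r, 'v) presheaf \<Rightarrow> ('o, 'm, 'r, 'w) presheaf \<Rightarrow> ('o \<Rightarrow> 'v \<Rightarrow> 'w) \<Rightarrow> bool" where
  "presheaf_map F G t \<longleftrightarrow> (\<forall>a\<in>Obj C. t a \<in> mod_hom R (Val F a) (Val G a)) \<and>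
     (\<forall>a\<in>Obj C. \<forall>b\<in>Obj C. \<forall>f\<in>Hom C a b. \<forall>x\<in>el F b. t a (Act F a b f x) = Act G a b f (t b x))"

lemma presheaf_map_hom: "\<lbrakk>presheaf_map F G t; a \<in> Obj C\<rbrakk> \<Longrightarrow> t a \<in> mod_hom R (Val F a) (Val G a)"
  and presheaf_map_act: "\<lbrakk>presheaf_map F G t; a \<in> Obj C; b \<in> Obj C; f \<in> Hom C a b; x \<in> el F b\<rbrakk>
      \<Longrightarrow> t a (Act F a b f x) = Act G a b f (t b x)"
  by (auto simp: presheaf_map_def)

lemma presheaf_mapI:
  assumes "\<And>a x. \<lbrakk>a \<in> Obj C; x \<in> el F a\<rbrakk> \<Longrightarrow> t a x \<in> el G a"
    and "\<And>a x y. \<lbrakk>a \<in> Obj C; x \<in> el F a; y \<in> el F a\<rbrakk> \<Longrightarrow> t a (x \<oplus>\<^bsub>Val F a\<^esub> y) = t a x \<oplus>\<^bsub>Val G a\<^esub> t a y"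
    and "\<And>a r x. \<lbrakk>a \<in> Obj C; r \<in> carrier R; x \<in> el F a\<rbrakk> \<Longrightarrow> t a (r \<odot>\<^bsub>Val F a\<^esub> x) = r \<odot>\<^bsub>Val G a\<^esub> t a x"
    and "\<And>a b f x. \<lbrakk>a \<in> Obj C; b \<in> Obj C; f \<in> Hom C a b; x \<in> el F b\<rbrakk> \<Longrightarrow> t a (Act F a b f x) = Act G a b f (t b x)"
  shows "presheaf_map F G t"
  unfolding presheaf_map_def using assms by (auto intro!: mod_homI)

lemma presheaf_map_closed: "\<lbrakk>presheaf_map F G t; a \<in> Obj C; x \<in> el F a\<rbrakk> \<Longrightarrow> t a x \<in> el G a"
  by (rule mod_hom_closed[OF presheaf_map_hom])

lemma presheaf_map_add: "\<lbrakk>presheaf_map F G t; a \<in> Obj C; x \<in> el F a; y \<in> el F a\<rbrakk>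
    \<Longrightarrow> t a (x \<oplus>\<^bsub>Val F a\<^esub> y) = t a x \<oplus>\<^bsub>Val G a\<^esub> t a y"
  by (rule mod_hom_add[OF presheaf_map_hom])

lemma presheaf_map_smult: "\<lbrakk>presheaf_map F G t; a \<in> Obj C; r \<in> carrier R; x \<in> el F a\<rbrakk>
    \<Longrightarrow> t a (r \<odot>\<^bsub>Val F a\<^esub> x) = r \<odot>\<^bsub>Val G a\<^esub> t a x"
  by (rule mod_hom_smult[OF presheaf_map_hom])

lemma presheaf_map_zero:
  "\<lbrakk>presheaf_map F G t; linear_presheaf R C F; linear_presheaf R C G; a \<in> Obj C\<rbrakk> \<Longrightarrow> t a (elzero F a) = elzero G a"
  by (rule mod_hom_zero[OF linear_presheaf.val_module linear_presheaf.val_module presheaf_map_hom])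

lemma presheaf_map_comp:
  "\<lbrakk>presheaf_map F G s; presheaf_map G H t\<rbrakk> \<Longrightarrow> presheaf_map F H (\<lambda>a x. t a (s a x))"
  by (rule presheaf_mapI)
    (simp_all add: presheaf_map_closed[of F G s] presheaf_map_closed[of G H t] presheaf_map_add[of F G s]
      presheaf_map_add[of G H t] presheaf_map_smult[of F G s] presheaf_map_smult[of G H t]
      presheaf_map_act[of F G s] presheaf_map_act[of G H t])

text \<open>As all maps are linear, the condition on elements that become zero also decides equality.\<close>

definition pw_colimit ::
    "('i, 'j, 'y) cat_scheme \<Rightarrow> ('i \<Rightarrow> ('o, 'm, 'r, 'v) presheaf) \<Rightarrow> ('i \<Rightarrow> 'i \<Rightarrow> 'j \<Rightarrow> 'o \<Rightarrow> 'v \<Rightarrow> 'v) \<Rightarrow>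
      ('o, 'm, 'r, 'w) presheaf \<Rightarrow> ('i \<Rightarrow> 'o \<Rightarrow> 'v \<Rightarrow> 'w) \<Rightarrow> bool" where
  "pw_colimit I D E G l \<longleftrightarrow> linear_presheaf R C G \<and>
     (\<forall>i\<in>Obj I. presheaf_map (D i) G (l i)) \<and>
     (\<forall>i\<in>Obj I. \<forall>j\<in>Obj I. \<forall>u\<in>Hom I i j. \<forall>a\<in>Obj C. \<forall>x\<in>el (D i) a. l j a (E i j u a x) = l i a x) \<and>
     (\<forall>a\<in>Obj C. \<forall>z\<in>el G a. \<exists>i\<in>Obj I. \<exists>x\<in>el (D i) a. z = l i a x) \<and>
     (\<forall>i\<in>Obj I. \<forall>a\<in>Obj C. \<forall>x\<in>el (D i) a. l i a x = elzero G a \<longrightarrow>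
        (\<exists>j\<in>Obj I. \<exists>u\<in>Hom I i j. E i j u a x = elzero (D j) a))"

lemma pw_colimit_psh: "pw_colimit I D E G l \<Longrightarrow> linear_presheaf R C G"
  and pw_colimit_map: "\<lbrakk>pw_colimit I D E G l; i \<in> Obj I\<rbrakk> \<Longrightarrow> presheaf_map (D i) G (l i)"
  and pw_colimit_cocone: "\<lbrakk>pw_colimit I D E G l; i \<in> Obj I; j \<in> Obj I; u \<in> Hom I i j; a \<in> Obj C; x \<in> el (D i) a\<rbrakk>
      \<Longrightarrow> l j a (E i j u a x) = l i a x"
  by (simp_all add: pw_colimit_def)

lemma pw_colimit_surj:
  assumes "pw_colimit I D E G l" "a \<in> Obj C" "z \<in> el G a"
  obtains i x where "i \<in> Obj I" "x \<in> el (D i) a" "z = l i a x"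
  using assms unfolding pw_colimit_def by blast

lemma pw_colimit_zeroD:
  assumes "pw_colimit I D E G l" "i \<in> Obj I" "a \<in> Obj C" "x \<in> el (D i) a" "l i a x = elzero G a"
  obtains j u where "j \<in> Obj I" "u \<in> Hom I i j" "E i j u a x = elzero (D j) a"
  using assms unfolding pw_colimit_def by blast

end

locale filtered_system = linear_category R C
  for R :: "('r, 'k) ring_scheme" (structure) and C :: "('o, 'm, 'r, 'z) lcat_scheme" +
  fixes I :: "('i, 'j, 'y) cat_scheme"
    and D :: "'i \<Rightarrow> ('o, 'm, 'r, 'v) presheaf"
    and E :: "'i \<Rightarrow> 'i \<Rightarrow> 'j \<Rightarrow> 'o \<Rightarrow> 'v \<Rightarrow> 'v"
  assumes filtered: "filtered_cat I"
    and D_psh: "i \<in> Obj I \<Longrightarrow> linear_presheaf R C (D i)"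
    and E_map: "\<lbrakk>i \<in> Obj I; j \<in> Obj I; u \<in> Hom I i j\<rbrakk> \<Longrightarrow> presheaf_map (D i) (D j) (E i j u)"
    and E_id: "\<lbrakk>i \<in> Obj I; a \<in> Obj C; x \<in> el (D i) a\<rbrakk> \<Longrightarrow> E i i (Id I i) a x = x"
    and E_comp: "\<lbrakk>i \<in> Obj I; j \<in> Obj I; k \<in> Obj I; u \<in> Hom I i j; v \<in> Hom I j k; a \<in> Obj C; x \<in> el (D i) a\<rbrakk>
        \<Longrightarrow> E i k (Comp I i j k v u) a x = E j k v a (E i j u a x)"
begin

lemmas E_closed = presheaf_map_closed[OF E_map]
lemmas E_add = presheaf_map_add[OF E_map]
lemmas E_smult = presheaf_map_smult[OF E_map]
lemmas E_act = presheaf_map_act[OF E_map]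
lemmas E_zero = presheaf_map_zero[OF E_map D_psh D_psh]
lemmas D_zero = linear_presheaf.el_zero[OF D_psh]
lemmas D_add = linear_presheaf.el_add[OF D_psh]
lemmas D_smult = linear_presheaf.el_smult[OF D_psh]
lemmas D_mod = linear_presheaf.val_module[OF D_psh]
lemmas D_act = linear_presheaf.act_closed[OF D_psh]

lemma index_category: "category I" using filtered by (simp add: filtered_cat_def)

lemmas index_comp = category.comp_closed[OF index_category]
lemmas index_id = category.id_closed[OF index_category]

lemma index_join:
  assumes "i \<in> Obj I" "j \<in> Obj I"
  obtains k u v where "k \<in> Obj I" "u \<in> Hom I i k" "v \<in> Hom I j k"
  using filtered assms unfolding filtered_cat_def by fast

lemma index_coeq:
  assumes "i \<in> Obj I" "j \<in> Obj I" "u \<in> Hom I i j" "v \<in> Hom I i j"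
  obtains k w where "k \<in> Obj I" "w \<in> Hom I j k" "Comp I i j k w u = Comp I i j k w v"
  using filtered assms unfolding filtered_cat_def by fast

lemma index_amalg:
  assumes i: "i \<in> Obj I" "j \<in> Obj I" "k \<in> Obj I" "u \<in> Hom I i j" "v \<in> Hom I i k"
  obtains l w w' where "l \<in> Obj I" "w \<in> Hom I j l" "w' \<in> Hom I k l" "Comp I i j l w u = Comp I i k l w' v"
proof -
  obtain m s t where m: "m \<in> Obj I" "s \<in> Hom I j m" "t \<in> Hom I k m" using index_join i by metis
  obtain l r where l: "l \<in> Obj I" "r \<in> Hom I m l"
    "Comp I i m l r (Comp I i j m s u) = Comp I i m l r (Comp I i k m t v)"
    using index_coeq[of i m "Comp I i j m s u" "Comp I i k m t v"] i m index_comp by metis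
  show ?thesis
    by (rule that[of l "Comp I j m l r s" "Comp I k m l r t"])
      (use i m l category.comp_assoc[OF index_category] index_comp in auto)
qed

definition eventually_eq :: "'o \<Rightarrow> 'i \<Rightarrow> 'v \<Rightarrow> 'i \<Rightarrow> 'v \<Rightarrow> bool" where
  "eventually_eq a i x j y \<longleftrightarrow> (\<exists>k\<in>Obj I. \<exists>u\<in>Hom I i k. \<exists>v\<in>Hom I j k. E i k u a x = E j k v a y)"

lemma eventually_eq_refl: "i \<in> Obj I \<Longrightarrow> eventually_eq a i x i x"
  unfolding eventually_eq_def using index_id by blast

lemma eventually_eq_sym: "eventually_eq a i x j y \<Longrightarrow> eventually_eq a j y i x"
  unfolding eventually_eq_def by metis

lemma eventually_eq_trans:
  assumes ij: "eventually_eq a i x j y" and jk: "eventually_eq a j y k z"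
    and o: "i \<in> Obj I" "j \<in> Obj I" "k \<in> Obj I" "a \<in> Obj C"
    and el: "x \<in> el (D i) a" "y \<in> el (D j) a" "z \<in> el (D k) a"
  shows "eventually_eq a i x k z"
proof -
  obtain l u v where l: "l \<in> Obj I" "u \<in> Hom I i l" "v \<in> Hom I j l" "E i l u a x = E j l v a y"
    using ij by (auto simp: eventually_eq_def)
  obtain l' v' w where l': "l' \<in> Obj I" "v' \<in> Hom I j l'" "w \<in> Hom I k l'" "E j l' v' a y = E k l' w a z"
    using jk by (auto simp: eventually_eq_def)
  obtain m s t where m: "m \<in> Obj I" "s \<in> Hom I l m" "t \<in> Hom I l' m" "Comp I j l m s v = Comp I j l' m t v'"
    using index_amalg[of j l l' v v'] o l l' by metis
  have "E i m (Comp I i l m s u) a x = E l m s a (E j l v a y)"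
    using o el l m by (simp add: E_comp)
  also have "\<dots> = E j m (Comp I j l m s v) a y"
    by (rule E_comp[symmetric]) (use o el l m in auto)
  also have "\<dots> = E k m (Comp I k l' m t w) a z"
    using o el l' m by (simp add: E_comp)
  finally show ?thesis
    unfolding eventually_eq_def using o l l' m index_comp by metis
qed

end

locale filtered_colim = filtered_system R C I D E
  for R :: "('r, 'k) ring_scheme" (structure) and C :: "('o, 'm, 'r, 'z) lcat_scheme"
    and I :: "('i, 'j, 'y) cat_scheme"
    and D :: "'i \<Rightarrow> ('o, 'm, 'r, 'v) presheaf"
    and E :: "'i \<Rightarrow> 'i \<Rightarrow> 'j \<Rightarrow> 'o \<Rightarrow> 'v \<Rightarrow> 'v" +
  fixes \<gamma> :: "'i \<Rightarrow> 'o \<Rightarrow> 'v \<Rightarrow> 'u"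
  assumes \<gamma>_eq_iff: "\<lbrakk>a \<in> Obj C; i \<in> Obj I; j \<in> Obj I; x \<in> el (D i) a; y \<in> el (D j) a\<rbrakk>
    \<Longrightarrow> \<gamma> i a x = \<gamma> j a y \<longleftrightarrow> eventually_eq a i x j y"
begin

lemma \<gamma>_trans:
  assumes "a \<in> Obj C" "i \<in> Obj I" "j \<in> Obj I" "u \<in> Hom I i j" "x \<in> el (D i) a"
  shows "\<gamma> j a (E i j u a x) = \<gamma> i a x"
proof -
  have "eventually_eq a j (E i j u a x) i x"
    unfolding eventually_eq_def using assms index_id E_id E_closed by blast
  then show ?thesis using assms by (simp add: \<gamma>_eq_iff E_closed)
qed

lemma \<gamma>_eqE:
  assumes "a \<in> Obj C" "i \<in> Obj I" "j \<in> Obj I" "x \<in> el (D i) a" "y \<in> el (D j) a" "\<gamma> i a x = \<gamma> j a y"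
  obtains k u v where "k \<in> Obj I" "u \<in> Hom I i k" "v \<in> Hom I j k" "E i k u a x = E j k v a y"
  using assms by (auto simp: \<gamma>_eq_iff eventually_eq_def)

definition cel :: "'o \<Rightarrow> 'u set" where
  "cel a = {\<gamma> i a x |i x. i \<in> Obj I \<and> x \<in> el (D i) a}"

definition cadd :: "'o \<Rightarrow> 'u \<Rightarrow> 'u \<Rightarrow> 'u" where
  "cadd a s t = (SOME z. \<exists>k x y. k \<in> Obj I \<and> x \<in> el (D k) a \<and> y \<in> el (D k) a \<and>
     s = \<gamma> k a x \<and> t = \<gamma> k a y \<and> z = \<gamma> k a (x \<oplus>\<^bsub>Val (D k) a\<^esub> y))"

definition csmult :: "'o \<Rightarrow> 'r \<Rightarrow> 'u \<Rightarrow> 'u" where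
  "csmult a r s = (SOME z. \<exists>k x. k \<in> Obj I \<and> x \<in> el (D k) a \<and>
     s = \<gamma> k a x \<and> z = \<gamma> k a (r \<odot>\<^bsub>Val (D k) a\<^esub> x))"

definition czero :: "'o \<Rightarrow> 'u" where
  "czero a = (let i = SOME i. i \<in> Obj I in \<gamma> i a (elzero (D i) a))"

definition cact :: "'o \<Rightarrow> 'o \<Rightarrow> 'm \<Rightarrow> 'u \<Rightarrow> 'u" where
  "cact a b f s = (SOME z. \<exists>k x. k \<in> Obj I \<and> x \<in> el (D k) b \<and> s = \<gamma> k b x \<and> z = \<gamma> k a (Act (D k) a b f x))"

definition colim :: "('o, 'm, 'r, 'u) presheaf" where
  "colim = \<lparr>Val = (\<lambda>a. \<lparr>carrier = cel a, mult = undefined, one = undefined, zero = czero a,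
      add = cadd a, smult = csmult a\<rparr>), Act = cact\<rparr>"

lemma \<gamma>_in_cel: "\<lbrakk>i \<in> Obj I; x \<in> el (D i) a\<rbrakk> \<Longrightarrow> \<gamma> i a x \<in> cel a"
  by (auto simp: cel_def)

lemma celE:
  assumes "s \<in> cel a" obtains i x where "i \<in> Obj I" "x \<in> el (D i) a" "s = \<gamma> i a x"
  using assms by (auto simp: cel_def)

lemma celE2:
  assumes "a \<in> Obj C" "s \<in> cel a" "t \<in> cel a"
  obtains i x y where "i \<in> Obj I" "x \<in> el (D i) a" "y \<in> el (D i) a" "s = \<gamma> i a x" "t = \<gamma> i a y"
proof -
  obtain i x where i: "i \<in> Obj I" "x \<in> el (D i) a" "s = \<gamma> i a x" using assms by (auto elim: celE)
  obtain j y where j: "j \<in> Obj I" "y \<in> el (D j) a" "t = \<gamma> j a y" using assms by (auto elim: celE)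
  obtain k u v where k: "k \<in> Obj I" "u \<in> Hom I i k" "v \<in> Hom I j k" using index_join[OF i(1) j(1)] .
  show ?thesis
    by (rule that[of k "E i k u a x" "E j k v a y"]) (use assms i j k E_closed \<gamma>_trans in auto)
qed

lemma celE3:
  assumes "a \<in> Obj C" "s \<in> cel a" "t \<in> cel a" "r \<in> cel a"
  obtains i x y z where "i \<in> Obj I" "x \<in> el (D i) a" "y \<in> el (D i) a" "z \<in> el (D i) a"
    "s = \<gamma> i a x" "t = \<gamma> i a y" "r = \<gamma> i a z"
proof -
  obtain i x y where i: "i \<in> Obj I" "x \<in> el (D i) a" "y \<in> el (D i) a" "s = \<gamma> i a x" "t = \<gamma> i a y"
    using assms by (auto elim: celE2)
  obtain j z where j: "j \<in> Obj I" "z \<in> el (D j) a" "r = \<gamma> j a z" using assms by (auto elim: celE)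
  obtain k u v where k: "k \<in> Obj I" "u \<in> Hom I i k" "v \<in> Hom I j k" using index_join[OF i(1) j(1)] .
  show ?thesis
    by (rule that[of k "E i k u a x" "E i k u a y" "E j k v a z"])
      (use assms i j k E_closed \<gamma>_trans in auto)
qed

lemma \<gamma>_add_cong:
  assumes a: "a \<in> Obj C" and i: "i \<in> Obj I" "x \<in> el (D i) a" "y \<in> el (D i) a"
    and j: "j \<in> Obj I" "x' \<in> el (D j) a" "y' \<in> el (D j) a"
    and eq: "\<gamma> i a x = \<gamma> j a x'" "\<gamma> i a y = \<gamma> j a y'"
  shows "\<gamma> i a (x \<oplus>\<^bsub>Val (D i) a\<^esub> y) = \<gamma> j a (x' \<oplus>\<^bsub>Val (D j) a\<^esub> y')"
proof -
  obtain k u v where k: "k \<in> Obj I" "u \<in> Hom I i k" "v \<in> Hom I j k" "E i k u a x = E j k v a x'"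
    using \<gamma>_eqE[OF a i(1) j(1) i(2) j(2) eq(1)] .
  obtain l u' v' where l: "l \<in> Obj I" "u' \<in> Hom I i l" "v' \<in> Hom I j l" "E i l u' a y = E j l v' a y'"
    using \<gamma>_eqE[OF a i(1) j(1) i(3) j(3) eq(2)] .
  obtain m w w' where m: "m \<in> Obj I" "w \<in> Hom I k m" "w' \<in> Hom I l m"
      "Comp I i k m w u = Comp I i l m w' u'"
    using index_amalg[OF i(1) k(1) l(1) k(2) l(2)] .
  have vw: "Comp I j k m w v \<in> Hom I j m" "Comp I j l m w' v' \<in> Hom I j m"
    using m k l j i index_comp by auto
  obtain n t where n: "n \<in> Obj I" "t \<in> Hom I m n"
      "Comp I j m n t (Comp I j k m w v) = Comp I j m n t (Comp I j l m w' v')"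
    using index_coeq[OF j(1) m(1) vw] .
  let ?u = "Comp I i m n t (Comp I i k m w u)" and ?v = "Comp I j m n t (Comp I j k m w v)"
  have uv: "?u \<in> Hom I i n" "?v \<in> Hom I j n"
    by (rule index_comp[OF i(1) m(1) n(1) index_comp[OF i(1) k(1) m(1) k(2) m(2)] n(2)])
      (rule index_comp[OF j(1) m(1) n(1) vw(1) n(2)])
  have x: "E i n ?u a x = E j n ?v a x'"
    using a i j k m(1-3) n(1,2) vw by (simp add: E_comp index_comp E_closed)
  have "E i n ?u a y = E i n (Comp I i m n t (Comp I i l m w' u')) a y" using m by simp
  also have "\<dots> = E j n ?v a y'"
    unfolding n(3) using a i j l m n vw by (simp add: E_comp index_comp E_closed)
  finally have "E i n ?u a (x \<oplus>\<^bsub>Val (D i) a\<^esub> y) = E j n ?v a (x' \<oplus>\<^bsub>Val (D j) a\<^esub> y')"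
    using x uv a i j n by (simp add: E_add)
  then show ?thesis
    using a i j n uv by (metis \<gamma>_trans D_add)
qed

lemma cadd_\<gamma>:
  assumes "a \<in> Obj C" "i \<in> Obj I" "x \<in> el (D i) a" "y \<in> el (D i) a"
  shows "cadd a (\<gamma> i a x) (\<gamma> i a y) = \<gamma> i a (x \<oplus>\<^bsub>Val (D i) a\<^esub> y)"
  unfolding cadd_def
proof (rule some_equality)
  show "\<exists>k x' y'. k \<in> Obj I \<and> x' \<in> el (D k) a \<and> y' \<in> el (D k) a \<and> \<gamma> i a x = \<gamma> k a x' \<and>
      \<gamma> i a y = \<gamma> k a y' \<and> \<gamma> i a (x \<oplus>\<^bsub>Val (D i) a\<^esub> y) = \<gamma> k a (x' \<oplus>\<^bsub>Val (D k) a\<^esub> y')"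
    using assms by blast
qed (use assms \<gamma>_add_cong in metis)

lemma csmult_\<gamma>:
  assumes a: "a \<in> Obj C" and i: "i \<in> Obj I" "x \<in> el (D i) a" and r: "r \<in> carrier R"
  shows "csmult a r (\<gamma> i a x) = \<gamma> i a (r \<odot>\<^bsub>Val (D i) a\<^esub> x)"
  unfolding csmult_def
proof (rule some_equality)
  show "\<exists>k x'. k \<in> Obj I \<and> x' \<in> el (D k) a \<and> \<gamma> i a x = \<gamma> k a x' \<and>
      \<gamma> i a (r \<odot>\<^bsub>Val (D i) a\<^esub> x) = \<gamma> k a (r \<odot>\<^bsub>Val (D k) a\<^esub> x')"
    using i by blast
  fix z assume "\<exists>k x'. k \<in> Obj I \<and> x' \<in> el (D k) a \<and> \<gamma> i a x = \<gamma> k a x' \<and> z = \<gamma> k a (r \<odot>\<^bsub>Val (D k) a\<^esub> x')"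
  then obtain j x' where j: "j \<in> Obj I" "x' \<in> el (D j) a" "\<gamma> i a x = \<gamma> j a x'"
    and z: "z = \<gamma> j a (r \<odot>\<^bsub>Val (D j) a\<^esub> x')" by blast
  obtain k u v where k: "k \<in> Obj I" "u \<in> Hom I i k" "v \<in> Hom I j k" "E i k u a x = E j k v a x'"
    using \<gamma>_eqE[OF a i(1) j(1) i(2) j(2,3)] .
  then have "E i k u a (r \<odot>\<^bsub>Val (D i) a\<^esub> x) = E j k v a (r \<odot>\<^bsub>Val (D j) a\<^esub> x')"
    using a i j r by (simp add: E_smult)
  then show "z = \<gamma> i a (r \<odot>\<^bsub>Val (D i) a\<^esub> x)"
    using z a i j k r by (metis \<gamma>_trans D_smult)
qed

lemma cact_\<gamma>:
  assumes a: "a \<in> Obj C" "b \<in> Obj C" and i: "i \<in> Obj I" "x \<in> el (D i) b" and f: "f \<in> Hom C a b"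
  shows "cact a b f (\<gamma> i b x) = \<gamma> i a (Act (D i) a b f x)"
  unfolding cact_def
proof (rule some_equality)
  show "\<exists>k x'. k \<in> Obj I \<and> x' \<in> el (D k) b \<and> \<gamma> i b x = \<gamma> k b x' \<and>
      \<gamma> i a (Act (D i) a b f x) = \<gamma> k a (Act (D k) a b f x')"
    using i by blast
  fix z assume "\<exists>k x'. k \<in> Obj I \<and> x' \<in> el (D k) b \<and> \<gamma> i b x = \<gamma> k b x' \<and> z = \<gamma> k a (Act (D k) a b f x')"
  then obtain j x' where j: "j \<in> Obj I" "x' \<in> el (D j) b" "\<gamma> i b x = \<gamma> j b x'"
    and z: "z = \<gamma> j a (Act (D j) a b f x')" by blast
  obtain k u v where k: "k \<in> Obj I" "u \<in> Hom I i k" "v \<in> Hom I j k" "E i k u b x = E j k v b x'"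
    using \<gamma>_eqE[OF a(2) i(1) j(1) i(2) j(2,3)] .
  then have "E i k u a (Act (D i) a b f x) = E j k v a (Act (D j) a b f x')"
    using a i j f by (simp add: E_act)
  then show "z = \<gamma> i a (Act (D i) a b f x)"
    using z a i j k f by (metis \<gamma>_trans D_act)
qed

lemma \<gamma>_zero:
  assumes a: "a \<in> Obj C" and i: "i \<in> Obj I"
  shows "\<gamma> i a (elzero (D i) a) = czero a"
proof -
  let ?j = "SOME i. i \<in> Obj I"
  have j: "?j \<in> Obj I" using i by (rule someI)
  obtain k u v where k: "k \<in> Obj I" "u \<in> Hom I i k" "v \<in> Hom I ?j k" using index_join[OF i j] .
  have "\<gamma> i a (elzero (D i) a) = \<gamma> k a (elzero (D k) a)"
    using \<gamma>_trans[OF a i k(1,2) D_zero[OF i a]] E_zero[OF i k(1,2) i k(1) a] by simp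
  also have "\<dots> = \<gamma> ?j a (elzero (D ?j) a)"
    using \<gamma>_trans[OF a j k(1,3) D_zero[OF j a]] E_zero[OF j k(1,3) j k(1) a] by simp
  finally show ?thesis by (simp add: czero_def Let_def)
qed

lemma colim_simps:
  "el colim a = cel a" "elzero colim a = czero a" "add (Val colim a) = cadd a"
  "smult (Val colim a) = csmult a" "Act colim = cact"
  by (simp_all add: colim_def)

lemma colim_module:
  assumes a: "a \<in> Obj C" shows "module R (Val colim a)"
proof (rule moduleI)
  show "cring R" by (rule cring_R)
  show "abelian_group (Val colim a)"
  proof (rule abelian_groupI; unfold colim_simps)
    fix s t assume st: "s \<in> cel a" "t \<in> cel a"
    obtain i x y where i: "i \<in> Obj I" "x \<in> el (D i) a" "y \<in> el (D i) a" "s = \<gamma> i a x" "t = \<gamma> i a y"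
      using celE2[OF a st] .
    interpret M: module R "Val (D i) a" using D_mod[OF i(1) a] .
    show "cadd a s t \<in> cel a" using a i by (simp add: cadd_\<gamma> \<gamma>_in_cel)
    show "cadd a s t = cadd a t s" using a i by (simp add: cadd_\<gamma> M.a_comm)
  next
    show "czero a \<in> cel a"
      using filtered a \<gamma>_zero \<gamma>_in_cel D_zero by (metis filtered_cat_def equals0I)
  next
    fix s t r assume st: "s \<in> cel a" "t \<in> cel a" "r \<in> cel a"
    obtain i x y z where i: "i \<in> Obj I" "x \<in> el (D i) a" "y \<in> el (D i) a" "z \<in> el (D i) a"
      "s = \<gamma> i a x" "t = \<gamma> i a y" "r = \<gamma> i a z"
      using celE3[OF a st] .
    interpret M: module R "Val (D i) a" using D_mod[OF i(1) a] .
    show "cadd a (cadd a s t) r = cadd a s (cadd a t r)"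
      using a i by (simp add: cadd_\<gamma> M.a_assoc)
  next
    fix s assume s: "s \<in> cel a"
    obtain i x where i: "i \<in> Obj I" "x \<in> el (D i) a" "s = \<gamma> i a x" using s by (rule celE)
    interpret M: module R "Val (D i) a" using D_mod[OF i(1) a] .
    show "cadd a (czero a) s = s"
      using a i by (simp flip: \<gamma>_zero[OF a i(1)] add: cadd_\<gamma>)
    have "cadd a (\<gamma> i a (\<ominus>\<^bsub>Val (D i) a\<^esub> x)) s = czero a"
      using a i by (simp add: cadd_\<gamma> M.M.l_neg \<gamma>_zero)
    then show "\<exists>y\<in>cel a. cadd a y s = czero a"
      using i \<gamma>_in_cel[OF i(1) M.M.a_inv_closed[OF i(2)]] by blast
  qed
next
  fix r s assume "r \<in> carrier R" "s \<in> el colim a"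
  then obtain i x where i: "i \<in> Obj I" "x \<in> el (D i) a" "s = \<gamma> i a x" by (auto simp: colim_simps elim: celE)
  then show "r \<odot>\<^bsub>Val colim a\<^esub> s \<in> el colim a"
    using \<open>r \<in> carrier R\<close> a by (simp add: colim_simps csmult_\<gamma> \<gamma>_in_cel D_smult)
next
  fix r r' s assume r: "r \<in> carrier R" "r' \<in> carrier R" and "s \<in> el colim a"
  then obtain i x where i: "i \<in> Obj I" "x \<in> el (D i) a" "s = \<gamma> i a x" by (auto simp: colim_simps elim: celE)
  interpret M: module R "Val (D i) a" using D_mod[OF i(1) a] .
  show "(r \<oplus> r') \<odot>\<^bsub>Val colim a\<^esub> s = r \<odot>\<^bsub>Val colim a\<^esub> s \<oplus>\<^bsub>Val colim a\<^esub> r' \<odot>\<^bsub>Val colim a\<^esub> s"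
    using r a i by (simp add: colim_simps csmult_\<gamma> cadd_\<gamma> M.smult_l_distr)
  show "(r \<otimes> r') \<odot>\<^bsub>Val colim a\<^esub> s = r \<odot>\<^bsub>Val colim a\<^esub> (r' \<odot>\<^bsub>Val colim a\<^esub> s)"
    using r a i by (simp add: colim_simps csmult_\<gamma> M.smult_assoc1)
next
  fix r s t assume r: "r \<in> carrier R" and "s \<in> el colim a" "t \<in> el colim a"
  then obtain i x y where i: "i \<in> Obj I" "x \<in> el (D i) a" "y \<in> el (D i) a" "s = \<gamma> i a x" "t = \<gamma> i a y"
    using a by (auto simp: colim_simps elim: celE2)
  interpret M: module R "Val (D i) a" using D_mod[OF i(1) a] .
  show "r \<odot>\<^bsub>Val colim a\<^esub> (s \<oplus>\<^bsub>Val colim a\<^esub> t) = r \<odot>\<^bsub>Val colim a\<^esub> s \<oplus>\<^bsub>Val colim a\<^esub> r \<odot>\<^bsub>Val colim a\<^esub> t"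
    using r a i by (simp add: colim_simps csmult_\<gamma> cadd_\<gamma> M.smult_r_distr)
next
  fix s assume "s \<in> el colim a"
  then obtain i x where i: "i \<in> Obj I" "x \<in> el (D i) a" "s = \<gamma> i a x" by (auto simp: colim_simps elim: celE)
  interpret M: module R "Val (D i) a" using D_mod[OF i(1) a] .
  show "\<one> \<odot>\<^bsub>Val colim a\<^esub> s = s"
    using a i by (simp add: colim_simps csmult_\<gamma>)
qed

lemma colim_presheaf: "linear_presheaf R C colim"
proof (rule linear_presheaf.intro[OF linear_category_axioms], rule linear_presheaf_axioms.intro;
    (unfold colim_simps)?)
  fix a assume "a \<in> Obj C" then show "module R (Val colim a)" by (rule colim_module)
next
  fix a b f assume ab: "a \<in> Obj C" "b \<in> Obj C" "f \<in> Hom C a b"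
  show "cact a b f \<in> mod_hom R (Val colim b) (Val colim a)"
  proof (rule mod_homI; unfold colim_simps)
    fix s assume "s \<in> cel b"
    then obtain i x where i: "i \<in> Obj I" "x \<in> el (D i) b" "s = \<gamma> i b x" by (auto elim: celE)
    show "cact a b f s \<in> cel a" using ab i by (simp add: cact_\<gamma> \<gamma>_in_cel D_act)
    fix r assume "r \<in> carrier R"
    then show "cact a b f (csmult b r s) = csmult a r (cact a b f s)"
      using ab i by (simp add: cact_\<gamma> csmult_\<gamma> D_act D_smult linear_presheaf.act_el_smult[OF D_psh])
  next
    fix s t assume "s \<in> cel b" "t \<in> cel b"
    then obtain i x y where i: "i \<in> Obj I" "x \<in> el (D i) b" "y \<in> el (D i) b" "s = \<gamma> i b x" "t = \<gamma> i b y"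
      using ab by (auto elim: celE2)
    show "cact a b f (cadd b s t) = cadd a (cact a b f s) (cact a b f t)"
      using ab i by (simp add: cact_\<gamma> cadd_\<gamma> D_act D_add linear_presheaf.act_el_add[OF D_psh])
  qed
next
  fix a s assume a: "a \<in> Obj C" "s \<in> cel a"
  then obtain i x where i: "i \<in> Obj I" "x \<in> el (D i) a" "s = \<gamma> i a x" by (auto elim: celE)
  then show "cact a a (Id C a) s = s"
    using a by (simp add: cact_\<gamma> id_closed linear_presheaf.act_id[OF D_psh])
next
  fix a b c f g s assume a: "a \<in> Obj C" "b \<in> Obj C" "c \<in> Obj C" "f \<in> Hom C a b" "g \<in> Hom C b c" "s \<in> cel c"
  then obtain i x where i: "i \<in> Obj I" "x \<in> el (D i) c" "s = \<gamma> i c x" by (auto elim: celE)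
  then show "cact a c (Comp C a b c g f) s = cact a b f (cact b c g s)"
    using a by (simp add: cact_\<gamma> comp_closed D_act linear_presheaf.act_comp[OF D_psh])
next
  fix a b f f' s assume a: "a \<in> Obj C" "b \<in> Obj C" "f \<in> Hom C a b" "f' \<in> Hom C a b" "s \<in> cel b"
  then obtain i x where i: "i \<in> Obj I" "x \<in> el (D i) b" "s = \<gamma> i b x" by (auto elim: celE)
  then show "cact a b (f \<oplus>\<^bsub>HomMod C a b\<^esub> f') s = cadd a (cact a b f s) (cact a b f' s)"
    using a by (simp add: cact_\<gamma> cadd_\<gamma> add_hom D_act linear_presheaf.act_add[OF D_psh])
next
  fix a b f r s assume a: "a \<in> Obj C" "b \<in> Obj C" "f \<in> Hom C a b" "r \<in> carrier R" "s \<in> cel b"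
  then obtain i x where i: "i \<in> Obj I" "x \<in> el (D i) b" "s = \<gamma> i b x" by (auto elim: celE)
  then show "cact a b (r \<odot>\<^bsub>HomMod C a b\<^esub> f) s = csmult a r (cact a b f s)"
    using a by (simp add: cact_\<gamma> csmult_\<gamma> smult_hom D_act linear_presheaf.act_smult[OF D_psh])
qed

lemma colim_pw_colimit: "pw_colimit I D E colim \<gamma>"
  unfolding pw_colimit_def
proof (intro conjI ballI impI)
  show "linear_presheaf R C colim" by (rule colim_presheaf)
  fix i assume i: "i \<in> Obj I"
  show "presheaf_map (D i) colim (\<gamma> i)"
    by (rule presheaf_mapI)
      (use i in \<open>simp_all add: colim_simps \<gamma>_in_cel cadd_\<gamma> csmult_\<gamma> cact_\<gamma>\<close>)
  fix a x assume a: "a \<in> Obj C" "x \<in> el (D i) a"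
  {
    fix j u assume "j \<in> Obj I" "u \<in> Hom I i j"
    then show "\<gamma> j a (E i j u a x) = \<gamma> i a x" using i a by (simp add: \<gamma>_trans)
  }
  assume "\<gamma> i a x = elzero colim a"
  then have "\<gamma> i a x = \<gamma> i a (elzero (D i) a)" using a i by (simp add: colim_simps \<gamma>_zero)
  then obtain k u v where k: "k \<in> Obj I" "u \<in> Hom I i k" "v \<in> Hom I i k"
      "E i k u a x = E i k v a (elzero (D i) a)"
    using \<gamma>_eqE[OF a(1) i i a(2) D_zero[OF i a(1)]] by metis
  then show "\<exists>j\<in>Obj I. \<exists>u\<in>Hom I i j. E i j u a x = elzero (D j) a"
    using E_zero[OF i k(1,3) i k(1) a(1)] by auto
next
  fix a z assume "a \<in> Obj C" "z \<in> el colim a"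
  then show "\<exists>i\<in>Obj I. \<exists>x\<in>el (D i) a. z = \<gamma> i a x" by (auto simp: colim_simps cel_def)
qed

end

context filtered_system
begin

lemma pw_colimit_exists:
  assumes small: "\<And>a. a \<in> Obj C \<Longrightarrow> (SIGMA i:Obj I. el (D i) a) \<lesssim> (UNIV :: 'u set)"
  shows "\<exists>(G :: ('o, 'm, 'r, 'u) presheaf) \<gamma>. pw_colimit I D E G \<gamma>"
proof -
  obtain e :: "'o \<Rightarrow> 'i \<times> 'v \<Rightarrow> 'u" where e: "\<And>a. a \<in> Obj C \<Longrightarrow> inj_on (e a) (SIGMA i:Obj I. el (D i) a)"
    using small unfolding lepoll_UNIV_iff by metis
  define rep where "rep i a x = (SOME p. p \<in> (SIGMA j:Obj I. el (D j) a) \<and> eventually_eq a i x (fst p) (snd p))"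
    for i a x
  have rep: "rep i a x \<in> (SIGMA j:Obj I. el (D j) a)" "eventually_eq a i x (fst (rep i a x)) (snd (rep i a x))"
    if "a \<in> Obj C" "i \<in> Obj I" "x \<in> el (D i) a" for i a x
  proof -
    have "\<exists>p. p \<in> (SIGMA j:Obj I. el (D j) a) \<and> eventually_eq a i x (fst p) (snd p)"
      using that eventually_eq_refl by (intro exI[of _ "(i, x)"]) auto
    from someI_ex[OF this] show "rep i a x \<in> (SIGMA j:Obj I. el (D j) a)"
      "eventually_eq a i x (fst (rep i a x)) (snd (rep i a x))"
      unfolding rep_def by auto
  qed
  interpret filtered_colim R C I D E "\<lambda>i a x. e a (rep i a x)"
  proof unfold_locales
    fix a i j x y
    assume *: "a \<in> Obj C" "i \<in> Obj I" "j \<in> Obj I" "x \<in> el (D i) a" "y \<in> el (D j) a"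
    have "rep i a x = rep j a y" if "eventually_eq a i x j y"
    proof -
      have "eventually_eq a i x k z \<longleftrightarrow> eventually_eq a j y k z" if "k \<in> Obj I" "z \<in> el (D k) a" for k z
        using * that \<open>eventually_eq a i x j y\<close> eventually_eq_trans eventually_eq_sym by metis
      then have "(\<lambda>p. p \<in> (SIGMA j:Obj I. el (D j) a) \<and> eventually_eq a i x (fst p) (snd p)) =
          (\<lambda>p. p \<in> (SIGMA j:Obj I. el (D j) a) \<and> eventually_eq a j y (fst p) (snd p))"
        by (intro ext) auto
      then show ?thesis by (simp add: rep_def)
    qed
    moreover have "eventually_eq a i x j y" if "rep i a x = rep j a y"
    proof -
      obtain k z where k: "rep i a x = (k, z)" by (cases "rep i a x")
      then show ?thesis
        using rep[of a i x] rep[of a j y] * that eventually_eq_trans[of a i x k z j y] eventually_eq_sym by auto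
    qed
    moreover have "e a (rep i a x) = e a (rep j a y) \<longleftrightarrow> rep i a x = rep j a y"
      using e[OF *(1)] rep(1)[of a i x] rep(1)[of a j y] * by (auto dest: inj_onD)
    ultimately show "e a (rep i a x) = e a (rep j a y) \<longleftrightarrow> eventually_eq a i x j y" by blast
  qed
  show ?thesis using colim_pw_colimit by blast
qed

lemma pw_colimit_eqD:
  assumes G: "pw_colimit I D E G l" and a: "a \<in> Obj C" and ij: "i \<in> Obj I" "j \<in> Obj I"
    and xy: "x \<in> el (D i) a" "y \<in> el (D j) a" and eq: "l i a x = l j a y"
  obtains k u v where "k \<in> Obj I" "u \<in> Hom I i k" "v \<in> Hom I j k" "E i k u a x = E j k v a y"
proof -
  interpret G: linear_presheaf R C G using G by (rule pw_colimit_psh)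
  obtain k u v where k: "k \<in> Obj I" "u \<in> Hom I i k" "v \<in> Hom I j k" using index_join[OF ij] .
  let ?x = "E i k u a x" and ?y = "E j k v a y"
  have el: "?x \<in> el (D k) a" "?y \<in> el (D k) a" using a ij xy k E_closed by auto
  have "l k a ?x = l k a ?y" using a ij xy k eq by (simp add: pw_colimit_cocone[OF G])
  then have "l k a (mdiff R (Val (D k) a) ?x ?y) = elzero G a"
    using a k el mod_hom_mdiff[OF D_mod presheaf_map_hom[OF pw_colimit_map[OF G]]]
    by (simp add: mdiff_eq_zero_iff[OF G.val_module] presheaf_map_closed[OF pw_colimit_map[OF G]])
  then obtain m w where w: "m \<in> Obj I" "w \<in> Hom I k m" "E k m w a (mdiff R (Val (D k) a) ?x ?y) = elzero (D m) a"
    using pw_colimit_zeroD[OF G k(1) a mdiff_closed[OF D_mod[OF k(1) a] el]] by metis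
  then have "E k m w a ?x = E k m w a ?y"
    using mod_hom_mdiff[OF D_mod[OF k(1) a] presheaf_map_hom[OF E_map[OF k(1) w(1,2)] a] el] el a k
    by (simp add: mdiff_eq_zero_iff[OF D_mod] E_closed)
  then have "E i m (Comp I i k m w u) a x = E j m (Comp I j k m w v) a y"
    using a ij xy k w by (simp add: E_comp)
  then show thesis using that[OF w(1)] ij k w index_comp by blast
qed

lemma pw_colimit_universal:
  assumes G: "pw_colimit I D E G l" and H: "linear_presheaf R C H"
    and m: "\<And>i. i \<in> Obj I \<Longrightarrow> presheaf_map (D i) H (m i)"
    and mE: "\<And>i j u a x. \<lbrakk>i \<in> Obj I; j \<in> Obj I; u \<in> Hom I i j; a \<in> Obj C; x \<in> el (D i) a\<rbrakk>
      \<Longrightarrow> m j a (E i j u a x) = m i a x"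
  shows "\<exists>n. presheaf_map G H n \<and> (\<forall>i\<in>Obj I. \<forall>a\<in>Obj C. \<forall>x\<in>el (D i) a. n a (l i a x) = m i a x)"
proof -
  interpret G: linear_presheaf R C G using G by (rule pw_colimit_psh)
  interpret H: linear_presheaf R C H by fact
  note l = pw_colimit_map[OF G]
  note lE = pw_colimit_cocone[OF G]
  have eq: "m i a x = m j a y"
    if p: "a \<in> Obj C" "i \<in> Obj I" "j \<in> Obj I" "x \<in> el (D i) a" "y \<in> el (D j) a" "l i a x = l j a y"
    for a i j x y
  proof -
    obtain k u v where k: "k \<in> Obj I" "u \<in> Hom I i k" "v \<in> Hom I j k" "E i k u a x = E j k v a y"
      using pw_colimit_eqD[OF G p] .
    then show ?thesis using mE[OF p(2) k(1,2) p(1,4)] mE[OF p(3) k(1,3) p(1,5)] by simp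
  qed
  define n where "n a z = (SOME w. \<exists>i x. i \<in> Obj I \<and> x \<in> el (D i) a \<and> z = l i a x \<and> w = m i a x)" for a z
  have n: "n a (l i a x) = m i a x" if "a \<in> Obj C" "i \<in> Obj I" "x \<in> el (D i) a" for a i x
    unfolding n_def
  proof (rule some_equality)
    show "\<exists>j y. j \<in> Obj I \<and> y \<in> el (D j) a \<and> l i a x = l j a y \<and> m i a x = m j a y"
      using that by blast
  qed (use that eq in metis)
  have lift2: "\<exists>i x y. i \<in> Obj I \<and> x \<in> el (D i) a \<and> y \<in> el (D i) a \<and> z = l i a x \<and> w = l i a y"
    if prems: "a \<in> Obj C" "z \<in> el G a" "w \<in> el G a" for a z w
  proof -
    obtain i x where i: "i \<in> Obj I" "x \<in> el (D i) a" "z = l i a x" using pw_colimit_surj[OF G prems(1,2)] .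
    obtain j y where j: "j \<in> Obj I" "y \<in> el (D j) a" "w = l j a y" using pw_colimit_surj[OF G prems(1,3)] .
    obtain k u v where k: "k \<in> Obj I" "u \<in> Hom I i k" "v \<in> Hom I j k" using index_join[OF i(1) j(1)] .
    show ?thesis
      by (rule exI[of _ k], rule exI[of _ "E i k u a x"], rule exI[of _ "E j k v a y"])
        (use i j k prems E_closed lE in auto)
  qed
  have "presheaf_map G H n"
  proof (rule presheaf_mapI)
    fix a z assume a: "a \<in> Obj C" "z \<in> el G a"
    obtain i x where i: "i \<in> Obj I" "x \<in> el (D i) a" "z = l i a x" using pw_colimit_surj[OF G a] .
    show "n a z \<in> el H a" using a i by (simp add: n presheaf_map_closed[OF m])
    fix r assume "r \<in> carrier R"
    then show "n a (r \<odot>\<^bsub>Val G a\<^esub> z) = r \<odot>\<^bsub>Val H a\<^esub> n a z"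
      using a i n[OF a(1) i(1) D_smult[OF i(1) a(1)]]
      by (simp add: n presheaf_map_smult[OF m] flip: presheaf_map_smult[OF l])
  next
    fix a z w assume a: "a \<in> Obj C" "z \<in> el G a" "w \<in> el G a"
    then obtain i x y where i: "i \<in> Obj I" "x \<in> el (D i) a" "y \<in> el (D i) a" "z = l i a x" "w = l i a y"
      using lift2 by blast
    then show "n a (z \<oplus>\<^bsub>Val G a\<^esub> w) = n a z \<oplus>\<^bsub>Val H a\<^esub> n a w"
      using a n[OF a(1) i(1) D_add[OF i(1) a(1)]]
      by (simp add: n presheaf_map_add[OF m] flip: presheaf_map_add[OF l])
  next
    fix a b f z assume a: "a \<in> Obj C" "b \<in> Obj C" "f \<in> Hom C a b" "z \<in> el G b"
    obtain i x where i: "i \<in> Obj I" "x \<in> el (D i) b" "z = l i b x" using pw_colimit_surj[OF G a(2,4)] .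
    then show "n a (Act G a b f z) = Act H a b f (n b z)"
      using a n[OF a(1) i(1) D_act[OF i(1) a(1)]]
      by (simp add: n presheaf_map_act[OF m] flip: presheaf_map_act[OF l])
  qed
  then show ?thesis using n by blast
qed

end

section \<open>Left exact presheaves\<close>

context linear_category
begin

lemma pw_colimit_cancel:
  assumes "pw_colimit I D E G l" "a \<in> Obj C" "z \<in> el G a"
    and "\<And>i x. \<lbrakk>i \<in> Obj I; x \<in> el (D i) a\<rbrakk> \<Longrightarrow> n a (l i a x) = n' a (l i a x)"
  shows "n a z = n' a z"
  using pw_colimit_surj[OF assms(1-3)] assms(4) by metis

definition lex :: "('o, 'm, 'r, 'v) presheaf \<Rightarrow> bool" where
  "lex F \<longleftrightarrow> linear_presheaf R C F \<and>
     (\<forall>w\<in>Obj C. \<forall>v\<in>Obj C. \<forall>u\<in>Obj C. \<forall>p q. is_cokernel C w v u p q \<longrightarrow>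
        (\<forall>y\<in>el F u. Act F v u q y = elzero F v \<longrightarrow> y = elzero F u) \<and>
        (\<forall>x\<in>el F v. Act F w v p x = elzero F w \<longrightarrow> (\<exists>y\<in>el F u. Act F v u q y = x)))"

lemma lexI:
  assumes "linear_presheaf R C F"
    and "\<And>w v u p q y. \<lbrakk>w \<in> Obj C; v \<in> Obj C; u \<in> Obj C; is_cokernel C w v u p q; y \<in> el F u;
      Act F v u q y = elzero F v\<rbrakk> \<Longrightarrow> y = elzero F u"
    and "\<And>w v u p q x. \<lbrakk>w \<in> Obj C; v \<in> Obj C; u \<in> Obj C; is_cokernel C w v u p q; x \<in> el F v;
      Act F w v p x = elzero F w\<rbrakk> \<Longrightarrow> \<exists>y\<in>el F u. Act F v u q y = x"
  shows "lex F"
  using assms unfolding lex_def by blast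

lemma lex_psh: "lex F \<Longrightarrow> linear_presheaf R C F"
  by (simp add: lex_def)

lemma lex_zeroD:
  "\<lbrakk>lex F; is_cokernel C w v u p q; w \<in> Obj C; v \<in> Obj C; u \<in> Obj C; y \<in> el F u; Act F v u q y = elzero F v\<rbrakk>
    \<Longrightarrow> y = elzero F u"
  unfolding lex_def by blast

lemma lex_factor:
  assumes "lex F" "is_cokernel C w v u p q" "w \<in> Obj C" "v \<in> Obj C" "u \<in> Obj C" "x \<in> el F v"
    "Act F w v p x = elzero F w"
  obtains y where "y \<in> el F u" "Act F v u q y = x"
  using assms unfolding lex_def by blast

lemma lex_cancel:
  assumes "lex F" "is_cokernel C w v u p q" "w \<in> Obj C" "v \<in> Obj C" "u \<in> Obj C"
    "x \<in> el F u" "y \<in> el F u" "Act F v u q x = Act F v u q y"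
  shows "x = y"
proof -
  interpret F: linear_presheaf R C F using assms(1) by (rule lex_psh)
  show ?thesis
    by (rule mod_hom_injD[OF F.val_module F.val_module F.act_hom[of v u q]])
      (use assms lex_zeroD[OF assms(1-5)] cokernelD[OF assms(2)] in auto)
qed

lemma lex_retract:
  assumes F: "linear_presheaf R C F" and G: "lex G"
    and s: "presheaf_map F G s" and t: "presheaf_map G F t"
    and ts: "\<And>a x. \<lbrakk>a \<in> Obj C; x \<in> el F a\<rbrakk> \<Longrightarrow> t a (s a x) = x"
  shows "lex F"
proof (rule lexI[OF F])
  interpret F: linear_presheaf R C F by fact
  interpret G: linear_presheaf R C G using G by (rule lex_psh)
  fix w v u p q assume o: "w \<in> Obj C" "v \<in> Obj C" "u \<in> Obj C" and c: "is_cokernel C w v u p q"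
  note pq = cokernelD[OF c]
  {
    fix y assume y: "y \<in> el F u" "Act F v u q y = elzero F v"
    have "Act G v u q (s u y) = elzero G v"
      using y o pq presheaf_map_act[OF s o(2,3) pq(2) y(1)] presheaf_map_zero[OF s F lex_psh[OF G] o(2)] by simp
    then have "s u y = elzero G u"
      using lex_zeroD[OF G c o] presheaf_map_closed[OF s o(3) y(1)] by blast
    then show "y = elzero F u"
      using ts[OF o(3) y(1)] presheaf_map_zero[OF t lex_psh[OF G] F o(3)] by simp
  }
  fix x assume x: "x \<in> el F v" "Act F w v p x = elzero F w"
  have "Act G w v p (s v x) = elzero G w"
    using x presheaf_map_act[OF s o(1,2) pq(1) x(1)] presheaf_map_zero[OF s F lex_psh[OF G] o(1)] by simp
  then obtain y where y: "y \<in> el G u" "Act G v u q y = s v x"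
    using lex_factor[OF G c o] presheaf_map_closed[OF s o(2) x(1)] by metis
  then have "Act F v u q (t u y) = x"
    using presheaf_map_act[OF t o(2,3) pq(2) y(1)] ts[OF o(2) x(1)] by simp
  then show "\<exists>y\<in>el F u. Act F v u q y = x"
    using presheaf_map_closed[OF t o(3) y(1)] by blast
qed

lemma presheaf_map_inverse:
  assumes F: "linear_presheaf R C F" and t: "presheaf_map F G t"
    and bij: "\<And>a. a \<in> Obj C \<Longrightarrow> bij_betw (t a) (el F a) (el G a)"
  shows "presheaf_map G F (\<lambda>a. inv_into (el F a) (t a))"
proof (rule presheaf_mapI)
  interpret F: linear_presheaf R C F by fact
  have inj: "inj_on (t a) (el F a)" and im: "t a ` el F a = el G a" if "a \<in> Obj C" for a
    using bij[OF that] by (auto simp: bij_betw_def)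
  fix a x assume a: "a \<in> Obj C" "x \<in> el G a"
  then obtain z where z: "z \<in> el F a" "x = t a z" using im by blast
  show "inv_into (el F a) (t a) x \<in> el F a" using a inj z by simp
  {
    fix r assume r: "r \<in> carrier R"
    have "r \<odot>\<^bsub>Val G a\<^esub> x = t a (r \<odot>\<^bsub>Val F a\<^esub> z)" using presheaf_map_smult[OF t] a r z by simp
    then show "inv_into (el F a) (t a) (r \<odot>\<^bsub>Val G a\<^esub> x) = r \<odot>\<^bsub>Val F a\<^esub> inv_into (el F a) (t a) x"
      using a inj z F.el_smult r by simp
  }
  {
    fix y assume "y \<in> el G a"
    then obtain z' where z': "z' \<in> el F a" "y = t a z'" using im a by blast
    have "x \<oplus>\<^bsub>Val G a\<^esub> y = t a (z \<oplus>\<^bsub>Val F a\<^esub> z')" using presheaf_map_add[OF t] a z z' by simp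
    then show "inv_into (el F a) (t a) (x \<oplus>\<^bsub>Val G a\<^esub> y)
        = inv_into (el F a) (t a) x \<oplus>\<^bsub>Val F a\<^esub> inv_into (el F a) (t a) y"
      using a inj z z' F.el_add by simp
  }
  fix b f assume b: "b \<in> Obj C" "f \<in> Hom C b a"
  have "Act G b a f x = t b (Act F b a f z)" using presheaf_map_act[OF t] a b z by simp
  then show "inv_into (el F b) (t b) (Act G b a f x) = Act F b a f (inv_into (el F a) (t a) x)"
    using a b inj z F.act_closed by simp
qed

end

lemma (in filtered_system) lex_pw_colimit:
  assumes G: "pw_colimit I D E G l" and D: "\<And>i. i \<in> Obj I \<Longrightarrow> lex (D i)"
  shows "lex G"
proof (rule lexI)
  show Gp: "linear_presheaf R C G" using G by (rule pw_colimit_psh)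
  note l = pw_colimit_map[OF G]
  note l_zero = presheaf_map_zero[OF l D_psh Gp]
  fix w v u p q assume o: "w \<in> Obj C" "v \<in> Obj C" "u \<in> Obj C" and c: "is_cokernel C w v u p q"
  note pq = cokernelD[OF c]
  {
    fix y assume y: "y \<in> el G u" "Act G v u q y = elzero G v"
    obtain i y' where i: "i \<in> Obj I" "y' \<in> el (D i) u" "y = l i u y'" using pw_colimit_surj[OF G o(3) y(1)] .
    have "l i v (Act (D i) v u q y') = elzero G v"
      using y i presheaf_map_act[OF l[OF i(1)] o(2,3) pq(2) i(2)] by simp
    then obtain j f where j: "j \<in> Obj I" "f \<in> Hom I i j" "E i j f v (Act (D i) v u q y') = elzero (D j) v"
      using pw_colimit_zeroD[OF G i(1) o(2) D_act[OF i(1) o(2,3) pq(2) i(2)]] by metis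
    then have "Act (D j) v u q (E i j f u y') = elzero (D j) v"
      using E_act[OF i(1) j(1,2) o(2,3) pq(2) i(2)] by simp
    then have "E i j f u y' = elzero (D j) u"
      using lex_zeroD[OF D[OF j(1)] c o] E_closed[OF i(1) j(1,2) o(3) i(2)] by blast
    then show "y = elzero G u"
      using pw_colimit_cocone[OF G i(1) j(1,2) o(3) i(2)] i(3) l_zero[OF j(1) j(1) o(3)] by simp
  }
  fix x assume x: "x \<in> el G v" "Act G w v p x = elzero G w"
  obtain i x' where i: "i \<in> Obj I" "x' \<in> el (D i) v" "x = l i v x'" using pw_colimit_surj[OF G o(2) x(1)] .
  have "l i w (Act (D i) w v p x') = elzero G w"
    using x i presheaf_map_act[OF l[OF i(1)] o(1,2) pq(1) i(2)] by simp
  then obtain j f where j: "j \<in> Obj I" "f \<in> Hom I i j" "E i j f w (Act (D i) w v p x') = elzero (D j) w"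
    using pw_colimit_zeroD[OF G i(1) o(1) D_act[OF i(1) o(1,2) pq(1) i(2)]] by metis
  then have "Act (D j) w v p (E i j f v x') = elzero (D j) w"
    using E_act[OF i(1) j(1,2) o(1,2) pq(1) i(2)] by simp
  then obtain y where y: "y \<in> el (D j) u" "Act (D j) v u q y = E i j f v x'"
    using lex_factor[OF D[OF j(1)] c o] E_closed[OF i(1) j(1,2) o(2) i(2)] by metis
  have "Act G v u q (l j u y) = x"
    using presheaf_map_act[OF l[OF j(1)] o(2,3) pq(2) y(1)] y i
      pw_colimit_cocone[OF G i(1) j(1,2) o(2) i(2)] by simp
  then show "\<exists>y\<in>el G u. Act G v u q y = x"
    using presheaf_map_closed[OF l[OF j(1)] o(3) y(1)] by blast
qed

context linear_category
begin

text \<open>Transport to another type is the colimit over the one-object index category.\<close>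

lemma presheaf_transport:
  fixes P :: "('o, 'm, 'r, 'v) presheaf"
  assumes P: "linear_presheaf R C P" and small: "\<And>a. a \<in> Obj C \<Longrightarrow> el P a \<lesssim> (UNIV :: 'u set)"
  shows "\<exists>(Q :: ('o, 'm, 'r, 'u) presheaf) t. linear_presheaf R C Q \<and> presheaf_map P Q t \<and>
    (\<forall>a\<in>Obj C. bij_betw (t a) (el P a) (el Q a))"
proof -
  interpret P: linear_presheaf R C P by fact
  define I :: "(unit, unit) cat" where
    "I = \<lparr>Obj = UNIV, Hom = (\<lambda>_ _. UNIV), Comp = (\<lambda>_ _ _ _ _. ()), Id = (\<lambda>_. ())\<rparr>"
  define E :: "unit \<Rightarrow> unit \<Rightarrow> unit \<Rightarrow> 'o \<Rightarrow> 'v \<Rightarrow> 'v" where "E = (\<lambda>_ _ _ _ x. x)"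
  interpret filtered_system R C I "\<lambda>_. P" E
    by unfold_locales
      (auto simp: I_def E_def filtered_cat_def category_def presheaf_mapI P)
  have "(SIGMA i:Obj I. el P a) \<lesssim> (UNIV :: 'u set)" if "a \<in> Obj C" for a
  proof -
    have "inj_on snd (SIGMA i:Obj I. el P a)" by (auto simp: inj_on_def)
    moreover have "snd ` (SIGMA i:Obj I. el P a) \<subseteq> el P a" by auto
    ultimately have "(SIGMA i:Obj I. el P a) \<lesssim> el P a" unfolding lepoll_def by blast
    then show ?thesis using small[OF that] by (rule lepoll_trans)
  qed
  then obtain Q :: "('o, 'm, 'r, 'u) presheaf" and l where Q: "pw_colimit I (\<lambda>_. P) E Q l"
    using pw_colimit_exists by blast
  have l: "presheaf_map P Q (l ())" using pw_colimit_map[OF Q, of "()"] by (simp add: I_def)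
  have Qp: "linear_presheaf R C Q" using Q by (rule pw_colimit_psh)
  have "bij_betw (l () a) (el P a) (el Q a)" if a: "a \<in> Obj C" for a
    unfolding bij_betw_def
  proof
    show "inj_on (l () a) (el P a)"
    proof (rule inj_onI, rule mod_hom_injD[OF P.val_module linear_presheaf.val_module[OF Qp] presheaf_map_hom[OF l]])
      fix x assume "x \<in> el P a" "l () a x = elzero Q a"
      then show "x = elzero P a"
        using a by (auto elim!: pw_colimit_zeroD[OF Q, rotated 2] simp: I_def E_def)
    qed (use a in auto)
    show "l () a ` el P a = el Q a"
      using presheaf_map_closed[OF l a] pw_colimit_surj[OF Q a] by (auto simp: image_def) (metis (full_types) unit.exhaust)
  qed
  then show ?thesis using Qp l by blast
qed

subsection \<open>Representable presheaves\<close>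

definition yon :: "'o \<Rightarrow> ('o, 'm, 'r, 'm) presheaf" where
  "yon c = \<lparr>Val = (\<lambda>a. HomMod C a c), Act = (\<lambda>a b f g. Comp C a b c g f)\<rparr>"

lemma yon_simps [simp]: "Val (yon c) a = HomMod C a c" "Act (yon c) a b f g = Comp C a b c g f"
  by (simp_all add: yon_def)

lemma yon_psh: "c \<in> Obj C \<Longrightarrow> linear_presheaf R C (yon c)"
  by (rule linear_presheaf.intro[OF linear_category_axioms], rule linear_presheaf_axioms.intro)
    (simp_all add: hom_module carrier_hom id_right comp_assoc comp_add_right comp_smult_right,
      simp add: yon_def precomp_mod_hom)

lemma yon_lex: "c \<in> Obj C \<Longrightarrow> lex (yon c)"
proof (rule lexI)
  assume c: "c \<in> Obj C"
  then show "linear_presheaf R C (yon c)" by (rule yon_psh)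
  fix w v u p q assume o: "w \<in> Obj C" "v \<in> Obj C" "u \<in> Obj C" and pq: "is_cokernel C w v u p q"
  {
    fix y assume "y \<in> el (yon c) u" "Act (yon c) v u q y = elzero (yon c) v"
    then show "y = elzero (yon c) u"
      using is_epiD[OF cokernel_epi[OF pq o] o(2,3) c] o c by (simp add: carrier_hom)
  }
  fix x assume "x \<in> el (yon c) v" "Act (yon c) w v p x = elzero (yon c) w"
  then show "\<exists>y\<in>el (yon c) u. Act (yon c) v u q y = x"
    using cokernel_factor[OF pq c, of x] o c by (auto simp: carrier_hom)
qed

definition yoneda_map :: "('o, 'm, 'r, 'v) presheaf \<Rightarrow> 'o \<Rightarrow> 'v \<Rightarrow> 'o \<Rightarrow> 'm \<Rightarrow> 'v" where
  "yoneda_map F c x = (\<lambda>a f. Act F a c f x)"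

lemma yoneda_map:
  assumes F: "linear_presheaf R C F" and c: "c \<in> Obj C" "x \<in> el F c"
  shows "presheaf_map (yon c) F (yoneda_map F c x)"
proof -
  interpret F: linear_presheaf R C F by fact
  show ?thesis
    by (rule presheaf_mapI)
      (use c in \<open>simp_all add: yoneda_map_def carrier_hom F.act_closed F.act_add F.act_smult F.act_comp\<close>)
qed

definition represents :: "('o, 'm, 'r, 'v) presheaf \<Rightarrow> 'o \<Rightarrow> ('o \<Rightarrow> 'm \<Rightarrow> 'v) \<Rightarrow> bool" where
  "represents F c t \<longleftrightarrow> c \<in> Obj C \<and> linear_presheaf R C F \<and> presheaf_map (yon c) F t \<and>
     (\<forall>a\<in>Obj C. bij_betw (t a) (Hom C a c) (el F a))"

lemma representable_iff: "linear_presheaf R C F \<Longrightarrow> representable R C F \<longleftrightarrow> (\<exists>c t. represents F c t)"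
proof
  assume F: "linear_presheaf R C F" and "representable R C F"
  then obtain c t where "c \<in> Obj C" "\<forall>a\<in>Obj C. t a \<in> mod_hom R (HomMod C a c) (Val F a) \<and>
        bij_betw (t a) (Hom C a c) (el F a)"
      "\<forall>a\<in>Obj C. \<forall>b\<in>Obj C. \<forall>f\<in>Hom C a b. \<forall>g\<in>Hom C b c. t a (Comp C a b c g f) = Act F a b f (t b g)"
    unfolding representable_def by blast
  then have "represents F c t" using F by (simp add: represents_def presheaf_map_def carrier_hom)
  then show "\<exists>c t. represents F c t" by blast
next
  assume "\<exists>c t. represents F c t"
  then obtain c t where "represents F c t" by blast
  then have "c \<in> Obj C" and "\<forall>a\<in>Obj C. t a \<in> mod_hom R (HomMod C a c) (Val F a) \<and>
        bij_betw (t a) (Hom C a c) (el F a)"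
      "\<forall>a\<in>Obj C. \<forall>b\<in>Obj C. \<forall>f\<in>Hom C a b. \<forall>g\<in>Hom C b c. t a (Comp C a b c g f) = Act F a b f (t b g)"
    by (auto simp: represents_def presheaf_map_def carrier_hom)
  then show "representable R C F" unfolding representable_def by blast
qed

lemma represents_exists:
  assumes "c \<in> Obj C" "\<And>a. a \<in> Obj C \<Longrightarrow> Hom C a c \<lesssim> (UNIV :: 'u set)"
  shows "\<exists>(F :: ('o, 'm, 'r, 'u) presheaf) t. represents F c t"
  using presheaf_transport[OF yon_psh[OF assms(1)]] assms by (auto simp: represents_def carrier_hom)

lemma representsD:
  assumes "represents F c t"
  shows "c \<in> Obj C" "linear_presheaf R C F" "presheaf_map (yon c) F t"
    "\<And>a. a \<in> Obj C \<Longrightarrow> bij_betw (t a) (Hom C a c) (el F a)"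
  using assms by (auto simp: represents_def)

lemma represents_elE:
  assumes "represents F c t" "a \<in> Obj C" "x \<in> el F a"
  obtains f where "f \<in> Hom C a c" "x = t a f"
  using representsD(4)[OF assms(1,2)] assms(3) by (auto simp: bij_betw_def)

lemma represents_eq_iff:
  "\<lbrakk>represents F c t; a \<in> Obj C; f \<in> Hom C a c; g \<in> Hom C a c\<rbrakk> \<Longrightarrow> t a f = t a g \<longleftrightarrow> f = g"
  using representsD(4)[of F c t a] by (auto simp: bij_betw_def dest: inj_onD)

lemma represents_closed: "\<lbrakk>represents F c t; a \<in> Obj C; f \<in> Hom C a c\<rbrakk> \<Longrightarrow> t a f \<in> el F a"
  using representsD(4)[of F c t a] by (auto simp: bij_betw_def)

lemma represents_act:
  "\<lbrakk>represents F c t; a \<in> Obj C; b \<in> Obj C; f \<in> Hom C a b; g \<in> Hom C b c\<rbrakk>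
    \<Longrightarrow> Act F a b f (t b g) = t a (Comp C a b c g f)"
  using presheaf_map_act[OF representsD(3), of F c t a b f g] by (simp add: carrier_hom representsD(1))

lemma represents_zero:
  "\<lbrakk>represents F c t; a \<in> Obj C\<rbrakk> \<Longrightarrow> t a (hzero a c) = elzero F a"
  using presheaf_map_zero[OF representsD(3)[of F c t] yon_psh[of c] representsD(2)[of F c t], of a]
    representsD(1)[of F c t] by simp

lemma represents_lex:
  assumes r: "represents F c t" shows "lex F"
proof -
  note d = representsD[OF r]
  have bij: "bij_betw (t a) (el (yon c) a) (el F a)" if "a \<in> Obj C" for a
    using d(4)[OF that] d(1) that by (simp add: carrier_hom)
  show ?thesis
    by (rule lex_retract[OF d(2) yon_lex[OF d(1)] presheaf_map_inverse[OF yon_psh[OF d(1)] d(3) bij] d(3)])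
      (assumption, rule bij_betw_inv_into_right[OF bij])
qed

lemma represents_yoneda:
  assumes r: "represents F c t" and H: "linear_presheaf R C H" and y: "y \<in> el H c"
  shows "\<exists>n. presheaf_map F H n \<and> (\<forall>a\<in>Obj C. \<forall>f\<in>Hom C a c. n a (t a f) = Act H a c f y)"
proof -
  note d = representsD[OF r]
  have bij: "bij_betw (t a) (el (yon c) a) (el F a)" if "a \<in> Obj C" for a
    using d(4)[OF that] d(1) that by (simp add: carrier_hom)
  let ?i = "\<lambda>a. inv_into (el (yon c) a) (t a)"
  have "presheaf_map F H (\<lambda>a x. yoneda_map H c y a (?i a x))"
    by (rule presheaf_map_comp[OF presheaf_map_inverse[OF yon_psh[OF d(1)] d(3) bij] yoneda_map[OF H d(1) y]])
  moreover have "?i a (t a f) = f" if "a \<in> Obj C" "f \<in> Hom C a c" for a f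
    using bij[OF that(1)] that d(1) by (simp add: bij_betw_inv_into_left carrier_hom)
  ultimately show ?thesis by (intro exI[of _ "\<lambda>a x. yoneda_map H c y a (?i a x)"]) (simp add: yoneda_map_def)
qed

lemma represents_map_apply:
  assumes r: "represents F c t" and n: "presheaf_map F H n" and a: "a \<in> Obj C" "f \<in> Hom C a c"
  shows "n a (t a f) = Act H a c f (n c (t c (Id C c)))"
proof -
  have "t a f = Act F a c f (t c (Id C c))"
    using represents_act[OF r a(1) _ a(2) id_closed] representsD(1)[OF r] a by (simp add: id_left)
  then show ?thesis
    using presheaf_map_act[OF n a(1) _ a(2)] represents_closed[OF r _ id_closed] representsD(1)[OF r] by simp
qed

subsection \<open>The category of presheaves\<close>

lemma presheaf_cat_simps [simp]:
  "Obj (presheaf_cat R C) = {F. linear_presheaf R C F}"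
  "Hom (presheaf_cat R C) = nat_trans R C"
  "HomMod (presheaf_cat R C) = nat_trans_module R C"
  "Comp (presheaf_cat R C) F G H t s = (\<lambda>a\<in>Obj C. \<lambda>x\<in>el F a. t a (s a x))"
  "Id (presheaf_cat R C) F = (\<lambda>a\<in>Obj C. \<lambda>x\<in>el F a. x)"
  by (simp_all add: presheaf_cat_def)

lemma nat_trans_iff:
  "t \<in> nat_trans R C F G \<longleftrightarrow> presheaf_map F G t \<and> t \<in> extensional (Obj C) \<and>
    (\<forall>a\<in>Obj C. t a \<in> extensional (el F a))"
  unfolding nat_trans_def presheaf_map_def by (auto simp: PiE_iff)

lemma nat_trans_map: "t \<in> nat_trans R C F G \<Longrightarrow> presheaf_map F G t"
  by (simp add: nat_trans_iff)

lemmas nat_trans_closed = presheaf_map_closed[OF nat_trans_map]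
lemmas nat_trans_add = presheaf_map_add[OF nat_trans_map]
lemmas nat_trans_smult = presheaf_map_smult[OF nat_trans_map]
lemmas nat_trans_act = presheaf_map_act[OF nat_trans_map]
lemmas nat_trans_zero = presheaf_map_zero[OF nat_trans_map]

lemma nat_trans_ext:
  assumes "s \<in> nat_trans R C F G" "t \<in> nat_trans R C F H"
    and "\<And>a x. \<lbrakk>a \<in> Obj C; x \<in> el F a\<rbrakk> \<Longrightarrow> s a x = t a x"
  shows "s = t"
proof
  fix a show "s a = t a"
  proof (cases "a \<in> Obj C")
    case True
    then show ?thesis using assms by (intro extensionalityI[of _ "el F a"]) (auto simp: nat_trans_iff)
  next
    case False
    then show ?thesis using assms by (auto simp: nat_trans_iff extensional_def)
  qed
qed

definition nt :: "('o, 'm, 'r, 'v) presheaf \<Rightarrow> ('o \<Rightarrow> 'v \<Rightarrow> 'v) \<Rightarrow> 'o \<Rightarrow> 'v \<Rightarrow> 'v" where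
  "nt F t = (\<lambda>a\<in>Obj C. \<lambda>x\<in>el F a. t a x)"

lemma nt_apply [simp]: "\<lbrakk>a \<in> Obj C; x \<in> el F a\<rbrakk> \<Longrightarrow> nt F t a x = t a x"
  by (simp add: nt_def)

lemma nt_nat_trans: "\<lbrakk>linear_presheaf R C F; presheaf_map F G t\<rbrakk> \<Longrightarrow> nt F t \<in> nat_trans R C F G"
  unfolding nat_trans_iff
  apply (intro conjI ballI)
    apply (rule presheaf_mapI)
  apply (simp_all add: presheaf_map_closed presheaf_map_add presheaf_map_smult presheaf_map_act
      linear_presheaf.el_add linear_presheaf.el_smult linear_presheaf.act_closed)
   apply (simp_all add: nt_def)
  done

lemma nat_trans_comp:
  "\<lbrakk>linear_presheaf R C F; s \<in> nat_trans R C F G; t \<in> nat_trans R C G H\<rbrakk>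
    \<Longrightarrow> Comp (presheaf_cat R C) F G H t s \<in> nat_trans R C F H"
  using nt_nat_trans[OF _ presheaf_map_comp[OF nat_trans_map nat_trans_map]] by (simp add: nt_def)

lemma nat_trans_module_simps:
  "carrier (nat_trans_module R C F G) = nat_trans R C F G"
  "add (nat_trans_module R C F G) s t = nt F (\<lambda>a x. s a x \<oplus>\<^bsub>Val G a\<^esub> t a x)"
  "zero (nat_trans_module R C F G) = nt F (\<lambda>a x. elzero G a)"
  "smult (nat_trans_module R C F G) r t = nt F (\<lambda>a x. r \<odot>\<^bsub>Val G a\<^esub> t a x)"
  by (simp_all add: nat_trans_module_def nt_def)

lemma nat_trans_zero_apply:
  "\<lbrakk>a \<in> Obj C; x \<in> el F a\<rbrakk> \<Longrightarrow> zero (nat_trans_module R C F G) a x = elzero G a"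
  by (simp add: nat_trans_module_simps)

lemma nt_add:
  assumes F: "linear_presheaf R C F" and G: "linear_presheaf R C G"
    and s: "s \<in> nat_trans R C F G" and t: "t \<in> nat_trans R C F G"
  shows "nt F (\<lambda>a x. s a x \<oplus>\<^bsub>Val G a\<^esub> t a x) \<in> nat_trans R C F G"
proof -
  interpret F: linear_presheaf R C F by fact
  interpret G: linear_presheaf R C G by fact
  note that = s t
  show ?thesis
  proof (rule nt_nat_trans[OF F], rule presheaf_mapI)
    fix a x assume a: "a \<in> Obj C" "x \<in> el F a"
    interpret M: module R "Val G a" using a G.val_module by blast
    show "s a x \<oplus>\<^bsub>Val G a\<^esub> t a x \<in> el G a" using a nat_trans_closed[OF that(1)] nat_trans_closed[OF that(2)] by blast
    {
      fix y assume y: "y \<in> el F a"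
      have "s a x \<in> el G a" "s a y \<in> el G a" "t a x \<in> el G a" "t a y \<in> el G a"
        using a y nat_trans_closed[OF that(1)] nat_trans_closed[OF that(2)] by blast+
      then show "s a (x \<oplus>\<^bsub>Val F a\<^esub> y) \<oplus>\<^bsub>Val G a\<^esub> t a (x \<oplus>\<^bsub>Val F a\<^esub> y)
          = s a x \<oplus>\<^bsub>Val G a\<^esub> t a x \<oplus>\<^bsub>Val G a\<^esub> (s a y \<oplus>\<^bsub>Val G a\<^esub> t a y)"
        using a y that by (simp add: nat_trans_add M.M.add.m_ac)
    }
    fix r assume "r \<in> carrier R"
    then show "s a (r \<odot>\<^bsub>Val F a\<^esub> x) \<oplus>\<^bsub>Val G a\<^esub> t a (r \<odot>\<^bsub>Val F a\<^esub> x)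
        = r \<odot>\<^bsub>Val G a\<^esub> (s a x \<oplus>\<^bsub>Val G a\<^esub> t a x)"
      using a that nat_trans_closed[OF that(1) a] nat_trans_closed[OF that(2) a]
      by (simp add: nat_trans_smult M.smult_r_distr)
  next
    fix a b f x assume "a \<in> Obj C" "b \<in> Obj C" "f \<in> Hom C a b" "x \<in> el F b"
    then show "s a (Act F a b f x) \<oplus>\<^bsub>Val G a\<^esub> t a (Act F a b f x)
        = Act G a b f (s b x \<oplus>\<^bsub>Val G b\<^esub> t b x)"
      using nat_trans_closed[OF that(1)] nat_trans_closed[OF that(2)] that by (simp add: nat_trans_act G.act_el_add)
  qed
qed

lemma nt_smult:
  assumes F: "linear_presheaf R C F" and G: "linear_presheaf R C G"
    and r: "r \<in> carrier R" and t: "t \<in> nat_trans R C F G"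
  shows "nt F (\<lambda>a x. r \<odot>\<^bsub>Val G a\<^esub> t a x) \<in> nat_trans R C F G"
proof -
  interpret F: linear_presheaf R C F by fact
  interpret G: linear_presheaf R C G by fact
  note that = r t
  show ?thesis
  proof (rule nt_nat_trans[OF F], rule presheaf_mapI)
    fix a x assume a: "a \<in> Obj C" "x \<in> el F a"
    interpret M: module R "Val G a" using a G.val_module by blast
    note tx = nat_trans_closed[OF that(2) a]
    show "r \<odot>\<^bsub>Val G a\<^esub> t a x \<in> el G a" using that tx by blast
    {
      fix y assume y: "y \<in> el F a"
      then show "r \<odot>\<^bsub>Val G a\<^esub> t a (x \<oplus>\<^bsub>Val F a\<^esub> y) = r \<odot>\<^bsub>Val G a\<^esub> t a x \<oplus>\<^bsub>Val G a\<^esub> r \<odot>\<^bsub>Val G a\<^esub> t a y"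
        using a that tx nat_trans_closed[OF that(2) a(1) y] by (simp add: nat_trans_add M.smult_r_distr)
    }
    fix r' assume "r' \<in> carrier R"
    then show "r \<odot>\<^bsub>Val G a\<^esub> t a (r' \<odot>\<^bsub>Val F a\<^esub> x) = r' \<odot>\<^bsub>Val G a\<^esub> (r \<odot>\<^bsub>Val G a\<^esub> t a x)"
      using a that tx by (simp add: nat_trans_smult m_comm flip: M.smult_assoc1)
  next
    fix a b f x assume "a \<in> Obj C" "b \<in> Obj C" "f \<in> Hom C a b" "x \<in> el F b"
    then show "r \<odot>\<^bsub>Val G a\<^esub> t a (Act F a b f x) = Act G a b f (r \<odot>\<^bsub>Val G b\<^esub> t b x)"
      using nat_trans_closed[OF that(2)] that by (simp add: nat_trans_act G.act_el_smult)
  qed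
qed

lemma nt_zero:
  assumes F: "linear_presheaf R C F" and G: "linear_presheaf R C G"
  shows "nt F (\<lambda>a x. elzero G a) \<in> nat_trans R C F G"
proof -
  interpret G: linear_presheaf R C G by fact
  show ?thesis
  proof (rule nt_nat_trans[OF F], rule presheaf_mapI)
    fix a x assume a: "a \<in> Obj C"
    interpret M: module R "Val G a" using a G.val_module by blast
    show "elzero G a \<in> el G a" "elzero G a = elzero G a \<oplus>\<^bsub>Val G a\<^esub> elzero G a" by simp_all
    show "elzero G a = r \<odot>\<^bsub>Val G a\<^esub> elzero G a" if "r \<in> carrier R" for r using that by simp
  qed (simp add: G.act_zero)
qed

lemma nat_trans_module:
  assumes F: "linear_presheaf R C F" and G: "linear_presheaf R C G"
  shows "module R (nat_trans_module R C F G)"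
proof -
  interpret G: linear_presheaf R C G by fact
  let ?M = "nat_trans_module R C F G"
  note add = nt_add[OF F G]
  note smult = nt_smult[OF F G]
  note zero = nt_zero[OF F G]
  show ?thesis
  proof (rule moduleI)
    show "cring R" by (rule cring_R)
    show "abelian_group ?M"
    proof (rule abelian_groupI; unfold nat_trans_module_simps)
      fix s t u assume st: "s \<in> nat_trans R C F G" "t \<in> nat_trans R C F G" "u \<in> nat_trans R C F G"
      show "nt F (\<lambda>a x. nt F (\<lambda>a x. s a x \<oplus>\<^bsub>Val G a\<^esub> t a x) a x \<oplus>\<^bsub>Val G a\<^esub> u a x) =
        nt F (\<lambda>a x. s a x \<oplus>\<^bsub>Val G a\<^esub> nt F (\<lambda>a x. t a x \<oplus>\<^bsub>Val G a\<^esub> u a x) a x)"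
      proof (rule nat_trans_ext[OF add[OF add] add[OF _ add]])
        fix a x assume a: "a \<in> Obj C" "x \<in> el F a"
        interpret M: module R "Val G a" using a G.val_module by blast
        show "nt F (\<lambda>a x. nt F (\<lambda>a x. s a x \<oplus>\<^bsub>Val G a\<^esub> t a x) a x \<oplus>\<^bsub>Val G a\<^esub> u a x) a x =
          nt F (\<lambda>a x. s a x \<oplus>\<^bsub>Val G a\<^esub> nt F (\<lambda>a x. t a x \<oplus>\<^bsub>Val G a\<^esub> u a x) a x) a x"
          using a nat_trans_closed[OF st(1) a] nat_trans_closed[OF st(2) a] nat_trans_closed[OF st(3) a]
          by (simp add: M.M.a_assoc)
      qed (fact st)+
    next
      fix s t assume st: "s \<in> nat_trans R C F G" "t \<in> nat_trans R C F G"
      show "nt F (\<lambda>a x. s a x \<oplus>\<^bsub>Val G a\<^esub> t a x) \<in> nat_trans R C F G" using st by (rule add)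
      show "nt F (\<lambda>a x. s a x \<oplus>\<^bsub>Val G a\<^esub> t a x) = nt F (\<lambda>a x. t a x \<oplus>\<^bsub>Val G a\<^esub> s a x)"
      proof (rule nat_trans_ext[OF add add])
        fix a x assume a: "a \<in> Obj C" "x \<in> el F a"
        interpret M: module R "Val G a" using a G.val_module by blast
        show "nt F (\<lambda>a x. s a x \<oplus>\<^bsub>Val G a\<^esub> t a x) a x = nt F (\<lambda>a x. t a x \<oplus>\<^bsub>Val G a\<^esub> s a x) a x"
          using a nat_trans_closed[OF st(1) a] nat_trans_closed[OF st(2) a] by (simp add: M.M.a_comm)
      qed (fact st)+
    next
      show "nt F (\<lambda>a x. elzero G a) \<in> nat_trans R C F G" by (rule zero)
    next
      fix s assume s: "s \<in> nat_trans R C F G"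
      show "nt F (\<lambda>a x. nt F (\<lambda>a x. elzero G a) a x \<oplus>\<^bsub>Val G a\<^esub> s a x) = s"
        by (rule nat_trans_ext[OF add[OF zero s] s])
          (simp add: module_l_zero[OF G.val_module] nat_trans_closed[OF s])
      show "\<exists>t\<in>nat_trans R C F G. nt F (\<lambda>a x. t a x \<oplus>\<^bsub>Val G a\<^esub> s a x) = nt F (\<lambda>a x. elzero G a)"
      proof (rule bexI)
        show n: "nt F (\<lambda>a x. (\<ominus> \<one>) \<odot>\<^bsub>Val G a\<^esub> s a x) \<in> nat_trans R C F G" using smult[OF _ s] by simp
        show "nt F (\<lambda>a x. nt F (\<lambda>a x. (\<ominus> \<one>) \<odot>\<^bsub>Val G a\<^esub> s a x) a x \<oplus>\<^bsub>Val G a\<^esub> s a x) = nt F (\<lambda>a x. elzero G a)"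
        proof (rule nat_trans_ext[OF add[OF n s] zero])
          fix a x assume a: "a \<in> Obj C" "x \<in> el F a"
          interpret M: module R "Val G a" using a G.val_module by blast
          show "nt F (\<lambda>a x. nt F (\<lambda>a x. (\<ominus> \<one>) \<odot>\<^bsub>Val G a\<^esub> s a x) a x \<oplus>\<^bsub>Val G a\<^esub> s a x) a x =
              nt F (\<lambda>a x. elzero G a) a x"
            using a nat_trans_closed[OF s a] by (simp add: M.smult_l_minus M.M.l_neg)
        qed
      qed
    qed
  next
    fix r s assume "r \<in> carrier R" "s \<in> carrier ?M"
    then show "r \<odot>\<^bsub>?M\<^esub> s \<in> carrier ?M" by (simp add: nat_trans_module_simps smult)
  next
    fix r r' s assume r: "r \<in> carrier R" "r' \<in> carrier R" and "s \<in> carrier ?M"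
    then have s: "s \<in> nat_trans R C F G" by (simp add: nat_trans_module_simps)
    show "(r \<oplus> r') \<odot>\<^bsub>?M\<^esub> s = r \<odot>\<^bsub>?M\<^esub> s \<oplus>\<^bsub>?M\<^esub> r' \<odot>\<^bsub>?M\<^esub> s"
      unfolding nat_trans_module_simps
    proof (rule nat_trans_ext[OF smult add[OF smult smult]])
      fix a x assume a: "a \<in> Obj C" "x \<in> el F a"
      interpret M: module R "Val G a" using a G.val_module by blast
      show "nt F (\<lambda>a x. (r \<oplus> r') \<odot>\<^bsub>Val G a\<^esub> s a x) a x =
          nt F (\<lambda>a x. nt F (\<lambda>a x. r \<odot>\<^bsub>Val G a\<^esub> s a x) a x \<oplus>\<^bsub>Val G a\<^esub> nt F (\<lambda>a x. r' \<odot>\<^bsub>Val G a\<^esub> s a x) a x) a x"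
        using a r nat_trans_closed[OF s a] by (simp add: M.smult_l_distr)
    qed (use r s in auto)
    show "(r \<otimes> r') \<odot>\<^bsub>?M\<^esub> s = r \<odot>\<^bsub>?M\<^esub> (r' \<odot>\<^bsub>?M\<^esub> s)"
      unfolding nat_trans_module_simps
    proof (rule nat_trans_ext[OF smult smult[OF _ smult]])
      fix a x assume a: "a \<in> Obj C" "x \<in> el F a"
      interpret M: module R "Val G a" using a G.val_module by blast
      show "nt F (\<lambda>a x. (r \<otimes> r') \<odot>\<^bsub>Val G a\<^esub> s a x) a x =
          nt F (\<lambda>a x. r \<odot>\<^bsub>Val G a\<^esub> nt F (\<lambda>a x. r' \<odot>\<^bsub>Val G a\<^esub> s a x) a x) a x"
        using a r nat_trans_closed[OF s a] by (simp add: M.smult_assoc1)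
    qed (use r s in auto)
  next
    fix r s t assume r: "r \<in> carrier R" and "s \<in> carrier ?M" "t \<in> carrier ?M"
    then have st: "s \<in> nat_trans R C F G" "t \<in> nat_trans R C F G" by (simp_all add: nat_trans_module_simps)
    show "r \<odot>\<^bsub>?M\<^esub> (s \<oplus>\<^bsub>?M\<^esub> t) = r \<odot>\<^bsub>?M\<^esub> s \<oplus>\<^bsub>?M\<^esub> r \<odot>\<^bsub>?M\<^esub> t"
      unfolding nat_trans_module_simps
    proof (rule nat_trans_ext[OF smult[OF _ add] add[OF smult smult]])
      fix a x assume a: "a \<in> Obj C" "x \<in> el F a"
      interpret M: module R "Val G a" using a G.val_module by blast
      show "nt F (\<lambda>a x. r \<odot>\<^bsub>Val G a\<^esub> nt F (\<lambda>a x. s a x \<oplus>\<^bsub>Val G a\<^esub> t a x) a x) a x =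
          nt F (\<lambda>a x. nt F (\<lambda>a x. r \<odot>\<^bsub>Val G a\<^esub> s a x) a x \<oplus>\<^bsub>Val G a\<^esub> nt F (\<lambda>a x. r \<odot>\<^bsub>Val G a\<^esub> t a x) a x) a x"
        using a r nat_trans_closed[OF st(1) a] nat_trans_closed[OF st(2) a] by (simp add: M.smult_r_distr)
    qed (use r st in auto)
  next
    fix s assume "s \<in> carrier ?M"
    then have s: "s \<in> nat_trans R C F G" by (simp add: nat_trans_module_simps)
    show "\<one> \<odot>\<^bsub>?M\<^esub> s = s"
      unfolding nat_trans_module_simps
    proof (rule nat_trans_ext[OF smult[OF _ s] s])
      fix a x assume a: "a \<in> Obj C" "x \<in> el F a"
      interpret M: module R "Val G a" using a G.val_module by blast
      show "nt F (\<lambda>a x. \<one> \<odot>\<^bsub>Val G a\<^esub> s a x) a x = s a x"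
        using a nat_trans_closed[OF s a] by simp
    qed simp
  qed
qed

end

lemma linear_category_full:
  assumes "linear_category R D" "S \<subseteq> Obj D"
  shows "linear_category R (D\<lparr>Obj := S\<rparr>)"
proof -
  interpret linear_category R D by fact
  show ?thesis
  proof (intro linear_category.intro cring_R category.intro linear_category_axioms.intro)
  qed (use assms(2) in \<open>simp_all add: subset_eq comp_closed id_closed comp_assoc id_left id_right hom_module
      carrier_hom comp_add_left comp_add_right comp_smult_left comp_smult_right\<close>)
qed

context linear_category
begin

lemma nat_trans_id: "linear_presheaf R C F \<Longrightarrow> (\<lambda>a\<in>Obj C. \<lambda>x\<in>el F a. x) \<in> nat_trans R C F F"
  using nt_nat_trans[of F F "\<lambda>a x. x"] by (simp add: nt_def presheaf_map_def mod_hom_def)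

lemma presheaf_category:
  "category (presheaf_cat R C :: (('o, 'm, 'r, 'v) presheaf, 'o \<Rightarrow> 'v \<Rightarrow> 'v, 'r) lcat)"
proof (rule category.intro)
  fix F G :: "('o, 'm, 'r, 'v) presheaf" and f
  assume *: "F \<in> Obj (presheaf_cat R C)" "G \<in> Obj (presheaf_cat R C)" "f \<in> Hom (presheaf_cat R C) F G"
  then have p: "linear_presheaf R C F" "linear_presheaf R C G" and f: "f \<in> nat_trans R C F G" by auto
  have "Comp (presheaf_cat R C) F G G (Id (presheaf_cat R C) G) f \<in> nat_trans R C F G"
    using nat_trans_comp[OF p(1) f nat_trans_id[OF p(2)]] by simp
  then show "Comp (presheaf_cat R C) F G G (Id (presheaf_cat R C) G) f = f"
    by (rule nat_trans_ext[OF _ f]) (simp add: nat_trans_closed[OF f])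
  have "Comp (presheaf_cat R C) F F G f (Id (presheaf_cat R C) F) \<in> nat_trans R C F G"
    using nat_trans_comp[OF p(1) nat_trans_id[OF p(1)] f] by simp
  then show "Comp (presheaf_cat R C) F F G f (Id (presheaf_cat R C) F) = f"
    by (rule nat_trans_ext[OF _ f]) simp
next
  fix F G H K :: "('o, 'm, 'r, 'v) presheaf" and f g h
  assume *: "F \<in> Obj (presheaf_cat R C)" "G \<in> Obj (presheaf_cat R C)" "H \<in> Obj (presheaf_cat R C)"
    "K \<in> Obj (presheaf_cat R C)" "f \<in> Hom (presheaf_cat R C) F G" "g \<in> Hom (presheaf_cat R C) G H"
    "h \<in> Hom (presheaf_cat R C) H K"
  then have f: "f \<in> nat_trans R C F G" by simp
  show "Comp (presheaf_cat R C) F H K h (Comp (presheaf_cat R C) F G H g f) =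
        Comp (presheaf_cat R C) F G K (Comp (presheaf_cat R C) G H K h g) f"
    by (auto simp: fun_eq_iff restrict_def nat_trans_closed[OF f])
qed (simp_all add: nat_trans_comp[simplified] nat_trans_id)

lemma presheaf_linear_category:
  "linear_category R (presheaf_cat R C :: (('o, 'm, 'r, 'v) presheaf, 'o \<Rightarrow> 'v \<Rightarrow> 'v, 'r) lcat)"
proof (rule linear_category.intro[OF cring_R presheaf_category], rule linear_category_axioms.intro)
  fix F G H :: "('o, 'm, 'r, 'v) presheaf" and f g g'
  assume *: "F \<in> Obj (presheaf_cat R C)" "G \<in> Obj (presheaf_cat R C)" "H \<in> Obj (presheaf_cat R C)"
    and "f \<in> Hom (presheaf_cat R C) F G"
  then have f: "f \<in> nat_trans R C F G" by simp
  {
    show "Comp (presheaf_cat R C) F G H (g \<oplus>\<^bsub>HomMod (presheaf_cat R C) G H\<^esub> g') f =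
        Comp (presheaf_cat R C) F G H g f \<oplus>\<^bsub>HomMod (presheaf_cat R C) F H\<^esub> Comp (presheaf_cat R C) F G H g' f"
      by (auto simp: fun_eq_iff restrict_def nat_trans_closed[OF f] nat_trans_module_simps nt_def)
    show "Comp (presheaf_cat R C) F G H (r \<odot>\<^bsub>HomMod (presheaf_cat R C) G H\<^esub> g) f =
        r \<odot>\<^bsub>HomMod (presheaf_cat R C) F H\<^esub> Comp (presheaf_cat R C) F G H g f" for r
      by (auto simp: fun_eq_iff restrict_def nat_trans_closed[OF f] nat_trans_module_simps nt_def)
  }
  assume "g \<in> Hom (presheaf_cat R C) G H"
  then have g: "g \<in> nat_trans R C G H" by simp
  show "Comp (presheaf_cat R C) F G H g (r \<odot>\<^bsub>HomMod (presheaf_cat R C) F G\<^esub> f) =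
        r \<odot>\<^bsub>HomMod (presheaf_cat R C) F H\<^esub> Comp (presheaf_cat R C) F G H g f" if "r \<in> carrier R" for r
    using that
    by (auto simp: fun_eq_iff restrict_def nat_trans_closed[OF f] nat_trans_smult[OF g] nat_trans_module_simps nt_def)
  fix f' assume "f' \<in> Hom (presheaf_cat R C) F G"
  then have f': "f' \<in> nat_trans R C F G" by simp
  show "Comp (presheaf_cat R C) F G H g (f \<oplus>\<^bsub>HomMod (presheaf_cat R C) F G\<^esub> f') =
        Comp (presheaf_cat R C) F G H g f \<oplus>\<^bsub>HomMod (presheaf_cat R C) F H\<^esub> Comp (presheaf_cat R C) F G H g f'"
    by (auto simp: fun_eq_iff restrict_def nat_trans_closed[OF f] nat_trans_closed[OF f'] nat_trans_add[OF g]
        nat_trans_module_simps nt_def)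
qed (simp_all add: nat_trans_module nat_trans_module_simps)

lemma functor_filtered_system:
  fixes D :: "'i \<Rightarrow> ('o, 'm, 'r, 'v) presheaf"
  assumes I: "filtered_cat I" and DE: "is_functor I (presheaf_cat R C) D E"
  shows "filtered_system R C I D E"
proof (rule filtered_system.intro[OF linear_category_axioms], rule filtered_system_axioms.intro)
  show "filtered_cat I" by fact
  have E: "E i j u \<in> nat_trans R C (D i) (D j)" if "i \<in> Obj I" "j \<in> Obj I" "u \<in> Hom I i j" for i j u
    using DE that by (simp add: is_functor_def)
  then show "presheaf_map (D i) (D j) (E i j u)" if "i \<in> Obj I" "j \<in> Obj I" "u \<in> Hom I i j" for i j u
    using that nat_trans_map by blast
  show "linear_presheaf R C (D i)" if "i \<in> Obj I" for i
    using DE that by (simp add: is_functor_def)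
  fix i a x assume "i \<in> Obj I" "a \<in> Obj C" "x \<in> el (D i) a"
  then show "E i i (Id I i) a x = x" using DE by (simp add: is_functor_def)
next
  fix i j k u v a x assume "i \<in> Obj I" "j \<in> Obj I" "k \<in> Obj I" "u \<in> Hom I i j" "v \<in> Hom I j k"
    "a \<in> Obj C" "x \<in> el (D i) a"
  then show "E i k (Comp I i j k v u) a x = E j k v a (E i j u a x)" using DE by (simp add: is_functor_def)
qed

lemma pw_colimit_is_colimit:
  fixes D :: "'i \<Rightarrow> ('o, 'm, 'r, 'v) presheaf" and F :: "('o, 'm, 'r, 'v) presheaf"
  assumes I: "filtered_cat I" and DE: "is_functor I (presheaf_cat R C) D E"
    and F: "pw_colimit I D E F l" and l: "\<And>i. i \<in> Obj I \<Longrightarrow> l i \<in> nat_trans R C (D i) F"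
  shows "is_colimit I (presheaf_cat R C) D E F l"
proof -
  interpret filtered_system R C I D E using I DE by (rule functor_filtered_system)
  have Fp: "linear_presheaf R C F" using F by (rule pw_colimit_psh)
  have E: "E i j u \<in> nat_trans R C (D i) (D j)" if "i \<in> Obj I" "j \<in> Obj I" "u \<in> Hom I i j" for i j u
    using DE that by (simp add: is_functor_def)
  show ?thesis
    unfolding is_colimit_def
  proof (intro conjI allI impI)
    show "is_cocone I (presheaf_cat R C) D E F l"
      unfolding is_cocone_def
    proof (intro conjI ballI)
      fix i j u assume i: "i \<in> Obj I" "j \<in> Obj I" "u \<in> Hom I i j"
      show "Comp (presheaf_cat R C) (D i) (D j) F (l j) (E i j u) = l i"
        by (rule nat_trans_ext[OF nat_trans_comp[OF D_psh[OF i(1)] E[OF i] l[OF i(2)]] l[OF i(1)]])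
          (simp add: pw_colimit_cocone[OF F i])
    qed (simp_all add: Fp l)
    fix H m assume Hm: "is_cocone I (presheaf_cat R C) D E H m"
    then have H: "linear_presheaf R C H" and m: "\<And>i. i \<in> Obj I \<Longrightarrow> m i \<in> nat_trans R C (D i) H"
      by (simp_all add: is_cocone_def)
    have mE: "m j a (E i j u a x) = m i a x"
      if "i \<in> Obj I" "j \<in> Obj I" "u \<in> Hom I i j" "a \<in> Obj C" "x \<in> el (D i) a" for i j u a x
    proof -
      have "Comp (presheaf_cat R C) (D i) (D j) H (m j) (E i j u) a x = m i a x"
        using Hm that by (simp add: is_cocone_def)
      then show ?thesis using that by simp
    qed
    obtain n where n: "presheaf_map F H n" "\<forall>i\<in>Obj I. \<forall>a\<in>Obj C. \<forall>x\<in>el (D i) a. n a (l i a x) = m i a x"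
      using pw_colimit_universal[OF F H nat_trans_map[OF m] mE] by blast
    show "\<exists>!h. h \<in> Hom (presheaf_cat R C) F H \<and>
        (\<forall>i\<in>Obj I. Comp (presheaf_cat R C) (D i) F H h (l i) = m i)"
    proof (rule ex1I)
      have nF: "nt F n \<in> nat_trans R C F H" using nt_nat_trans[OF Fp n(1)] .
      moreover have "Comp (presheaf_cat R C) (D i) F H (nt F n) (l i) = m i" if i: "i \<in> Obj I" for i
        by (rule nat_trans_ext[OF nat_trans_comp[OF D_psh[OF i] l[OF i] nF] m[OF i]])
          (use n(2) i nat_trans_closed[OF l[OF i]] in simp)
      ultimately show "nt F n \<in> Hom (presheaf_cat R C) F H \<and>
          (\<forall>i\<in>Obj I. Comp (presheaf_cat R C) (D i) F H (nt F n) (l i) = m i)"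
        by simp
      fix h assume h: "h \<in> Hom (presheaf_cat R C) F H \<and>
          (\<forall>i\<in>Obj I. Comp (presheaf_cat R C) (D i) F H h (l i) = m i)"
      have hl: "h a (l i a x) = m i a x" if "i \<in> Obj I" "a \<in> Obj C" "x \<in> el (D i) a" for i a x
      proof -
        have "Comp (presheaf_cat R C) (D i) F H h (l i) a x = m i a x" using h that by simp
        then show ?thesis using that by simp
      qed
      show "h = nt F n"
      proof (rule nat_trans_ext[OF _ nF])
        show "h \<in> nat_trans R C F H" using h by simp
        fix a x assume a: "a \<in> Obj C" "x \<in> el F a"
        show "h a x = nt F n a x"
          by (rule pw_colimit_cancel[OF F a, of h "nt F n"])
            (use hl n(2) a in \<open>simp add: nat_trans_closed[OF l]\<close>)
      qed
    qed
  qed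
qed

end

lemma colimit_reindex:
  fixes J :: "('i, 'j, 'y) cat_scheme"
  assumes J: "filtered_cat J" and D: "is_functor J C D E" and F: "is_colimit J C D E F l"
    and Obj: "Obj J \<lesssim> (UNIV :: 'u set)"
    and Hom: "\<And>i j. \<lbrakk>i \<in> Obj J; j \<in> Obj J\<rbrakk> \<Longrightarrow> Hom J i j \<lesssim> (UNIV :: 'u set)"
  obtains I :: "('u, 'u) cat" and D' E' l' where "filtered_cat I" "is_functor I C D' E'"
    "is_colimit I C D' E' F l'" "\<And>i. i \<in> Obj I \<Longrightarrow> \<exists>j\<in>Obj J. D' i = D j"
proof -
  obtain \<phi> :: "'i \<Rightarrow> 'u" where \<phi>: "inj_on \<phi> (Obj J)" using Obj by (auto simp: lepoll_UNIV_iff)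
  obtain \<psi> :: "'i \<Rightarrow> 'i \<Rightarrow> 'j \<Rightarrow> 'u" where \<psi>: "\<And>i j. \<lbrakk>i \<in> Obj J; j \<in> Obj J\<rbrakk> \<Longrightarrow> inj_on (\<psi> i j) (Hom J i j)"
    using Hom unfolding lepoll_UNIV_iff by metis
  define \<phi>' where "\<phi>' = inv_into (Obj J) \<phi>"
  define \<psi>' where "\<psi>' i j = inv_into (Hom J i j) (\<psi> i j)" for i j
  have \<phi>': "\<phi>' (\<phi> i) = i" if "i \<in> Obj J" for i using \<phi> that by (simp add: \<phi>'_def)
  have \<psi>': "\<psi>' i j (\<psi> i j u) = u" if "i \<in> Obj J" "j \<in> Obj J" "u \<in> Hom J i j" for i j u
    using \<psi> that by (simp add: \<psi>'_def)
  define I :: "('u, 'u) cat" where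
    "I = \<lparr>Obj = \<phi> ` Obj J, Hom = (\<lambda>i j. \<psi> (\<phi>' i) (\<phi>' j) ` Hom J (\<phi>' i) (\<phi>' j)),
      Comp = (\<lambda>i j k v u. \<psi> (\<phi>' i) (\<phi>' k) (Comp J (\<phi>' i) (\<phi>' j) (\<phi>' k) (\<psi>' (\<phi>' j) (\<phi>' k) v) (\<psi>' (\<phi>' i) (\<phi>' j) u))),
      Id = (\<lambda>i. \<psi> (\<phi>' i) (\<phi>' i) (Id J (\<phi>' i)))\<rparr>"
  have I [simp]: "Obj I = \<phi> ` Obj J" "Hom I i j = \<psi> (\<phi>' i) (\<phi>' j) ` Hom J (\<phi>' i) (\<phi>' j)"
    "Comp I i j k v u = \<psi> (\<phi>' i) (\<phi>' k) (Comp J (\<phi>' i) (\<phi>' j) (\<phi>' k) (\<psi>' (\<phi>' j) (\<phi>' k) v) (\<psi>' (\<phi>' i) (\<phi>' j) u))"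
    "Id I i = \<psi> (\<phi>' i) (\<phi>' i) (Id J (\<phi>' i))" for i j k u v
    by (simp_all add: I_def)
  let ?D = "\<lambda>i. D (\<phi>' i)" and ?E = "\<lambda>i j u. E (\<phi>' i) (\<phi>' j) (\<psi>' (\<phi>' i) (\<phi>' j) u)" and ?l = "\<lambda>i. l (\<phi>' i)"
  interpret J: category J using J by (simp add: filtered_cat_def)
  note simps = \<phi>' \<psi>' J.comp_closed J.id_closed
  have "category I"
    by (rule category.intro) (auto simp: simps J.comp_assoc J.id_left J.id_right)
  moreover have "\<exists>k\<in>Obj I. Hom I i k \<noteq> {} \<and> Hom I j k \<noteq> {}" if "i \<in> Obj I" "j \<in> Obj I" for i j
    using J that unfolding filtered_cat_def by (auto simp: simps)
  moreover have "\<exists>k\<in>Obj I. \<exists>w\<in>Hom I j k. Comp I i j k w u = Comp I i j k w v"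
    if prems: "i \<in> Obj I" "j \<in> Obj I" "u \<in> Hom I i j" "v \<in> Hom I i j" for i j u v
  proof -
    obtain i0 j0 where ij: "i0 \<in> Obj J" "j0 \<in> Obj J" "i = \<phi> i0" "j = \<phi> j0" using prems(1,2) by auto
    then obtain u0 v0 where uv: "u0 \<in> Hom J i0 j0" "v0 \<in> Hom J i0 j0" "u = \<psi> i0 j0 u0" "v = \<psi> i0 j0 v0"
      using prems by (auto simp: simps)
    obtain k w where "k \<in> Obj J" "w \<in> Hom J j0 k" "Comp J i0 j0 k w u0 = Comp J i0 j0 k w v0"
      using J ij uv unfolding filtered_cat_def by fast
    then show ?thesis
      using ij uv by (intro bexI[of _ "\<phi> k"] bexI[of _ "\<psi> j0 k w"]) (auto simp: simps)
  qed
  moreover have "Obj I \<noteq> {}" using J by (simp add: filtered_cat_def)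
  ultimately have "filtered_cat I" by (simp only: filtered_cat_def) blast
  moreover have "is_functor I C ?D ?E"
    using D unfolding is_functor_def by (simp add: simps)
  moreover have cocone: "is_cocone I C ?D ?E d (\<lambda>i. m (\<phi>' i)) \<longleftrightarrow> is_cocone J C D E d m" for d m
    unfolding is_cocone_def by (simp add: simps)
  have "is_colimit I C ?D ?E F ?l"
    unfolding is_colimit_def
  proof (intro conjI allI impI)
    show "is_cocone I C ?D ?E F ?l" using F by (simp add: cocone is_colimit_def)
    fix d m assume dm: "is_cocone I C ?D ?E d m"
    have "is_cocone I C ?D ?E d (\<lambda>i. m (\<phi> (\<phi>' i)))"
      using dm unfolding is_cocone_def by (simp add: simps)
    then have "is_cocone J C D E d (\<lambda>i. m (\<phi> i))" using cocone[of d "\<lambda>i. m (\<phi> i)"] by simp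
    then show "\<exists>!h. h \<in> Hom C F d \<and> (\<forall>i\<in>Obj I. Comp C (?D i) F d h (?l i) = m i)"
      using F by (simp add: is_colimit_def simps)
  qed
  moreover have "\<exists>j\<in>Obj J. ?D i = D j" if "i \<in> Obj I" for i using that by (auto simp: simps)
  ultimately show ?thesis using that[of I ?D ?E ?l] by blast
qed

section \<open>Finite colimits in a linear category\<close>

locale cocomplete_linear_category = linear_category +
  assumes cocomplete: "finitely_cocomplete C"
begin

lemma object_exists: "Obj C \<noteq> {}"
proof -
  let ?I = "\<lparr>Obj = {}, Hom = \<lambda>_ _. {}, Comp = \<lambda>_ _ _ _ _. 0, Id = \<lambda>_. 0\<rparr> :: (nat, nat) cat"
  have "finite_cat ?I" "is_functor ?I C undefined undefined"
    by (auto simp: finite_cat_def category_def is_functor_def)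
  then obtain c l where "is_colimit ?I C undefined undefined c l"
    using cocomplete unfolding finitely_cocomplete_def by blast
  then show ?thesis by (auto simp: is_colimit_def is_cocone_def)
qed

lemma cokernel_exists:
  assumes w: "w \<in> Obj C" "v \<in> Obj C" and p: "p \<in> Hom C w v"
  obtains u q where "u \<in> Obj C" "is_cokernel C w v u p q"
proof -
  define I :: "(nat, nat) cat" where
    "I = \<lparr>Obj = {0, 1}, Hom = (\<lambda>i j. if i = j then {0} else if i < j then {0, 1} else {}),
      Comp = (\<lambda>_ _ _ g f. g + f), Id = (\<lambda>_. 0)\<rparr>"
  define D where "D i = (if i = 0 then w else v)" for i :: nat
  define E where "E i j u = (if i = j then Id C (D i) else if u = 0 then p else hzero w v)" for i j u :: nat
  have "finite_cat I"
    unfolding finite_cat_def category_def I_def by (auto split: if_splits)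
  moreover have "is_functor I C D E"
    unfolding is_functor_def I_def D_def E_def
    using w p zero_hom by (auto simp: id_closed id_left id_right split: if_splits)
  ultimately obtain u l where ul: "is_colimit I C D E u l"
    using cocomplete unfolding finitely_cocomplete_def by blast
  then have u: "u \<in> Obj C" and l: "l 0 \<in> Hom C w u" "l 1 \<in> Hom C v u"
    and lp: "Comp C w v u (l 1) p = l 0" "Comp C w v u (l 1) (hzero w v) = l 0"
    unfolding is_colimit_def is_cocone_def by (auto simp: I_def D_def E_def)
  have l0: "l 0 = hzero w u" using lp(2) comp_zero_right[OF w u l(2)] by simp
  have "is_cokernel C w v u p (l 1)"
    unfolding is_cokernel_def
  proof (intro conjI ballI impI)
    fix d g assume d: "d \<in> Obj C" "g \<in> Hom C v d" "Comp C w v d g p = hzero w d"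
    define m where "m i = (if i = 0 then hzero w d else g)" for i :: nat
    have "is_cocone I C D E d m"
      unfolding is_cocone_def I_def D_def E_def m_def
      using d w zero_hom by (auto simp: id_right comp_zero_right)
    then have "\<exists>!h. h \<in> Hom C u d \<and> (\<forall>i\<in>Obj I. Comp C (D i) u d h (l i) = m i)"
      using ul by (simp add: is_colimit_def)
    moreover have "(\<forall>i\<in>Obj I. Comp C (D i) u d h (l i) = m i) \<longleftrightarrow> Comp C v u d h (l 1) = g"
      if "h \<in> Hom C u d" for h
      using that u d w by (auto simp: I_def D_def m_def l0 comp_zero_right)
    ultimately show "\<exists>!h. h \<in> Hom C u d \<and> Comp C v u d h (l 1) = g" by metis
  qed (use p l lp l0 in auto)
  then show thesis using u that by blast
qed

lemma biproduct_exists: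
  assumes a: "a \<in> Obj C" and b: "b \<in> Obj C"
  obtains s i j p q where "is_biproduct C a b s i j p q"
    "Comp C a s b q i = hzero a b" "Comp C b s a p j = hzero b a"
proof -
  define I :: "(nat, nat) cat" where
    "I = \<lparr>Obj = {0, 1}, Hom = (\<lambda>i j. if i = j then {0} else {}), Comp = (\<lambda>_ _ _ _ _. 0), Id = (\<lambda>_. 0)\<rparr>"
  define D where "D i = (if i = 0 then a else b)" for i :: nat
  define E where "E i j u = Id C (D i)" for i j u :: nat
  have "finite_cat I"
    unfolding finite_cat_def category_def I_def by (auto split: if_splits)
  moreover have "is_functor I C D E"
    unfolding is_functor_def I_def D_def E_def
    using a b by (auto simp: id_closed id_left id_right split: if_splits)
  ultimately obtain s l where sl: "is_colimit I C D E s l"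
    using cocomplete unfolding finitely_cocomplete_def by blast
  then have s: "s \<in> Obj C" and l: "l 0 \<in> Hom C a s" "l 1 \<in> Hom C b s"
    unfolding is_colimit_def is_cocone_def by (auto simp: I_def D_def E_def)
  have univ: "\<exists>!h. h \<in> Hom C s d \<and> Comp C a s d h (l 0) = f \<and> Comp C b s d h (l 1) = g"
    if "d \<in> Obj C" "f \<in> Hom C a d" "g \<in> Hom C b d" for d f g
  proof -
    have "is_cocone I C D E d (\<lambda>i. if i = 0 then f else g)"
      unfolding is_cocone_def I_def D_def E_def using that a b by (auto simp: id_right)
    then have "\<exists>!h. h \<in> Hom C s d \<and> (\<forall>i\<in>Obj I. Comp C (D i) s d h (l i) = (if i = 0 then f else g))"
      using sl unfolding is_colimit_def by blast
    then show ?thesis by (simp add: I_def D_def)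
  qed
  obtain p where p: "p \<in> Hom C s a" "Comp C a s a p (l 0) = Id C a" "Comp C b s a p (l 1) = hzero b a"
    using univ[OF a id_closed[OF a] zero_hom[OF b a]] by blast
  obtain q where q: "q \<in> Hom C s b" "Comp C a s b q (l 0) = hzero a b" "Comp C b s b q (l 1) = Id C b"
    using univ[OF b zero_hom[OF a b] id_closed[OF b]] by blast
  let ?e = "Comp C s a s (l 0) p \<oplus>\<^bsub>HomMod C s s\<^esub> Comp C s b s (l 1) q"
  have pl: "Comp C s a s (l 0) p \<in> Hom C s s" "Comp C s b s (l 1) q \<in> Hom C s s"
    using comp_closed s a b l p q by auto
  have "?e \<in> Hom C s s" using pl s by (simp add: add_hom)
  moreover have "Comp C a s s ?e (l 0) = l 0"
    using comp_add_left[OF a s s l(1) pl] comp_assoc[OF a s a s l(1) p(1) l(1), symmetric] comp_assoc[OF a s b s l(1) q(1) l(2), symmetric]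
      p q a b s l by (simp add: id_right comp_zero_right hom_r_zero)
  moreover have "Comp C b s s ?e (l 1) = l 1"
    using comp_add_left[OF b s s l(2) pl] comp_assoc[OF b s a s l(2) p(1) l(1), symmetric] comp_assoc[OF b s b s l(2) q(1) l(2), symmetric]
      p q a b s l by (simp add: id_right comp_zero_right hom_l_zero)
  ultimately have "?e = Id C s"
    using univ[OF s l] id_closed[OF s] id_left[OF a s l(1)] id_left[OF b s l(2)] by blast
  then have "is_biproduct C a b s (l 0) (l 1) p q"
    using s l p q by (simp add: is_biproduct_def)
  then show thesis using that p q by blast
qed

end

section \<open>Ind-objects are the left exact presheaves\<close>

context linear_category
begin

definition yoneda_nat ::
    "('o, 'm, 'r, 'v) presheaf \<Rightarrow> 'o \<Rightarrow> ('o \<Rightarrow> 'm \<Rightarrow> 'v) \<Rightarrow> ('o, 'm, 'r, 'v) presheaf \<Rightarrow> 'v \<Rightarrow> 'o \<Rightarrow> 'v \<Rightarrow> 'v" where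
  "yoneda_nat F c t H y =
     nt F (SOME n. presheaf_map F H n \<and> (\<forall>a\<in>Obj C. \<forall>f\<in>Hom C a c. n a (t a f) = Act H a c f y))"

lemma yoneda_nat:
  assumes r: "represents F c t" and H: "linear_presheaf R C H" and y: "y \<in> el H c"
  shows "yoneda_nat F c t H y \<in> nat_trans R C F H"
    and "\<And>a f. \<lbrakk>a \<in> Obj C; f \<in> Hom C a c\<rbrakk> \<Longrightarrow> yoneda_nat F c t H y a (t a f) = Act H a c f y"
proof -
  let ?n = "SOME n. presheaf_map F H n \<and> (\<forall>a\<in>Obj C. \<forall>f\<in>Hom C a c. n a (t a f) = Act H a c f y)"
  have n: "presheaf_map F H ?n \<and> (\<forall>a\<in>Obj C. \<forall>f\<in>Hom C a c. ?n a (t a f) = Act H a c f y)"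
    using represents_yoneda[OF r H y] by (rule someI_ex)
  show "yoneda_nat F c t H y \<in> nat_trans R C F H"
    unfolding yoneda_nat_def using nt_nat_trans[OF representsD(2)[OF r]] n by blast
  show "yoneda_nat F c t H y a (t a f) = Act H a c f y" if "a \<in> Obj C" "f \<in> Hom C a c" for a f
    unfolding yoneda_nat_def using n that represents_closed[OF r that] by simp
qed

lemma represents_nat_eqI:
  assumes r: "represents F c t" and n: "n \<in> nat_trans R C F H" "n' \<in> nat_trans R C F K"
    and eq: "\<And>a f. \<lbrakk>a \<in> Obj C; f \<in> Hom C a c\<rbrakk> \<Longrightarrow> n a (t a f) = n' a (t a f)"
  shows "n = n'"
proof (rule nat_trans_ext[OF n])
  fix a x assume a: "a \<in> Obj C" "x \<in> el F a"
  obtain f where "f \<in> Hom C a c" "x = t a f" using represents_elE[OF r a] .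
  then show "n a x = n' a x" using eq a by simp
qed

definition elements :: "('o, 'm, 'r, 'v) presheaf \<Rightarrow> ('o \<times> 'v, 'm) cat" where
  "elements F = \<lparr>Obj = (SIGMA c:Obj C. el F c),
     Hom = (\<lambda>i j. {f \<in> Hom C (fst i) (fst j). Act F (fst i) (fst j) f (snd j) = snd i}),
     Comp = (\<lambda>i j k. Comp C (fst i) (fst j) (fst k)), Id = (\<lambda>i. Id C (fst i))\<rparr>"

lemma elements_simps [simp]:
  "Obj (elements F) = (SIGMA c:Obj C. el F c)"
  "Hom (elements F) i j = {f \<in> Hom C (fst i) (fst j). Act F (fst i) (fst j) f (snd j) = snd i}"
  "Comp (elements F) i j k = Comp C (fst i) (fst j) (fst k)"
  "Id (elements F) i = Id C (fst i)"
  by (simp_all add: elements_def)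

end

lemma (in cocomplete_linear_category) lex_pair:
  assumes F: "linear_presheaf R C F" and s: "is_biproduct C a b s i j p q"
    and o: "Comp C a s b q i = hzero a b" "Comp C b s a p j = hzero b a"
    and ab: "a \<in> Obj C" "b \<in> Obj C" and xy: "x \<in> el F a" "y \<in> el F b"
  defines "z \<equiv> Act F s a p x \<oplus>\<^bsub>Val F s\<^esub> Act F s b q y"
  shows "z \<in> el F s" "Act F a s i z = x" "Act F b s j z = y"
proof -
  interpret F: linear_presheaf R C F by fact
  have h: "s \<in> Obj C" "i \<in> Hom C a s" "j \<in> Hom C b s" "p \<in> Hom C s a" "q \<in> Hom C s b"
    "Comp C a s a p i = Id C a" "Comp C b s b q j = Id C b"
    using s by (auto simp: is_biproduct_def)
  show "z \<in> el F s" using h ab xy by (simp add: z_def F.act_closed F.el_add)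
  have 1: "Act F a s i (Act F s a p x) = x" "Act F a s i (Act F s b q y) = elzero F a"
    using F.act_comp[OF ab(1) h(1) ab(1) h(2,4) xy(1)] F.act_comp[OF ab(1) h(1) ab(2) h(2,5) xy(2)] h o ab xy
    by (simp_all add: F.act_id F.act_hzero)
  have 2: "Act F b s j (Act F s b q y) = y" "Act F b s j (Act F s a p x) = elzero F b"
    using F.act_comp[OF ab(2) h(1) ab(2) h(3,5) xy(2)] F.act_comp[OF ab(2) h(1) ab(1) h(3,4) xy(1)] h o ab xy
    by (simp_all add: F.act_id F.act_hzero)
  show "Act F a s i z = x"
    using 1 h ab xy by (simp add: z_def F.act_el_add F.act_closed module_r_zero[OF F.val_module])
  show "Act F b s j z = y"
    using 2 h ab xy by (simp add: z_def F.act_el_add F.act_closed module_l_zero[OF F.val_module])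
qed

lemma (in cocomplete_linear_category) coequalizer_exists:
  assumes "a \<in> Obj C" "b \<in> Obj C" "f \<in> Hom C a b" "g \<in> Hom C a b"
  obtains c w where "c \<in> Obj C" "w \<in> Hom C b c" "is_cokernel C a b c (hdiff a b f g) w"
    "Comp C a b c w f = Comp C a b c w g"
proof -
  obtain c w where c: "c \<in> Obj C" "is_cokernel C a b c (hdiff a b f g) w"
    using cokernel_exists[OF assms(1,2) hdiff_closed[OF assms]] .
  note w = cokernelD[OF c(2)]
  have "hdiff a c (Comp C a b c w f) (Comp C a b c w g) = hzero a c"
    using w comp_hdiff_right[OF assms(1,2) c(1) assms(3,4) w(2)] by simp
  then have "Comp C a b c w f = Comp C a b c w g"
    using assms c w by (simp add: hdiff_zero_iff comp_closed)
  then show thesis using that c w by blast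
qed

lemma (in cocomplete_linear_category) elements_filtered:
  assumes F: "lex F" shows "filtered_cat (elements F)"
  unfolding filtered_cat_def
proof (intro conjI ballI)
  interpret F: linear_presheaf R C F using F by (rule lex_psh)
  show "category (elements F)"
    by (rule category.intro) (auto simp: comp_closed id_closed comp_assoc id_left id_right F.act_id F.act_comp)
  obtain c where c: "c \<in> Obj C" using object_exists by blast
  then have "(c, elzero F c) \<in> Obj (elements F)" by (simp add: F.el_zero)
  then show "Obj (elements F) \<noteq> {}" by blast
  fix ix iy assume ij: "ix \<in> Obj (elements F)" "iy \<in> Obj (elements F)"
  then obtain a x b y where ab: "a \<in> Obj C" "b \<in> Obj C" and xy: "x \<in> el F a" "y \<in> el F b"
    and eq: "ix = (a, x)" "iy = (b, y)" by auto
  obtain s i j p q where s: "is_biproduct C a b s i j p q" "Comp C a s b q i = hzero a b" "Comp C b s a p j = hzero b a"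
    using biproduct_exists[OF ab] .
  then have "s \<in> Obj C" "i \<in> Hom C a s" "j \<in> Hom C b s" by (auto simp: is_biproduct_def)
  then show "\<exists>k\<in>Obj (elements F). Hom (elements F) ix k \<noteq> {} \<and> Hom (elements F) iy k \<noteq> {}"
    using lex_pair[OF lex_psh[OF F] s ab xy] eq
    by (intro bexI[of _ "(s, Act F s a p x \<oplus>\<^bsub>Val F s\<^esub> Act F s b q y)"]) auto
  fix f g assume fg: "f \<in> Hom (elements F) ix iy" "g \<in> Hom (elements F) ix iy"
  then have fgh: "f \<in> Hom C a b" "g \<in> Hom C a b" and act: "Act F a b f y = x" "Act F a b g y = x" using eq by auto
  obtain c w where c: "c \<in> Obj C" "w \<in> Hom C b c" "is_cokernel C a b c (hdiff a b f g) w"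
    "Comp C a b c w f = Comp C a b c w g" using coequalizer_exists[OF ab fgh] .
  have "Act F a b (hdiff a b f g) y = elzero F a"
    using ab fgh xy act by (simp add: F.act_hdiff mdiff_eq_zero_iff[OF F.val_module])
  then obtain z where "z \<in> el F c" "Act F b c w z = y"
    using lex_factor[OF F c(3) ab c(1) xy(2)] by blast
  then show "\<exists>k\<in>Obj (elements F). \<exists>w\<in>Hom (elements F) iy k. Comp (elements F) ix iy k w f = Comp (elements F) ix iy k w g"
    using c eq by (intro bexI[of _ "(c, z)"] bexI[of _ w]) auto
qed

locale small_cocomplete_category = cocomplete_linear_category R C
  for R :: "('r, 'k) ring_scheme" (structure) and C :: "('o, 'm, 'r, 'z) lcat_scheme" +
  fixes U :: "'u itself"
  assumes small: "small_cat U C"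
begin

lemma universe_infinite: "infinite (UNIV :: 'u set)"
  and Obj_small: "Obj C \<lesssim> (UNIV :: 'u set)"
  and Hom_small: "\<lbrakk>a \<in> Obj C; b \<in> Obj C\<rbrakk> \<Longrightarrow> Hom C a b \<lesssim> (UNIV :: 'u set)"
  using small by (auto simp: small_cat_def)

definition Yrep :: "'o \<Rightarrow> ('o, 'm, 'r, 'u) presheaf \<times> ('o \<Rightarrow> 'm \<Rightarrow> 'u)" where
  "Yrep c = (SOME p. represents (fst p) c (snd p))"

definition Y :: "'o \<Rightarrow> ('o, 'm, 'r, 'u) presheaf" where "Y c = fst (Yrep c)"

definition \<theta> :: "'o \<Rightarrow> 'o \<Rightarrow> 'm \<Rightarrow> 'u" where "\<theta> c = snd (Yrep c)"

lemma Y_represents: assumes "c \<in> Obj C" shows "represents (Y c) c (\<theta> c)"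
proof -
  obtain F :: "('o, 'm, 'r, 'u) presheaf" and t where "represents F c t"
    using represents_exists[OF assms Hom_small] assms by blast
  then have "represents (fst (F, t)) c (snd (F, t))" by simp
  then show ?thesis unfolding Y_def \<theta>_def Yrep_def by (rule someI)
qed

lemmas Y_psh = representsD(2)[OF Y_represents]
lemmas Y_lex = represents_lex[OF Y_represents]
lemmas \<theta>_closed = represents_closed[OF Y_represents]
lemmas \<theta>_eq_iff = represents_eq_iff[OF Y_represents]
lemmas \<theta>_act = represents_act[OF Y_represents]
lemmas \<theta>_zero = represents_zero[OF Y_represents]

definition Yelt :: "'o \<Rightarrow> ('o, 'm, 'r, 'u) presheaf \<Rightarrow> 'u \<Rightarrow> 'o \<Rightarrow> 'u \<Rightarrow> 'u" where
  "Yelt c H y = yoneda_nat (Y c) c (\<theta> c) H y"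

lemma Yelt_nat: "\<lbrakk>c \<in> Obj C; linear_presheaf R C H; y \<in> el H c\<rbrakk> \<Longrightarrow> Yelt c H y \<in> nat_trans R C (Y c) H"
  unfolding Yelt_def by (rule yoneda_nat[OF Y_represents])

lemma Yelt_apply:
  "\<lbrakk>c \<in> Obj C; linear_presheaf R C H; y \<in> el H c; a \<in> Obj C; f \<in> Hom C a c\<rbrakk>
    \<Longrightarrow> Yelt c H y a (\<theta> c a f) = Act H a c f y"
  unfolding Yelt_def by (rule yoneda_nat[OF Y_represents])

definition Ymap :: "'o \<Rightarrow> 'o \<Rightarrow> 'm \<Rightarrow> 'o \<Rightarrow> 'u \<Rightarrow> 'u" where
  "Ymap c d f = Yelt c (Y d) (\<theta> d c f)"

lemma Ymap_nat: "\<lbrakk>c \<in> Obj C; d \<in> Obj C; f \<in> Hom C c d\<rbrakk> \<Longrightarrow> Ymap c d f \<in> nat_trans R C (Y c) (Y d)"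
  unfolding Ymap_def by (simp add: Yelt_nat Y_psh \<theta>_closed)

lemma Ymap_apply:
  "\<lbrakk>c \<in> Obj C; d \<in> Obj C; f \<in> Hom C c d; a \<in> Obj C; g \<in> Hom C a c\<rbrakk>
    \<Longrightarrow> Ymap c d f a (\<theta> c a g) = \<theta> d a (Comp C a c d f g)"
  unfolding Ymap_def by (simp add: Yelt_apply Y_psh \<theta>_closed \<theta>_act)

lemma lex_ind_object:
  fixes F :: "('o, 'm, 'r, 'u) presheaf"
  assumes F: "lex F" shows "ind_object R C F"
proof -
  interpret F: linear_presheaf R C F using F by (rule lex_psh)
  let ?D = "\<lambda>i. Y (fst i)" and ?E = "\<lambda>i j f. Ymap (fst i) (fst j) f"
  let ?l = "\<lambda>i. Yelt (fst i) F (snd i)"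
  have filt: "filtered_cat (elements F)" using F by (rule elements_filtered)
  have func: "is_functor (elements F) (presheaf_cat R C) ?D ?E"
    unfolding is_functor_def
  proof (intro conjI ballI)
    fix i assume i: "i \<in> Obj (elements F)"
    then have c: "fst i \<in> Obj C" by auto
    show "Y (fst i) \<in> Obj (presheaf_cat R C)" using Y_psh[OF c] by simp
    have "Ymap (fst i) (fst i) (Id C (fst i)) = (\<lambda>a\<in>Obj C. \<lambda>x\<in>el (Y (fst i)) a. x)"
      by (rule represents_nat_eqI[OF Y_represents[OF c] Ymap_nat[OF c c id_closed[OF c]] nat_trans_id[OF Y_psh[OF c]]])
        (use c in \<open>simp add: Ymap_apply id_closed id_left \<theta>_closed\<close>)
    then show "Ymap (fst i) (fst i) (Id (elements F) i) = Id (presheaf_cat R C) (Y (fst i))" by simp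
    fix j assume j: "j \<in> Obj (elements F)"
    then have d: "fst j \<in> Obj C" by auto
    {
      fix f assume "f \<in> Hom (elements F) i j"
      then show "Ymap (fst i) (fst j) f \<in> Hom (presheaf_cat R C) (Y (fst i)) (Y (fst j))"
        using c d by (simp add: Ymap_nat)
    }
    fix k f g assume k: "k \<in> Obj (elements F)" and "f \<in> Hom (elements F) i j" "g \<in> Hom (elements F) j k"
    then have e: "fst k \<in> Obj C" and fg: "f \<in> Hom C (fst i) (fst j)" "g \<in> Hom C (fst j) (fst k)" by auto
    show "Ymap (fst i) (fst k) (Comp (elements F) i j k g f) =
        Comp (presheaf_cat R C) (Y (fst i)) (Y (fst j)) (Y (fst k)) (Ymap (fst j) (fst k) g) (Ymap (fst i) (fst j) f)"
      unfolding elements_simps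
      by (rule represents_nat_eqI[OF Y_represents[OF c] Ymap_nat[OF c e comp_closed[OF c d e fg]]
            nat_trans_comp[OF Y_psh[OF c] Ymap_nat[OF c d fg(1)] Ymap_nat[OF d e fg(2)]]])
        (use c d e fg in \<open>simp add: Ymap_apply comp_closed comp_assoc \<theta>_closed\<close>)
  qed
  have l: "?l i \<in> nat_trans R C (?D i) F" if "i \<in> Obj (elements F)" for i
    using that by (auto intro!: Yelt_nat F.linear_presheaf_axioms)
  have "pw_colimit (elements F) ?D ?E F ?l"
    unfolding pw_colimit_def
  proof (intro conjI ballI impI)
    show "linear_presheaf R C F" by (rule F.linear_presheaf_axioms)
    fix i assume i: "i \<in> Obj (elements F)"
    then have c: "fst i \<in> Obj C" "snd i \<in> el F (fst i)" by auto
    show "presheaf_map (Y (fst i)) F (?l i)" using l[OF i] by (rule nat_trans_map)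
    {
      fix j f a x assume "j \<in> Obj (elements F)" "f \<in> Hom (elements F) i j" and a: "a \<in> Obj C" "x \<in> el (Y (fst i)) a"
      then have d: "fst j \<in> Obj C" "snd j \<in> el F (fst j)" and f: "f \<in> Hom C (fst i) (fst j)"
        "Act F (fst i) (fst j) f (snd j) = snd i" by auto
      obtain g where g: "g \<in> Hom C a (fst i)" "x = \<theta> (fst i) a g" using represents_elE[OF Y_represents[OF c(1)] a] .
      show "?l j a (Ymap (fst i) (fst j) f a x) = ?l i a x"
        using a c d f g by (simp add: Ymap_apply Yelt_apply F.linear_presheaf_axioms comp_closed F.act_comp)
    }
    fix a x assume a: "a \<in> Obj C" "x \<in> el (Y (fst i)) a" "?l i a x = elzero F a"
    obtain g where g: "g \<in> Hom C a (fst i)" "x = \<theta> (fst i) a g" using represents_elE[OF Y_represents[OF c(1)] a(1,2)] .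
    then have z: "Act F a (fst i) g (snd i) = elzero F a"
      using a c by (simp add: Yelt_apply F.linear_presheaf_axioms)
    obtain e w where e: "e \<in> Obj C" "is_cokernel C a (fst i) e g w" using cokernel_exists[OF a(1) c(1) g(1)] .
    obtain y where y: "y \<in> el F e" "Act F (fst i) e w y = snd i"
      using lex_factor[OF F e(2) a(1) c(1) e(1) c(2) z] .
    have "Ymap (fst i) e w a x = elzero (Y e) a"
      using g a c e cokernelD[OF e(2)] by (simp add: Ymap_apply \<theta>_zero)
    then show "\<exists>j\<in>Obj (elements F). \<exists>f\<in>Hom (elements F) i j. Ymap (fst i) (fst j) f a x = elzero (Y (fst j)) a"
      using e y cokernelD[OF e(2)] by (intro bexI[of _ "(e, y)"] bexI[of _ w]) auto
  next
    fix a z assume a: "a \<in> Obj C" "z \<in> el F a"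
    then show "\<exists>i\<in>Obj (elements F). \<exists>x\<in>el (Y (fst i)) a. z = ?l i a x"
      by (intro bexI[of _ "(a, z)"] bexI[of _ "\<theta> a a (Id C a)"])
        (simp_all add: Yelt_apply F.linear_presheaf_axioms id_closed F.act_id \<theta>_closed)
  qed
  then have colim: "is_colimit (elements F) (presheaf_cat R C) ?D ?E F ?l"
    using pw_colimit_is_colimit[OF filt func] l by blast
  have "Obj (elements F) \<lesssim> (UNIV :: 'u set)"
    unfolding elements_simps
    by (rule Sigma_lepoll_infinite[OF universe_infinite Obj_small]) (simp add: subset_imp_lepoll)
  moreover have "Hom (elements F) i j \<lesssim> (UNIV :: 'u set)" if "i \<in> Obj (elements F)" "j \<in> Obj (elements F)" for i j
  proof -
    have "Hom (elements F) i j \<lesssim> Hom C (fst i) (fst j)" by (rule subset_imp_lepoll) auto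
    then show ?thesis using lepoll_trans Hom_small that by fastforce
  qed
  ultimately obtain I :: "('u, 'u) cat" and D' E' l' where I: "filtered_cat I" "is_functor I (presheaf_cat R C) D' E'"
    "is_colimit I (presheaf_cat R C) D' E' F l'" "\<And>i. i \<in> Obj I \<Longrightarrow> \<exists>j\<in>Obj (elements F). D' i = ?D j"
    using colimit_reindex[OF filt func colim] by blast
  have "representable R C (D' i)" if i: "i \<in> Obj I" for i
  proof -
    obtain j where "j \<in> Obj (elements F)" "D' i = Y (fst j)" using I(4)[OF i] by blast
    then show ?thesis using representable_iff Y_represents Y_psh by fastforce
  qed
  then show ?thesis unfolding ind_object_def using I by blast
qed

lemma ind_object_lex:
  fixes F :: "('o, 'm, 'r, 'u) presheaf"
  assumes F: "ind_object R C F" shows "lex F"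
proof -
  obtain I :: "('u, 'u) cat" and D E l where I: "filtered_cat I" "is_functor I (presheaf_cat R C) D E"
    and rep: "\<And>i. i \<in> Obj I \<Longrightarrow> representable R C (D i)" and F: "is_colimit I (presheaf_cat R C) D E F l"
    using F unfolding ind_object_def by blast
  interpret filtered_system R C I D E using I by (rule functor_filtered_system)
  have Fc: "is_cocone I (presheaf_cat R C) D E F l" using F by (simp add: is_colimit_def)
  have Fp: "linear_presheaf R C F" using Fc by (simp add: is_cocone_def)
  have l: "l i \<in> nat_trans R C (D i) F" if "i \<in> Obj I" for i using Fc that by (simp add: is_cocone_def)
  have lE: "l j a (E i j u a x) = l i a x"
    if "i \<in> Obj I" "j \<in> Obj I" "u \<in> Hom I i j" "a \<in> Obj C" "x \<in> el (D i) a" for i j u a x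
  proof -
    have "Comp (presheaf_cat R C) (D i) (D j) F (l j) (E i j u) a x = l i a x"
      using Fc that by (simp add: is_cocone_def)
    then show ?thesis using that by simp
  qed
  have "(SIGMA i:Obj I. el (D i) a) \<lesssim> (UNIV :: 'u set)" for a
    by (rule Sigma_lepoll_infinite[OF universe_infinite]) (simp_all add: subset_imp_lepoll)
  then obtain G :: "('o, 'm, 'r, 'u) presheaf" and g where G: "pw_colimit I D E G g"
    using pw_colimit_exists by blast
  have Gp: "linear_presheaf R C G" using G by (rule pw_colimit_psh)
  have "lex (D i)" if "i \<in> Obj I" for i
    using rep[OF that] representable_iff[OF D_psh[OF that]] represents_lex by blast
  then have Gl: "lex G" by (rule lex_pw_colimit[OF G])
  obtain n where n: "presheaf_map G F n" "\<forall>i\<in>Obj I. \<forall>a\<in>Obj C. \<forall>x\<in>el (D i) a. n a (g i a x) = l i a x"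
    using pw_colimit_universal[OF G Fp nat_trans_map[OF l] lE] by blast
  define g' where "g' i = nt (D i) (g i)" for i
  have g': "g' i \<in> nat_trans R C (D i) G" if "i \<in> Obj I" for i
    unfolding g'_def by (rule nt_nat_trans[OF D_psh[OF that] pw_colimit_map[OF G that]])
  have g'_apply: "g' i a x = g i a x" if "a \<in> Obj C" "x \<in> el (D i) a" for i a x
    using that by (simp add: g'_def)
  have E: "E i j u \<in> nat_trans R C (D i) (D j)" if "i \<in> Obj I" "j \<in> Obj I" "u \<in> Hom I i j" for i j u
    using I(2) that by (simp add: is_functor_def)
  have "is_cocone I (presheaf_cat R C) D E G g'"
    unfolding is_cocone_def
  proof (intro conjI ballI)
    fix i j u assume i: "i \<in> Obj I" "j \<in> Obj I" "u \<in> Hom I i j"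
    show "Comp (presheaf_cat R C) (D i) (D j) G (g' j) (E i j u) = g' i"
      by (rule nat_trans_ext[OF nat_trans_comp[OF D_psh[OF i(1)] E[OF i] g'[OF i(2)]] g'[OF i(1)]])
        (simp add: g'_apply E_closed[OF i] pw_colimit_cocone[OF G i])
  qed (simp_all add: Gp g')
  then have "\<exists>!h. h \<in> nat_trans R C F G \<and> (\<forall>i\<in>Obj I. Comp (presheaf_cat R C) (D i) F G h (l i) = g' i)"
    using F unfolding is_colimit_def presheaf_cat_simps(2) by blast
  then obtain h where h: "h \<in> nat_trans R C F G"
      "\<And>i. i \<in> Obj I \<Longrightarrow> Comp (presheaf_cat R C) (D i) F G h (l i) = g' i"
    by blast
  have hl: "h a (l i a x) = g i a x" if "i \<in> Obj I" "a \<in> Obj C" "x \<in> el (D i) a" for i a x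
  proof -
    have "Comp (presheaf_cat R C) (D i) F G h (l i) a x = g i a x" using h(2) that g'_apply by simp
    then show ?thesis using that by simp
  qed
  let ?nh = "nt F (\<lambda>a x. n a (h a x))"
  have nh: "?nh \<in> nat_trans R C F F"
    by (rule nt_nat_trans[OF Fp presheaf_map_comp[OF nat_trans_map[OF h(1)] n(1)]])
  have "Comp (presheaf_cat R C) (D i) F F ?nh (l i) = l i" if i: "i \<in> Obj I" for i
    by (rule nat_trans_ext[OF nat_trans_comp[OF D_psh[OF i] l[OF i] nh] l[OF i]])
      (use i n(2) hl in \<open>simp add: nat_trans_closed[OF l[OF i]]\<close>)
  moreover have "Comp (presheaf_cat R C) (D i) F F (Id (presheaf_cat R C) F) (l i) = l i" if i: "i \<in> Obj I" for i
    using category.id_left[OF presheaf_category, of "D i" F "l i"] D_psh[OF i] Fp l[OF i] by simp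
  moreover have "\<exists>!k. k \<in> nat_trans R C F F \<and> (\<forall>i\<in>Obj I. Comp (presheaf_cat R C) (D i) F F k (l i) = l i)"
    using F Fc unfolding is_colimit_def presheaf_cat_simps(2) by blast
  moreover have "Id (presheaf_cat R C) F \<in> nat_trans R C F F" using nat_trans_id[OF Fp] by simp
  ultimately have "?nh = Id (presheaf_cat R C) F" using nh by blast
  then have "?nh a x = x" if "a \<in> Obj C" "x \<in> el F a" for a x using that by simp
  then have "n a (h a x) = x" if "a \<in> Obj C" "x \<in> el F a" for a x using that by simp
  then show ?thesis by (rule lex_retract[OF Fp Gl nat_trans_map[OF h(1)] n(1)])
qed

theorem ind_object_iff_lex: "ind_object R C (F :: ('o, 'm, 'r, 'u) presheaf) \<longleftrightarrow> lex F"
  using lex_ind_object ind_object_lex by blast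

abbreviation ind :: "(('o, 'm, 'r, 'u) presheaf, 'o \<Rightarrow> 'u \<Rightarrow> 'u, 'r) lcat" where
  "ind \<equiv> Ind R C"

lemma ind_simps [simp]:
  "Obj ind = {F. lex F}" "Hom ind = nat_trans R C" "HomMod ind = nat_trans_module R C"
  "Comp ind F G H t s = (\<lambda>a\<in>Obj C. \<lambda>x\<in>el F a. t a (s a x))"
  "Id ind F = (\<lambda>a\<in>Obj C. \<lambda>x\<in>el F a. x)"
  by (simp_all add: Ind_def ind_object_iff_lex)

lemma ind_linear_category: "linear_category R ind"
  unfolding Ind_def
  by (rule linear_category_full[OF presheaf_linear_category]) (auto simp: ind_object_iff_lex lex_psh)

end

section \<open>Cokernels of maps of ind-objects\<close>

lemma (in linear_category) cokernel_of_zero: "a \<in> Obj C \<Longrightarrow> is_cokernel C a a a (hzero a a) (Id C a)"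
  by (rule is_cokernelI) (auto simp: is_epi_def zero_hom id_closed id_left id_right)

context linear_category
begin

text \<open>
  The cokernel of \<open>\<alpha> : F \<rightarrow> G\<close> is the filtered colimit of the cokernels \<open>k : u \<rightarrow> e\<close> of those
  \<open>p : v \<rightarrow> u\<close> that fit into a commutative square with \<open>\<alpha>\<close>, \<open>x \<in> F v\<close> and \<open>y \<in> G u\<close>.
\<close>

definition cokernel_stage ::
    "('o, 'm, 'r, 'u) presheaf \<Rightarrow> ('o, 'm, 'r, 'u) presheaf \<Rightarrow> ('o \<Rightarrow> 'u \<Rightarrow> 'u) \<Rightarrow>
      'o \<Rightarrow> 'o \<Rightarrow> 'm \<Rightarrow> 'u \<Rightarrow> 'o \<Rightarrow> 'm \<Rightarrow> 'u \<Rightarrow> bool" where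
  "cokernel_stage F G \<alpha> u e k y v p x \<longleftrightarrow>
     u \<in> Obj C \<and> e \<in> Obj C \<and> v \<in> Obj C \<and> y \<in> el G u \<and> x \<in> el F v \<and>
     is_cokernel C v u e p k \<and> Act G v u p y = \<alpha> v x"

lemma cokernel_stageD:
  assumes "cokernel_stage F G \<alpha> u e k y v p x"
  shows "u \<in> Obj C" "e \<in> Obj C" "v \<in> Obj C" "y \<in> el G u" "x \<in> el F v" "is_cokernel C v u e p k"
    "Act G v u p y = \<alpha> v x" "p \<in> Hom C v u" "k \<in> Hom C u e" "Comp C v u e k p = hzero v e"
  using assms cokernelD by (auto simp: cokernel_stage_def)

end

locale cokernel_system = small_cocomplete_category R C U
  for R :: "('r, 'k) ring_scheme" (structure) and C :: "('o, 'm, 'r, 'z) lcat_scheme" and U :: "'u itself" +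
  fixes F G :: "('o, 'm, 'r, 'u) presheaf" and \<alpha> :: "'o \<Rightarrow> 'u \<Rightarrow> 'u"
  assumes F: "lex F" and G: "lex G" and \<alpha>: "\<alpha> \<in> nat_trans R C F G"
begin

sublocale F: linear_presheaf R C F using F by (rule lex_psh)
sublocale G: linear_presheaf R C G using G by (rule lex_psh)

abbreviation stage where "stage \<equiv> cokernel_stage F G \<alpha>"

abbreviation uo :: "'o \<times> 'o \<times> 'm \<times> 'u \<Rightarrow> 'o" where "uo i \<equiv> fst i"
abbreviation eo :: "'o \<times> 'o \<times> 'm \<times> 'u \<Rightarrow> 'o" where "eo i \<equiv> fst (snd i)"
abbreviation ko :: "'o \<times> 'o \<times> 'm \<times> 'u \<Rightarrow> 'm" where "ko i \<equiv> fst (snd (snd i))"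
abbreviation yo :: "'o \<times> 'o \<times> 'm \<times> 'u \<Rightarrow> 'u" where "yo i \<equiv> snd (snd (snd i))"

definition J :: "('o \<times> 'o \<times> 'm \<times> 'u, 'm \<times> 'm) cat" where
  "J = \<lparr>Obj = {i. \<exists>v p x. stage (uo i) (eo i) (ko i) (yo i) v p x},
     Hom = (\<lambda>i i'. {j. fst j \<in> Hom C (uo i) (uo i') \<and> snd j \<in> Hom C (eo i) (eo i') \<and>
        Comp C (uo i) (uo i') (eo i') (ko i') (fst j) = Comp C (uo i) (eo i) (eo i') (snd j) (ko i) \<and>
        Act G (uo i) (uo i') (fst j) (yo i') = yo i}),
     Comp = (\<lambda>i i' i'' g f. (Comp C (uo i) (uo i') (uo i'') (fst g) (fst f), Comp C (eo i) (eo i') (eo i'') (snd g) (snd f))),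
     Id = (\<lambda>i. (Id C (uo i), Id C (eo i)))\<rparr>"

lemma J_simps [simp]:
  "Obj J = {i. \<exists>v p x. stage (uo i) (eo i) (ko i) (yo i) v p x}"
  "Hom J i i' = {j. fst j \<in> Hom C (uo i) (uo i') \<and> snd j \<in> Hom C (eo i) (eo i') \<and>
      Comp C (uo i) (uo i') (eo i') (ko i') (fst j) = Comp C (uo i) (eo i) (eo i') (snd j) (ko i) \<and>
      Act G (uo i) (uo i') (fst j) (yo i') = yo i}"
  "Comp J i i' i'' g f = (Comp C (uo i) (uo i') (uo i'') (fst g) (fst f), Comp C (eo i) (eo i') (eo i'') (snd g) (snd f))"
  "Id J i = (Id C (uo i), Id C (eo i))"
  by (simp_all add: J_def)

lemmas stageD = cokernel_stageD[of F G \<alpha>]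

lemma J_obj:
  assumes "i \<in> Obj J"
  shows "uo i \<in> Obj C" "eo i \<in> Obj C" "ko i \<in> Hom C (uo i) (eo i)" "yo i \<in> el G (uo i)"
  using assms stageD by fastforce+

lemma J_extend:
  assumes s: "stage u e k y v p x" and s': "stage u' e' k' y' v' p' x'" and j: "j \<in> Hom C u u'"
    and jy: "Act G u u' j y' = y" and kp: "Comp C v u' e' k' (Comp C v u u' j p) = hzero v e'"
  obtains j' where "(j, j') \<in> Hom J (u, e, k, y) (u', e', k', y')"
proof -
  note d = stageD[OF s] and d' = stageD[OF s']
  have "Comp C v u e' (Comp C u u' e' k' j) p = hzero v e'"
    using d d' j kp by (simp add: comp_assoc)
  then obtain j' where "j' \<in> Hom C e e'" "Comp C u e e' j' k = Comp C u u' e' k' j"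
    using cokernel_factor[OF d(6) d'(2) comp_closed[OF d(1) d'(1,2) j d'(9)]] by blast
  then show thesis using that[of j'] j jy by auto
qed

lemma J_category: "category J"
proof (rule category.intro)
  fix i i' i'' f g
  assume o: "i \<in> Obj J" "i' \<in> Obj J" "i'' \<in> Obj J" and f: "f \<in> Hom J i i'" and g: "g \<in> Hom J i' i''"
  note i = J_obj[OF o(1)] J_obj[OF o(2)] J_obj[OF o(3)]
  have fg: "fst f \<in> Hom C (uo i) (uo i')" "fst g \<in> Hom C (uo i') (uo i'')" "snd f \<in> Hom C (eo i) (eo i')"
    "snd g \<in> Hom C (eo i') (eo i'')"
    and e: "Comp C (uo i) (uo i') (eo i') (ko i') (fst f) = Comp C (uo i) (eo i) (eo i') (snd f) (ko i)"
      "Comp C (uo i') (uo i'') (eo i'') (ko i'') (fst g) = Comp C (uo i') (eo i') (eo i'') (snd g) (ko i')"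
    and y: "Act G (uo i) (uo i') (fst f) (yo i') = yo i" "Act G (uo i') (uo i'') (fst g) (yo i'') = yo i'"
    using f g by auto
  have "Comp C (uo i) (uo i'') (eo i'') (ko i'') (Comp C (uo i) (uo i') (uo i'') (fst g) (fst f))
      = Comp C (uo i) (uo i') (eo i'') (Comp C (uo i') (eo i') (eo i'') (snd g) (ko i')) (fst f)"
    using i fg e by (simp add: comp_assoc)
  also have "\<dots> = Comp C (uo i) (eo i') (eo i'') (snd g) (Comp C (uo i) (uo i') (eo i') (ko i') (fst f))"
    using i fg by (simp add: comp_assoc)
  also have "\<dots> = Comp C (uo i) (eo i) (eo i'') (Comp C (eo i) (eo i') (eo i'') (snd g) (snd f)) (ko i)"
    using i fg e by (simp add: comp_assoc)
  finally show "Comp J i i' i'' g f \<in> Hom J i i''"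
    using i fg y by (simp add: comp_closed G.act_comp)
next
  fix i assume "i \<in> Obj J"
  from J_obj[OF this] show "Id J i \<in> Hom J i i" by (simp add: id_closed id_left id_right G.act_id)
next
  fix i j k l f g h
  assume o: "i \<in> Obj J" "j \<in> Obj J" "k \<in> Obj J" "l \<in> Obj J"
    and "f \<in> Hom J i j" "g \<in> Hom J j k" "h \<in> Hom J k l"
  then show "Comp J i k l h (Comp J i j k g f) = Comp J i j l (Comp J j k l h g) f"
    using J_obj[OF o(1)] J_obj[OF o(2)] J_obj[OF o(3)] J_obj[OF o(4)] by (simp add: comp_assoc del: J_simps(1))
next
  fix i j f assume o: "i \<in> Obj J" "j \<in> Obj J" and "f \<in> Hom J i j"
  then show "Comp J i j j (Id J j) f = f" "Comp J i i j f (Id J i) = f"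
    using J_obj[OF o(1)] J_obj[OF o(2)] by (simp_all add: id_left id_right del: J_simps(1))
qed

lemma J_join:
  assumes s: "stage u e k y v p x" and s': "stage u' e' k' y' v' p' x'"
  shows "\<exists>l\<in>Obj J. Hom J (u, e, k, y) l \<noteq> {} \<and> Hom J (u', e', k', y') l \<noteq> {}"
proof -
  note d = stageD[OF s] and d' = stageD[OF s']
  obtain s i1 i2 p1 p2 where bs: "is_biproduct C u u' s i1 i2 p1 p2"
    "Comp C u s u' p2 i1 = hzero u u'" "Comp C u' s u p1 i2 = hzero u' u" using biproduct_exists[OF d(1) d'(1)] .
  obtain t j1 j2 q1 q2 where bt: "is_biproduct C v v' t j1 j2 q1 q2"
    "Comp C v t v' q2 j1 = hzero v v'" "Comp C v' t v q1 j2 = hzero v' v" using biproduct_exists[OF d(3) d'(3)] .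
  have hs: "s \<in> Obj C" "i1 \<in> Hom C u s" "i2 \<in> Hom C u' s" "p1 \<in> Hom C s u" "p2 \<in> Hom C s u'"
    using bs by (auto simp: is_biproduct_def)
  have ht: "t \<in> Obj C" "j1 \<in> Hom C v t" "j2 \<in> Hom C v' t" "q1 \<in> Hom C t v" "q2 \<in> Hom C t v'"
    "Comp C v t v q1 j1 = Id C v" "Comp C v' t v' q2 j2 = Id C v'"
    using bt by (auto simp: is_biproduct_def)
  let ?y = "Act G s u p1 y \<oplus>\<^bsub>Val G s\<^esub> Act G s u' p2 y'" and ?x = "Act F t v q1 x \<oplus>\<^bsub>Val F t\<^esub> Act F t v' q2 x'"
  let ?g = "Comp C t v s (Comp C v u s i1 p) q1" and ?g' = "Comp C t v' s (Comp C v' u' s i2 p') q2"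
  let ?p = "?g \<oplus>\<^bsub>HomMod C t s\<^esub> ?g'"
  note y = lex_pair[OF lex_psh[OF G] bs d(1) d'(1) d(4) d'(4)]
  have ip: "Comp C v u s i1 p \<in> Hom C v s" "Comp C v' u' s i2 p' \<in> Hom C v' s"
    using d d' hs by (simp_all add: comp_closed)
  have g: "?g \<in> Hom C t s" "?g' \<in> Hom C t s" using d d' hs ht ip by (simp_all add: comp_closed)
  have p: "?p \<in> Hom C t s" using g hs ht by (simp add: add_hom)
  obtain l k'' where l: "l \<in> Obj C" "is_cokernel C t s l ?p k''" using cokernel_exists[OF ht(1) hs(1) p] .
  note k'' = cokernelD[OF l(2)]
  have "Act G t s ?g ?y = Act G t v q1 (\<alpha> v x)" "Act G t s ?g' ?y = Act G t v' q2 (\<alpha> v' x')"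
    using d d' hs ht y ip by (simp_all add: G.act_comp)
  then have "Act G t s ?p ?y = \<alpha> t ?x"
    using d d' hs ht y g
    by (simp add: G.act_add nat_trans_add[OF \<alpha>] nat_trans_act[OF \<alpha>] F.act_closed)
  then have sl: "stage s l k'' ?y t ?p ?x"
    unfolding cokernel_stage_def using hs ht l y d d' by (simp add: F.act_closed F.el_add)
  have "Comp C v t s ?g j1 = Comp C v u s i1 p" "Comp C v t s ?g' j1 = hzero v s"
    using comp_assoc[OF d(3) ht(1) d(3) hs(1) ht(2,4) ip(1), symmetric]
      comp_assoc[OF d(3) ht(1) d'(3) hs(1) ht(2,5) ip(2), symmetric] d d' hs ht bt ip
    by (simp_all add: id_right comp_zero_right)
  then have j1: "Comp C v t s ?p j1 = Comp C v u s i1 p"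
    using comp_add_left[OF d(3) ht(1) hs(1) ht(2) g] d hs ip by (simp add: hom_r_zero)
  have "Comp C v' t s ?g j2 = hzero v' s" "Comp C v' t s ?g' j2 = Comp C v' u' s i2 p'"
    using comp_assoc[OF d'(3) ht(1) d(3) hs(1) ht(3,4) ip(1), symmetric]
      comp_assoc[OF d'(3) ht(1) d'(3) hs(1) ht(3,5) ip(2), symmetric] d d' hs ht bt ip
    by (simp_all add: id_right comp_zero_right)
  then have j2: "Comp C v' t s ?p j2 = Comp C v' u' s i2 p'"
    using comp_add_left[OF d'(3) ht(1) hs(1) ht(3) g] d' hs ip by (simp add: hom_l_zero)
  have 1: "Comp C v s l k'' (Comp C v u s i1 p) = hzero v l"
    using comp_assoc[OF d(3) ht(1) hs(1) l(1) ht(2) p k''(2)] d ht k'' l by (simp add: j1 comp_zero_left)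
  have 2: "Comp C v' s l k'' (Comp C v' u' s i2 p') = hzero v' l"
    using comp_assoc[OF d'(3) ht(1) hs(1) l(1) ht(3) p k''(2)] d' ht k'' l by (simp add: j2 comp_zero_left)
  obtain f where f: "(i1, f) \<in> Hom J (u, e, k, y) (s, l, k'', ?y)" using J_extend[OF s sl hs(2) y(2) 1] .
  obtain f' where f': "(i2, f') \<in> Hom J (u', e', k', y') (s, l, k'', ?y)" using J_extend[OF s' sl hs(3) y(3) 2] .
  have "(s, l, k'', ?y) \<in> Obj J" using sl by auto
  then show ?thesis using f f' by blast
qed

lemma J_coeq:
  assumes i: "i \<in> Obj J" and i': "i' \<in> Obj J" and f: "f \<in> Hom J i i'" and g: "g \<in> Hom J i i'"
  shows "\<exists>l\<in>Obj J. \<exists>w\<in>Hom J i' l. Comp J i i' l w f = Comp J i i' l w g"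
proof -
  obtain u e k y where eq: "i = (u, e, k, y)" by (cases i)
  obtain u' e' k' y' where eq': "i' = (u', e', k', y')" by (cases i')
  obtain v p x where s: "stage u e k y v p x" using i eq by auto
  obtain v' p' x' where s': "stage u' e' k' y' v' p' x'" using i' eq' by auto
  note d = stageD[OF s] and d' = stageD[OF s']
  obtain f1 f2 where feq: "f = (f1, f2)" by (cases f)
  obtain g1 g2 where geq: "g = (g1, g2)" by (cases g)
  have h: "f1 \<in> Hom C u u'" "g1 \<in> Hom C u u'" "f2 \<in> Hom C e e'" "g2 \<in> Hom C e e'"
    and sq: "Comp C u u' e' k' f1 = Comp C u e e' f2 k" "Comp C u u' e' k' g1 = Comp C u e e' g2 k"
    and act: "Act G u u' f1 y' = y" "Act G u u' g1 y' = y"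
    using f g by (auto simp: eq eq' feq geq)
  obtain c w where c: "c \<in> Obj C" "w \<in> Hom C u' c" "is_cokernel C u u' c (hdiff u u' f1 g1) w"
    "Comp C u u' c w f1 = Comp C u u' c w g1" using coequalizer_exists[OF d(1) d'(1) h(1,2)] .
  have "Act G u u' (hdiff u u' f1 g1) y' = elzero G u"
    using d d' h act by (simp add: G.act_hdiff mdiff_eq_zero_iff[OF G.val_module])
  then obtain z where z: "z \<in> el G c" "Act G u' c w z = y'"
    using lex_factor[OF G c(3) d(1) d'(1) c(1) d'(4)] by blast
  let ?p = "Comp C v' u' c w p'"
  have p: "?p \<in> Hom C v' c" using d' c by (simp add: comp_closed)
  obtain l k'' where l: "l \<in> Obj C" "is_cokernel C v' c l ?p k''" using cokernel_exists[OF d'(3) c(1) p] .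
  note k'' = cokernelD[OF l(2)]
  have "Act G v' c ?p z = \<alpha> v' x'" using d' c z by (simp add: G.act_comp)
  then have sl: "stage c l k'' z v' ?p x'" unfolding cokernel_stage_def using d' c l z by simp
  obtain w' where w': "(w, w') \<in> Hom J (u', e', k', y') (c, l, k'', z)"
    using J_extend[OF s' sl c(2) z(2) k''(3)] .
  then have w'h: "w' \<in> Hom C e' l" and wsq: "Comp C u' c l k'' w = Comp C u' e' l w' k'" by auto
  have "Comp C u e l (Comp C e e' l w' f2) k = Comp C u e' l w' (Comp C u u' e' k' f1)"
    using d d' l h w'h sq by (simp add: comp_assoc)
  also have "\<dots> = Comp C u u' l (Comp C u' c l k'' w) f1"
    using d d' l h w'h wsq by (simp add: comp_assoc)
  also have "\<dots> = Comp C u c l k'' (Comp C u u' c w f1)"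
    using d d' l h c(1,2) k'' by (simp add: comp_assoc)
  also have "\<dots> = Comp C u u' l (Comp C u' e' l w' k') g1"
    unfolding c(4) wsq[symmetric] using d d' l h c(1,2) k'' by (simp add: comp_assoc)
  also have "\<dots> = Comp C u e' l w' (Comp C u u' e' k' g1)"
    using d d' l h w'h by (simp add: comp_assoc)
  also have "\<dots> = Comp C u e l (Comp C e e' l w' g2) k"
    using d d' l h w'h sq by (simp add: comp_assoc)
  finally have "Comp C e e' l w' f2 = Comp C e e' l w' g2"
    using cokernel_cancel[OF d(6) d(3,1,2) l(1)] d d' l h w'h comp_closed by blast
  then have "Comp J i i' (c, l, k'', z) (w, w') f = Comp J i i' (c, l, k'', z) (w, w') g"
    using c by (simp add: eq eq' feq geq)
  moreover have "(c, l, k'', z) \<in> Obj J" using sl by auto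
  ultimately show ?thesis using w' eq' by blast
qed

text \<open>Through these stages \<open>G\<close> maps to the cokernel.\<close>

abbreviation unit_stage :: "'o \<Rightarrow> 'u \<Rightarrow> 'o \<times> 'o \<times> 'm \<times> 'u" where
  "unit_stage a y \<equiv> (a, a, Id C a, y)"

lemma unit_stage:
  assumes "a \<in> Obj C" "y \<in> el G a"
  shows "stage a a (Id C a) y a (hzero a a) (elzero F a)"
  unfolding cokernel_stage_def
  using assms cokernel_of_zero nat_trans_zero[OF \<alpha> F.linear_presheaf_axioms G.linear_presheaf_axioms]
  by (simp add: F.el_zero G.act_hzero)

lemma unit_stage_obj: "\<lbrakk>a \<in> Obj C; y \<in> el G a\<rbrakk> \<Longrightarrow> unit_stage a y \<in> Obj J"
  unfolding J_simps mem_Collect_eq fst_conv snd_conv using unit_stage by blast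

lemma J_filtered: "filtered_cat J"
  unfolding filtered_cat_def
proof (intro conjI ballI)
  show "category J" by (rule J_category)
  obtain a where "a \<in> Obj C" using object_exists by blast
  then show "Obj J \<noteq> {}" using unit_stage_obj[OF _ G.el_zero] by blast
  fix i i' assume i: "i \<in> Obj J" "i' \<in> Obj J"
  then obtain v p x v' p' x' where "stage (uo i) (eo i) (ko i) (yo i) v p x" "stage (uo i') (eo i') (ko i') (yo i') v' p' x'"
    by auto
  from J_join[OF this] show "\<exists>l\<in>Obj J. Hom J i l \<noteq> {} \<and> Hom J i' l \<noteq> {}" by simp
  fix f g assume "f \<in> Hom J i i'" "g \<in> Hom J i i'"
  then show "\<exists>l\<in>Obj J. \<exists>w\<in>Hom J i' l. Comp J i i' l w f = Comp J i i' l w g" using J_coeq i by blast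
qed

sublocale sys: filtered_system R C J "\<lambda>i. yon (eo i)" "\<lambda>i i' f a. Comp C a (eo i) (eo i') (snd f)"
proof (rule filtered_system.intro[OF linear_category_axioms], rule filtered_system_axioms.intro)
  show "filtered_cat J" by (rule J_filtered)
  show "linear_presheaf R C (yon (eo i))" if "i \<in> Obj J" for i using J_obj[OF that] by (simp add: yon_psh)
  show "presheaf_map (yon (eo i)) (yon (eo i')) (\<lambda>a. Comp C a (eo i) (eo i') (snd f))"
    if "i \<in> Obj J" "i' \<in> Obj J" "f \<in> Hom J i i'" for i i' f
    using J_obj[OF that(1)] J_obj[OF that(2)] that(3)
    by (intro presheaf_mapI) (simp_all add: carrier_hom comp_closed comp_add_right comp_smult_right comp_assoc)
  show "Comp C a (eo i) (eo i) (snd (Id J i)) x = x"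
    if "i \<in> Obj J" "a \<in> Obj C" "x \<in> el (yon (eo i)) a" for i a x
    using J_obj[OF that(1)] that(2,3) by (simp add: carrier_hom id_left)
  show "Comp C a (eo i) (eo k) (snd (Comp J i j k v u)) x = Comp C a (eo j) (eo k) (snd v) (Comp C a (eo i) (eo j) (snd u) x)"
    if "i \<in> Obj J" "j \<in> Obj J" "k \<in> Obj J" "u \<in> Hom J i j" "v \<in> Hom J j k" "a \<in> Obj C" "x \<in> el (yon (eo i)) a"
    for i j k u v a x
    using J_obj[OF that(1)] J_obj[OF that(2)] J_obj[OF that(3)] that(4-7) by (simp add: carrier_hom comp_assoc)
qed

lemma sys_small:
  assumes a: "a \<in> Obj C" shows "(SIGMA i:Obj J. el (yon (eo i)) a) \<lesssim> (UNIV :: 'u set)"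
proof (rule Sigma_lepoll_infinite[OF universe_infinite])
  have "Obj J \<subseteq> (SIGMA u:Obj C. SIGMA e:Obj C. Hom C u e \<times> UNIV)" using J_obj by fastforce
  then have "Obj J \<lesssim> (SIGMA u:Obj C. SIGMA e:Obj C. Hom C u e \<times> (UNIV :: 'u set))" by (rule subset_imp_lepoll)
  also have "\<dots> \<lesssim> (UNIV :: 'u set)"
    by (intro Sigma_lepoll_infinite[OF universe_infinite] Obj_small Times_lepoll_UNIV[OF universe_infinite] Hom_small
        lepoll_refl)
  finally show "Obj J \<lesssim> (UNIV :: 'u set)" .
  show "el (yon (eo i)) a \<lesssim> (UNIV :: 'u set)" if "i \<in> Obj J" for i
    using J_obj[OF that] a Hom_small by (simp add: carrier_hom)
qed

lemma cokernel_presheaf_exists: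
  "\<exists>(K :: ('o, 'm, 'r, 'u) presheaf) \<tau>. lex K \<and> \<tau> \<in> nat_trans R C G K \<and>
    (\<forall>a\<in>Obj C. \<forall>x\<in>el F a. \<tau> a (\<alpha> a x) = elzero K a) \<and>
    (\<forall>H \<beta>. lex H \<and> \<beta> \<in> nat_trans R C G H \<and> (\<forall>a\<in>Obj C. \<forall>x\<in>el F a. \<beta> a (\<alpha> a x) = elzero H a) \<longrightarrow>
      (\<exists>n\<in>nat_trans R C K H. \<forall>a\<in>Obj C. \<forall>y\<in>el G a. n a (\<tau> a y) = \<beta> a y)) \<and>
    (\<forall>H n n'. lex H \<and> n \<in> nat_trans R C K H \<and> n' \<in> nat_trans R C K H \<and>
      (\<forall>a\<in>Obj C. \<forall>y\<in>el G a. n a (\<tau> a y) = n' a (\<tau> a y)) \<longrightarrow> n = n') \<and>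
    (\<forall>a\<in>Obj C. \<forall>b\<in>Obj C. \<forall>z\<in>el K a. \<forall>q\<in>Hom C b a. \<forall>y\<in>el G b. Act K b a q z = \<tau> b y \<longrightarrow>
      (\<exists>u e k y' v p x j d. stage u e k y' v p x \<and> j \<in> Hom C b u \<and> Act G b u j y' = y \<and>
        d \<in> Hom C a e \<and> Comp C b u e k j = Comp C b a e d q))"
proof -
  obtain K :: "('o, 'm, 'r, 'u) presheaf" and \<gamma>
    where K: "pw_colimit J (\<lambda>i. yon (eo i)) (\<lambda>i i' f a. Comp C a (eo i) (eo i') (snd f)) K \<gamma>"
    using sys.pw_colimit_exists[OF sys_small] by blast
  interpret K: linear_presheaf R C K using K by (rule pw_colimit_psh)
  have Kl: "lex K" by (rule sys.lex_pw_colimit[OF K]) (use J_obj in \<open>blast intro: yon_lex\<close>)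
  note \<gamma> = pw_colimit_map[OF K]
  have \<gamma>_closed: "\<gamma> i a h \<in> el K a" if "i \<in> Obj J" "a \<in> Obj C" "h \<in> Hom C a (eo i)" for i a h
    using presheaf_map_closed[OF \<gamma>[OF that(1)] that(2), of h] that J_obj[OF that(1)] by (simp add: carrier_hom)
  have \<gamma>_add: "\<gamma> i a (h \<oplus>\<^bsub>HomMod C a (eo i)\<^esub> h') = \<gamma> i a h \<oplus>\<^bsub>Val K a\<^esub> \<gamma> i a h'"
    if "i \<in> Obj J" "a \<in> Obj C" "h \<in> Hom C a (eo i)" "h' \<in> Hom C a (eo i)" for i a h h'
    using presheaf_map_add[OF \<gamma>[OF that(1)] that(2), of h h'] that J_obj[OF that(1)] by (simp add: carrier_hom)
  have \<gamma>_smult: "\<gamma> i a (r \<odot>\<^bsub>HomMod C a (eo i)\<^esub> h) = r \<odot>\<^bsub>Val K a\<^esub> \<gamma> i a h"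
    if "i \<in> Obj J" "a \<in> Obj C" "h \<in> Hom C a (eo i)" "r \<in> carrier R" for i a h r
    using presheaf_map_smult[OF \<gamma>[OF that(1)] that(2,4), of h] that J_obj[OF that(1)] by (simp add: carrier_hom)
  have \<gamma>_act: "Act K b a f (\<gamma> i a h) = \<gamma> i b (Comp C b a (eo i) h f)"
    if "i \<in> Obj J" "b \<in> Obj C" "a \<in> Obj C" "f \<in> Hom C b a" "h \<in> Hom C a (eo i)" for i a b f h
    using presheaf_map_act[OF \<gamma>[OF that(1)] that(2,3,4), of h] that J_obj[OF that(1)] by (simp add: carrier_hom)
  have \<gamma>_zero: "\<gamma> i a (hzero a (eo i)) = elzero K a" if "i \<in> Obj J" "a \<in> Obj C" for i a
    using presheaf_map_zero[OF \<gamma>[OF that(1)] yon_psh K.linear_presheaf_axioms that(2)] J_obj[OF that(1)] by simp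
  have K_surj: "\<exists>i h. i \<in> Obj J \<and> h \<in> Hom C a (eo i) \<and> z = \<gamma> i a h" if a: "a \<in> Obj C" "z \<in> el K a" for a z
  proof -
    obtain i h where i: "i \<in> Obj J" "h \<in> el (yon (eo i)) a" "z = \<gamma> i a h" using pw_colimit_surj[OF K a] .
    then have "h \<in> Hom C a (eo i)" using a J_obj[OF i(1)] by (simp add: carrier_hom)
    then show ?thesis using i by blast
  qed
  define \<tau> where "\<tau> = nt G (\<lambda>a y. \<gamma> (unit_stage a y) a (Id C a))"
  have \<tau>_apply: "\<tau> a y = \<gamma> (unit_stage a y) a (Id C a)" if "a \<in> Obj C" "y \<in> el G a" for a y
    using that by (simp add: \<tau>_def)
  have \<tau>_stage: "\<tau> a (Act G a (uo i) f (yo i)) = \<gamma> i a (Comp C a (uo i) (eo i) (ko i) f)"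
    if i: "i \<in> Obj J" and a: "a \<in> Obj C" and f: "f \<in> Hom C a (uo i)" for i a f
  proof -
    note o = J_obj[OF i]
    let ?y = "Act G a (uo i) f (yo i)" and ?g = "Comp C a (uo i) (eo i) (ko i) f"
    have y: "?y \<in> el G a" using o a f by (simp add: G.act_closed)
    have g: "?g \<in> Hom C a (eo i)" using o a f by (simp add: comp_closed)
    have "(f, ?g) \<in> Hom J (unit_stage a ?y) i" using o a f g by (simp add: id_right)
    from pw_colimit_cocone[OF K unit_stage_obj[OF a y] i this a, of "Id C a"]
    show ?thesis using a y g o by (simp add: \<tau>_apply carrier_hom id_closed id_right)
  qed
  have \<tau>: "\<tau> \<in> nat_trans R C G K"
    unfolding \<tau>_def
  proof (rule nt_nat_trans[OF G.linear_presheaf_axioms], rule presheaf_mapI)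
    fix a y assume a: "a \<in> Obj C" "y \<in> el G a"
    note ob = unit_stage_obj[OF a]
    show "\<gamma> (unit_stage a y) a (Id C a) \<in> el K a" using \<gamma>_closed[OF ob a(1)] a by (simp add: id_closed)
    {
      fix y' assume y': "y' \<in> el G a"
      obtain s i j p q where s: "is_biproduct C a a s i j p q"
        "Comp C a s a q i = hzero a a" "Comp C a s a p j = hzero a a" using biproduct_exists[OF a(1) a(1)] .
      have h: "s \<in> Obj C" "i \<in> Hom C a s" "j \<in> Hom C a s" using s by (auto simp: is_biproduct_def)
      let ?z = "Act G s a p y \<oplus>\<^bsub>Val G s\<^esub> Act G s a q y'"
      note z = lex_pair[OF G.linear_presheaf_axioms s a(1) a(1) a(2) y']
      note os = unit_stage_obj[OF h(1) z(1)]
      let ?i = "i \<oplus>\<^bsub>HomMod C a s\<^esub> j"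
      have ij: "?i \<in> Hom C a s" using h a by (simp add: add_hom)
      have "Act G a s ?i ?z = y \<oplus>\<^bsub>Val G a\<^esub> y'" using h a z by (simp add: G.act_add)
      then have "\<tau> a (y \<oplus>\<^bsub>Val G a\<^esub> y') = \<gamma> (unit_stage s ?z) a ?i"
        using \<tau>_stage[OF os a(1), of ?i] ij h a by (simp add: id_left)
      moreover have "\<tau> a y = \<gamma> (unit_stage s ?z) a i" "\<tau> a y' = \<gamma> (unit_stage s ?z) a j"
        using \<tau>_stage[OF os a(1), of i] \<tau>_stage[OF os a(1), of j] h a z by (simp_all add: id_left)
      ultimately show "\<gamma> (unit_stage a (y \<oplus>\<^bsub>Val G a\<^esub> y')) a (Id C a)
          = \<gamma> (unit_stage a y) a (Id C a) \<oplus>\<^bsub>Val K a\<^esub> \<gamma> (unit_stage a y') a (Id C a)"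
        using \<gamma>_add[OF os a(1), of i j] h a y' by (simp add: \<tau>_apply G.el_add)
    }
    {
      fix r assume r: "r \<in> carrier R"
      let ?r = "r \<odot>\<^bsub>HomMod C a a\<^esub> Id C a"
      have rh: "?r \<in> Hom C a a" using a r by (simp add: smult_hom id_closed)
      have "Act G a a ?r y = r \<odot>\<^bsub>Val G a\<^esub> y" using a r by (simp add: G.act_smult id_closed G.act_id)
      then have "\<tau> a (r \<odot>\<^bsub>Val G a\<^esub> y) = \<gamma> (unit_stage a y) a ?r"
        using \<tau>_stage[OF ob a(1), of ?r] rh a by (simp add: id_left)
      then show "\<gamma> (unit_stage a (r \<odot>\<^bsub>Val G a\<^esub> y)) a (Id C a) = r \<odot>\<^bsub>Val K a\<^esub> \<gamma> (unit_stage a y) a (Id C a)"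
        using \<gamma>_smult[OF ob a(1), of "Id C a" r] a r by (simp add: \<tau>_apply G.el_smult id_closed)
    }
    fix b f assume b: "b \<in> Obj C" "f \<in> Hom C b a"
    have "\<tau> b (Act G b a f y) = \<gamma> (unit_stage a y) b f"
      using \<tau>_stage[OF ob b(1), of f] a b by (simp add: id_left)
    then show "\<gamma> (unit_stage b (Act G b a f y)) b (Id C b) = Act K b a f (\<gamma> (unit_stage a y) a (Id C a))"
      using \<gamma>_act[OF ob b(1) a(1) b(2), of "Id C a"] a b by (simp add: \<tau>_apply G.act_closed id_closed id_left)
  qed
  have \<tau>\<alpha>: "\<tau> a (\<alpha> a x) = elzero K a" if a: "a \<in> Obj C" "x \<in> el F a" for a x
  proof -
    obtain e k where e: "e \<in> Obj C" "is_cokernel C a a e (Id C a) k"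
      using cokernel_exists[OF a(1) a(1) id_closed[OF a(1)]] .
    note k = cokernelD[OF e(2)]
    have y: "\<alpha> a x \<in> el G a" using a by (rule nat_trans_closed[OF \<alpha>])
    then have "stage a e k (\<alpha> a x) a (Id C a) x" using a e by (simp add: cokernel_stage_def G.act_id)
    then have ob: "(a, e, k, \<alpha> a x) \<in> Obj J" by auto
    have "\<tau> a (\<alpha> a x) = \<gamma> (a, e, k, \<alpha> a x) a (hzero a e)"
      using \<tau>_stage[OF ob a(1), of "Id C a"] a k y by (simp add: id_closed G.act_id)
    then show ?thesis using \<gamma>_zero[OF ob a(1)] by simp
  qed
  have \<gamma>_gen: "\<gamma> i (eo i) (Id C (eo i)) \<in> el K (eo i)"
      "Act K (uo i) (eo i) (ko i) (\<gamma> i (eo i) (Id C (eo i))) = \<tau> (uo i) (yo i)"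
      "\<And>a h. \<lbrakk>a \<in> Obj C; h \<in> Hom C a (eo i)\<rbrakk> \<Longrightarrow> Act K a (eo i) h (\<gamma> i (eo i) (Id C (eo i))) = \<gamma> i a h"
    if i: "i \<in> Obj J" for i
  proof -
    note o = J_obj[OF i]
    show "\<gamma> i (eo i) (Id C (eo i)) \<in> el K (eo i)" using \<gamma>_closed[OF i] o by (simp add: id_closed)
    show *: "Act K a (eo i) h (\<gamma> i (eo i) (Id C (eo i))) = \<gamma> i a h" if "a \<in> Obj C" "h \<in> Hom C a (eo i)" for a h
      using \<gamma>_act[OF i that(1) o(2) that(2) id_closed[OF o(2)]] that o by (simp add: id_left)
    show "Act K (uo i) (eo i) (ko i) (\<gamma> i (eo i) (Id C (eo i))) = \<tau> (uo i) (yo i)"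
      using \<tau>_stage[OF i o(1) id_closed[OF o(1)]] *[OF o(1,3)] o by (simp add: id_right G.act_id)
  qed
  have univ: "\<exists>n\<in>nat_trans R C K H. \<forall>a\<in>Obj C. \<forall>y\<in>el G a. n a (\<tau> a y) = \<beta> a y"
    if H: "lex H" and \<beta>: "\<beta> \<in> nat_trans R C G H" and \<beta>\<alpha>: "\<forall>a\<in>Obj C. \<forall>x\<in>el F a. \<beta> a (\<alpha> a x) = elzero H a"
    for H \<beta>
  proof -
    interpret H: linear_presheaf R C H using H by (rule lex_psh)
    have "\<exists>z\<in>el H (eo i). Act H (uo i) (eo i) (ko i) z = \<beta> (uo i) (yo i)" if i: "i \<in> Obj J" for i
    proof -
      obtain v p x where "stage (uo i) (eo i) (ko i) (yo i) v p x" using i by auto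
      note d = stageD[OF this]
      have "Act H v (uo i) p (\<beta> (uo i) (yo i)) = elzero H v"
        using d \<beta>\<alpha> by (simp flip: nat_trans_act[OF \<beta>])
      then show ?thesis
        using lex_factor[OF H d(6) d(3,1,2)] nat_trans_closed[OF \<beta> d(1,4)] by metis
    qed
    then obtain \<zeta> where \<zeta>: "\<And>i. i \<in> Obj J \<Longrightarrow> \<zeta> i \<in> el H (eo i)"
        "\<And>i. i \<in> Obj J \<Longrightarrow> Act H (uo i) (eo i) (ko i) (\<zeta> i) = \<beta> (uo i) (yo i)"
      by metis
    have \<zeta>_trans: "Act H (eo i) (eo i') (snd f) (\<zeta> i') = \<zeta> i"
      if ob: "i \<in> Obj J" "i' \<in> Obj J" and "f \<in> Hom J i i'" for i i' f
    proof -
      note o = J_obj[OF ob(1)] and o' = J_obj[OF ob(2)]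
      have f: "fst f \<in> Hom C (uo i) (uo i')" "snd f \<in> Hom C (eo i) (eo i')"
          "Comp C (uo i) (uo i') (eo i') (ko i') (fst f) = Comp C (uo i) (eo i) (eo i') (snd f) (ko i)"
          "Act G (uo i) (uo i') (fst f) (yo i') = yo i"
        using \<open>f \<in> Hom J i i'\<close> by auto
      obtain v p x where "stage (uo i) (eo i) (ko i) (yo i) v p x" using ob by auto
      note d = stageD[OF this]
      have "Act H (uo i) (eo i) (ko i) (Act H (eo i) (eo i') (snd f) (\<zeta> i'))
          = Act H (uo i) (eo i') (Comp C (uo i) (uo i') (eo i') (ko i') (fst f)) (\<zeta> i')"
        unfolding f(3) using o o' f \<zeta>(1)[OF ob(2)] by (simp add: H.act_comp)
      also have "\<dots> = Act H (uo i) (uo i') (fst f) (\<beta> (uo i') (yo i'))"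
        using o o' f(1,2) \<zeta>[OF ob(2)] by (simp add: H.act_comp)
      also have "\<dots> = Act H (uo i) (eo i) (ko i) (\<zeta> i)"
        using o o' f \<zeta>(2)[OF ob(1)] by (simp flip: nat_trans_act[OF \<beta>])
      finally show ?thesis
        by (rule lex_cancel[OF H d(6) d(3,1,2) H.act_closed[OF o(2) o'(2) f(2) \<zeta>(1)[OF ob(2)]] \<zeta>(1)[OF ob(1)]])
    qed
    obtain n where n: "presheaf_map K H n"
        "\<forall>i\<in>Obj J. \<forall>a\<in>Obj C. \<forall>h\<in>el (yon (eo i)) a. n a (\<gamma> i a h) = yoneda_map H (eo i) (\<zeta> i) a h"
    proof (rule exE[OF sys.pw_colimit_universal[OF K H.linear_presheaf_axioms]])
      show "presheaf_map (yon (eo i)) H (yoneda_map H (eo i) (\<zeta> i))" if "i \<in> Obj J" for i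
        using yoneda_map[OF H.linear_presheaf_axioms J_obj(2)[OF that] \<zeta>(1)[OF that]] .
      show "yoneda_map H (eo i') (\<zeta> i') a (Comp C a (eo i) (eo i') (snd f) h) = yoneda_map H (eo i) (\<zeta> i) a h"
        if "i \<in> Obj J" "i' \<in> Obj J" "f \<in> Hom J i i'" "a \<in> Obj C" "h \<in> el (yon (eo i)) a" for i i' f a h
        using J_obj[OF that(1)] J_obj[OF that(2)] that(3-5) \<zeta>(1)[OF that(2)] \<zeta>_trans[OF that(1-3)]
        by (simp add: yoneda_map_def carrier_hom H.act_comp)
    qed blast
    have "n a (\<tau> a y) = \<beta> a y" if a: "a \<in> Obj C" "y \<in> el G a" for a y
    proof -
      note ob = unit_stage_obj[OF a]
      have "n a (\<tau> a y) = \<zeta> (unit_stage a y)"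
        using n(2) ob a \<zeta>(1)[OF ob] by (simp add: \<tau>_apply yoneda_map_def carrier_hom id_closed H.act_id del: J_simps)
      then show ?thesis using \<zeta>[OF ob] a by (simp add: H.act_id)
    qed
    then show ?thesis
      using nt_nat_trans[OF K.linear_presheaf_axioms n(1)] nat_trans_closed[OF \<tau>]
      by (intro bexI[of _ "nt K n"]) simp_all
  qed
  have uniq: "n = n'"
    if H: "lex H" and n: "n \<in> nat_trans R C K H" "n' \<in> nat_trans R C K H"
      and eq: "\<forall>a\<in>Obj C. \<forall>y\<in>el G a. n a (\<tau> a y) = n' a (\<tau> a y)" for H n n'
  proof (rule nat_trans_ext[OF n])
    fix a z assume a: "a \<in> Obj C" "z \<in> el K a"
    then obtain i h where i: "i \<in> Obj J" and h: "h \<in> Hom C a (eo i)" "z = \<gamma> i a h" using K_surj by blast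
    note o = J_obj[OF i] and g = \<gamma>_gen[OF i]
    obtain v p x where "stage (uo i) (eo i) (ko i) (yo i) v p x" using i by auto
    note d = stageD[OF this]
    let ?g = "\<gamma> i (eo i) (Id C (eo i))"
    have "Act H (uo i) (eo i) (ko i) (n (eo i) ?g) = Act H (uo i) (eo i) (ko i) (n' (eo i) ?g)"
      using o g(1,2) eq by (simp flip: nat_trans_act[OF n(1)] nat_trans_act[OF n(2)])
    then have "n (eo i) ?g = n' (eo i) ?g"
      by (rule lex_cancel[OF H d(6) d(3,1,2) nat_trans_closed[OF n(1) o(2) g(1)] nat_trans_closed[OF n(2) o(2) g(1)]])
    then show "n a z = n' a z"
      using g(3)[OF a(1) h(1)] nat_trans_act[OF n(1) a(1) o(2) h(1) g(1)] nat_trans_act[OF n(2) a(1) o(2) h(1) g(1)] h(2)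
      by simp
  qed
  have ev: "\<exists>u e k y' v p x j d. stage u e k y' v p x \<and> j \<in> Hom C b u \<and> Act G b u j y' = y \<and>
        d \<in> Hom C a e \<and> Comp C b u e k j = Comp C b a e d q"
    if a: "a \<in> Obj C" and b: "b \<in> Obj C" and z: "z \<in> el K a" and q: "q \<in> Hom C b a" and y: "y \<in> el G b"
      and eq: "Act K b a q z = \<tau> b y" for a b z q y
  proof -
    obtain i h where i: "i \<in> Obj J" and h: "h \<in> Hom C a (eo i)" "z = \<gamma> i a h" using K_surj a z by blast
    note o = J_obj[OF i] and ob = unit_stage_obj[OF b y]
    have hq: "Comp C b a (eo i) h q \<in> Hom C b (eo i)" using o a b h q by (simp add: comp_closed)
    have g_eq: "\<gamma> i b (Comp C b a (eo i) h q) = \<gamma> (unit_stage b y) b (Id C b)"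
      using eq \<gamma>_act[OF i b a q h(1)] h(2) b y by (simp add: \<tau>_apply)
    have el: "Comp C b a (eo i) h q \<in> el (yon (eo i)) b" "Id C b \<in> el (yon (eo (unit_stage b y))) b"
      using o b hq by (simp_all add: carrier_hom id_closed)
    obtain l f g where l: "l \<in> Obj J" and f: "f \<in> Hom J i l" and g: "g \<in> Hom J (unit_stage b y) l"
      and fg: "Comp C b (eo i) (eo l) (snd f) (Comp C b a (eo i) h q) = Comp C b (eo (unit_stage b y)) (eo l) (snd g) (Id C b)"
      using sys.pw_colimit_eqD[OF K b i ob el g_eq] .
    note ol = J_obj[OF l]
    have gh: "fst g \<in> Hom C b (uo l)" "snd g \<in> Hom C b (eo l)" "Act G b (uo l) (fst g) (yo l) = y"
      "Comp C b (uo l) (eo l) (ko l) (fst g) = snd g" and fh: "snd f \<in> Hom C (eo i) (eo l)"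
      using f g b ol by (auto simp: id_right)
    obtain v p x where "stage (uo l) (eo l) (ko l) (yo l) v p x" using l by auto
    moreover have "Comp C a (eo i) (eo l) (snd f) h \<in> Hom C a (eo l)" using a o ol fh h by (simp add: comp_closed)
    moreover have "Comp C b (uo l) (eo l) (ko l) (fst g) = Comp C b a (eo l) (Comp C a (eo i) (eo l) (snd f) h) q"
      using fg gh fh a b o ol h q by (simp add: comp_assoc id_right)
    ultimately show ?thesis using gh by blast
  qed
  show ?thesis
    by (rule exI[of _ K], rule exI[of _ \<tau>], intro conjI allI ballI impI; (elim conjE)?;
      (rule Kl \<tau> \<tau>\<alpha> univ uniq ev; assumption))
qed

end

context small_cocomplete_category
begin

interpretation ind: linear_category R ind by (rule ind_linear_category)

lemma ind_comp_eqI: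
  "\<lbrakk>lex F; s \<in> nat_trans R C F G; t \<in> nat_trans R C G H; r \<in> nat_trans R C F H;
    \<And>a x. \<lbrakk>a \<in> Obj C; x \<in> el F a\<rbrakk> \<Longrightarrow> t a (s a x) = r a x\<rbrakk> \<Longrightarrow> Comp ind F G H t s = r"
  using nat_trans_ext[OF nat_trans_comp[OF lex_psh], of F s G t H r] by simp

lemma ind_comp_eqD:
  "\<lbrakk>Comp ind F G H t s = r; a \<in> Obj C; x \<in> el F a\<rbrakk> \<Longrightarrow> t a (s a x) = r a x"
  by auto

lemma ind_comp_zero_iff:
  assumes "lex F" "lex H" "s \<in> nat_trans R C F G" "t \<in> nat_trans R C G H"
  shows "Comp ind F G H t s = \<zero>\<^bsub>HomMod ind F H\<^esub> \<longleftrightarrow> (\<forall>a\<in>Obj C. \<forall>x\<in>el F a. t a (s a x) = elzero H a)"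
proof
  assume eq: "Comp ind F G H t s = \<zero>\<^bsub>HomMod ind F H\<^esub>"
  show "\<forall>a\<in>Obj C. \<forall>x\<in>el F a. t a (s a x) = elzero H a"
  proof (intro ballI)
    fix a x assume a: "a \<in> Obj C" "x \<in> el F a"
    show "t a (s a x) = elzero H a" using ind_comp_eqD[OF eq a] a by (simp add: nat_trans_zero_apply)
  qed
next
  assume eq: "\<forall>a\<in>Obj C. \<forall>x\<in>el F a. t a (s a x) = elzero H a"
  have "\<zero>\<^bsub>HomMod ind F H\<^esub> \<in> nat_trans R C F H"
    using ind.zero_hom[of F H] assms by simp
  then show "Comp ind F G H t s = \<zero>\<^bsub>HomMod ind F H\<^esub>"
    using eq by (intro ind_comp_eqI[OF assms(1,3,4)]) (simp_all add: nat_trans_zero_apply)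
qed

text \<open>
  The last property describes equality in the filtered colimit: an element of the cokernel that
  restricts along \<open>q\<close> to the image of \<open>y\<close> does so already at some stage.
\<close>

theorem ind_cokernel_exists:
  assumes F: "lex F" and G: "lex G" and \<alpha>: "\<alpha> \<in> nat_trans R C F G"
  obtains K \<tau> where "lex K" "is_cokernel ind F G K \<alpha> \<tau>"
    "\<And>a b z q y. \<lbrakk>a \<in> Obj C; b \<in> Obj C; z \<in> el K a; q \<in> Hom C b a; y \<in> el G b; Act K b a q z = \<tau> b y\<rbrakk>
      \<Longrightarrow> \<exists>u e k y' v p x j d. cokernel_stage F G \<alpha> u e k y' v p x \<and> j \<in> Hom C b u \<and> Act G b u j y' = y \<and>
        d \<in> Hom C a e \<and> Comp C b u e k j = Comp C b a e d q"
proof -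
  interpret cokernel_system R C U F G \<alpha>
    using assms by unfold_locales
  obtain K :: "('o, 'm, 'r, 'u) presheaf" and \<tau> where K: "lex K" and \<tau>: "\<tau> \<in> nat_trans R C G K"
    and \<tau>\<alpha>: "\<forall>a\<in>Obj C. \<forall>x\<in>el F a. \<tau> a (\<alpha> a x) = elzero K a"
    and univ: "\<forall>H \<beta>. lex H \<and> \<beta> \<in> nat_trans R C G H \<and> (\<forall>a\<in>Obj C. \<forall>x\<in>el F a. \<beta> a (\<alpha> a x) = elzero H a) \<longrightarrow>
      (\<exists>n\<in>nat_trans R C K H. \<forall>a\<in>Obj C. \<forall>y\<in>el G a. n a (\<tau> a y) = \<beta> a y)"
    and uniq: "\<forall>H n n'. lex H \<and> n \<in> nat_trans R C K H \<and> n' \<in> nat_trans R C K H \<and>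
      (\<forall>a\<in>Obj C. \<forall>y\<in>el G a. n a (\<tau> a y) = n' a (\<tau> a y)) \<longrightarrow> n = n'"
    and ev: "\<forall>a\<in>Obj C. \<forall>b\<in>Obj C. \<forall>z\<in>el K a. \<forall>q\<in>Hom C b a. \<forall>y\<in>el G b. Act K b a q z = \<tau> b y \<longrightarrow>
      (\<exists>u e k y' v p x j d. stage u e k y' v p x \<and> j \<in> Hom C b u \<and> Act G b u j y' = y \<and>
        d \<in> Hom C a e \<and> Comp C b u e k j = Comp C b a e d q)"
    using cokernel_presheaf_exists by (elim exE conjE) (rule that; assumption)
  have "is_cokernel ind F G K \<alpha> \<tau>"
  proof (rule ind.is_cokernelI)
    show "Comp ind F G K \<tau> \<alpha> = \<zero>\<^bsub>HomMod ind F K\<^esub>"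
      using \<tau>\<alpha> by (subst ind_comp_zero_iff[OF F K \<alpha> \<tau>])
    show "is_epi ind G K \<tau>"
      unfolding is_epi_def
    proof (intro conjI ballI impI)
      fix H n n' assume H: "H \<in> Obj ind" "n \<in> Hom ind K H" "n' \<in> Hom ind K H"
        and eq: "Comp ind G K H n \<tau> = Comp ind G K H n' \<tau>"
      have "n a (\<tau> a y) = n' a (\<tau> a y)" if "a \<in> Obj C" "y \<in> el G a" for a y
        using ind_comp_eqD[OF eq that] that by simp
      then show "n = n'" using uniq H by (simp del: presheaf_cat_simps)
    qed (simp add: \<tau>)
    fix H \<beta> assume "H \<in> Obj ind" "\<beta> \<in> Hom ind G H" and eq: "Comp ind F G H \<beta> \<alpha> = \<zero>\<^bsub>HomMod ind F H\<^esub>"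
    then have H: "lex H" "\<beta> \<in> nat_trans R C G H" by simp_all
    obtain n where n: "n \<in> nat_trans R C K H" "\<forall>a\<in>Obj C. \<forall>y\<in>el G a. n a (\<tau> a y) = \<beta> a y"
      using univ H eq ind_comp_zero_iff[OF F H(1) \<alpha> H(2)] by blast
    have "Comp ind G K H n \<tau> = \<beta>" by (rule ind_comp_eqI[OF G \<tau> n(1) H(2)]) (use n(2) in blast)
    then show "\<exists>h. h \<in> Hom ind K H \<and> Comp ind G K H h \<tau> = \<beta>" using n(1) by auto
  qed (use F G K \<alpha> in simp_all)
  then show thesis using that K ev by blast
qed

end

section \<open>Kernels and biproducts of ind-objects\<close>

context linear_category
begin

lemma cokernel_identity_zero:
  assumes a: "a \<in> Obj C" and e: "e \<in> Obj C" and k: "is_cokernel C a a e (Id C a) k"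
  shows "Id C e = hzero e e"
proof -
  note c = cokernelD[OF k]
  have "k = hzero a e" using c a e by (simp add: id_right)
  then have "Comp C a e e (Id C e) k = Comp C a e e (hzero e e) k"
    using c a e by (simp add: comp_zero_left id_left)
  then show ?thesis by (rule cokernel_cancel[OF k a a e e id_closed[OF e] zero_hom[OF e e]])
qed

lemma is_zero_objectI:
  assumes z: "z \<in> Obj C" "Id C z = hzero z z"
  shows "is_zero_object C z"
  unfolding is_zero_object_def
proof (intro conjI ballI)
  fix a assume a: "a \<in> Obj C"
  have "f = hzero z a" if "f \<in> Hom C z a" for f
    using id_right[OF z(1) a that] comp_zero_right[OF z(1) z(1) a that] z by simp
  then show "\<exists>!f. f \<in> Hom C z a" using zero_hom[OF z(1) a] by blast
  have "f = hzero a z" if "f \<in> Hom C a z" for f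
    using id_left[OF a z(1) that] comp_zero_left[OF a z(1) z(1) that] z by simp
  then show "\<exists>!f. f \<in> Hom C a z" using zero_hom[OF a z(1)] by blast
qed (rule z)

definition kernel_presheaf ::
    "('o, 'm, 'r, 'v) presheaf \<Rightarrow> ('o, 'm, 'r, 'v) presheaf \<Rightarrow> ('o \<Rightarrow> 'v \<Rightarrow> 'v) \<Rightarrow> ('o, 'm, 'r, 'v) presheaf" where
  "kernel_presheaf F G \<alpha> =
     \<lparr>Val = (\<lambda>a. (Val F a)\<lparr>carrier := {x \<in> el F a. \<alpha> a x = elzero G a}\<rparr>), Act = Act F\<rparr>"

lemma kernel_presheaf_simps [simp]:
  "el (kernel_presheaf F G \<alpha>) a = {x \<in> el F a. \<alpha> a x = elzero G a}"
  "add (Val (kernel_presheaf F G \<alpha>) a) = add (Val F a)"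
  "smult (Val (kernel_presheaf F G \<alpha>) a) = smult (Val F a)"
  "elzero (kernel_presheaf F G \<alpha>) a = elzero F a"
  "Act (kernel_presheaf F G \<alpha>) = Act F"
  by (simp_all add: kernel_presheaf_def)

lemma kernel_presheaf:
  assumes F: "linear_presheaf R C F" and G: "linear_presheaf R C G" and \<alpha>: "\<alpha> \<in> nat_trans R C F G"
  shows "linear_presheaf R C (kernel_presheaf F G \<alpha>)"
proof -
  interpret F: linear_presheaf R C F by fact
  interpret G: linear_presheaf R C G by fact
  show ?thesis
  proof (rule linear_presheaf.intro[OF linear_category_axioms], rule linear_presheaf_axioms.intro)
    fix a assume a: "a \<in> Obj C"
    interpret FM: module R "Val F a" by (rule F.val_module[OF a])
    interpret GM: module R "Val G a" by (rule G.val_module[OF a])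
    note add = nat_trans_add[OF \<alpha> a] and smult = nat_trans_smult[OF \<alpha> a]
    have neg: "(\<ominus> \<one>) \<odot>\<^bsub>Val F a\<^esub> x \<oplus>\<^bsub>Val F a\<^esub> x = elzero F a" if "x \<in> el F a" for x
      using that by (simp add: FM.smult_l_minus FM.M.l_neg)
    have "abelian_group (Val (kernel_presheaf F G \<alpha>) a)"
    proof (rule abelian_groupI)
      fix x assume "x \<in> el (kernel_presheaf F G \<alpha>) a"
      then show "\<exists>y\<in>el (kernel_presheaf F G \<alpha>) a. y \<oplus>\<^bsub>Val (kernel_presheaf F G \<alpha>) a\<^esub> x = elzero (kernel_presheaf F G \<alpha>) a"
        by (intro bexI[of _ "(\<ominus> \<one>) \<odot>\<^bsub>Val F a\<^esub> x"]) (simp_all add: neg smult)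
    qed (use add nat_trans_zero[OF \<alpha> F G a] in \<open>auto simp: FM.M.a_assoc intro: FM.M.a_comm\<close>)
    then show "module R (Val (kernel_presheaf F G \<alpha>) a)"
      by (rule moduleI[OF cring_R])
        (auto simp: smult FM.smult_l_distr FM.smult_r_distr FM.smult_assoc1)
  next
    fix a b f assume ab: "a \<in> Obj C" "b \<in> Obj C" "f \<in> Hom C a b"
    then show "Act (kernel_presheaf F G \<alpha>) a b f \<in> mod_hom R (Val (kernel_presheaf F G \<alpha>) b) (Val (kernel_presheaf F G \<alpha>) a)"
      by (intro mod_homI)
        (auto simp: F.act_closed nat_trans_act[OF \<alpha>] G.act_zero F.act_el_add F.act_el_smult)
  qed (auto simp: F.act_id F.act_comp F.act_add F.act_smult)
qed

lemma kernel_presheaf_lex: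
  assumes F: "lex F" and G: "lex G" and \<alpha>: "\<alpha> \<in> nat_trans R C F G"
  shows "lex (kernel_presheaf F G \<alpha>)"
proof (rule lexI)
  interpret F: linear_presheaf R C F using F by (rule lex_psh)
  interpret G: linear_presheaf R C G using G by (rule lex_psh)
  show "linear_presheaf R C (kernel_presheaf F G \<alpha>)"
    using F.linear_presheaf_axioms G.linear_presheaf_axioms \<alpha> by (rule kernel_presheaf)
  fix w v u p q assume o: "w \<in> Obj C" "v \<in> Obj C" "u \<in> Obj C" and c: "is_cokernel C w v u p q"
  note pq = cokernelD[OF c]
  {
    fix y assume "y \<in> el (kernel_presheaf F G \<alpha>) u" "Act (kernel_presheaf F G \<alpha>) v u q y = elzero (kernel_presheaf F G \<alpha>) v"
    then show "y = elzero (kernel_presheaf F G \<alpha>) u" using lex_zeroD[OF F c o] by simp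
  }
  fix x assume "x \<in> el (kernel_presheaf F G \<alpha>) v" "Act (kernel_presheaf F G \<alpha>) w v p x = elzero (kernel_presheaf F G \<alpha>) w"
  then have x: "x \<in> el F v" "\<alpha> v x = elzero G v" "Act F w v p x = elzero F w" by simp_all
  obtain y where y: "y \<in> el F u" "Act F v u q y = x" using lex_factor[OF F c o x(1,3)] .
  have "Act G v u q (\<alpha> u y) = elzero G v"
    using nat_trans_act[OF \<alpha> o(2,3) pq(2) y(1)] y x by simp
  then have "\<alpha> u y = elzero G u"
    using lex_zeroD[OF G c o] nat_trans_closed[OF \<alpha> o(3) y(1)] by blast
  then show "\<exists>y\<in>el (kernel_presheaf F G \<alpha>) u. Act (kernel_presheaf F G \<alpha>) v u q y = x" using y by auto
qed

definition product_presheaf ::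
    "('o, 'm, 'r, 'v) presheaf \<Rightarrow> ('o, 'm, 'r, 'w) presheaf \<Rightarrow> ('o, 'm, 'r, 'v \<times> 'w) presheaf" where
  "product_presheaf F G =
     \<lparr>Val = (\<lambda>a. \<lparr>carrier = el F a \<times> el G a, mult = undefined, one = undefined,
        zero = (elzero F a, elzero G a),
        add = (\<lambda>x y. (fst x \<oplus>\<^bsub>Val F a\<^esub> fst y, snd x \<oplus>\<^bsub>Val G a\<^esub> snd y)),
        smult = (\<lambda>r x. (r \<odot>\<^bsub>Val F a\<^esub> fst x, r \<odot>\<^bsub>Val G a\<^esub> snd x))\<rparr>),
      Act = (\<lambda>a b f x. (Act F a b f (fst x), Act G a b f (snd x)))\<rparr>"

lemma product_presheaf_simps [simp]:
  "el (product_presheaf F G) a = el F a \<times> el G a"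
  "elzero (product_presheaf F G) a = (elzero F a, elzero G a)"
  "add (Val (product_presheaf F G) a) x y = (fst x \<oplus>\<^bsub>Val F a\<^esub> fst y, snd x \<oplus>\<^bsub>Val G a\<^esub> snd y)"
  "smult (Val (product_presheaf F G) a) r x = (r \<odot>\<^bsub>Val F a\<^esub> fst x, r \<odot>\<^bsub>Val G a\<^esub> snd x)"
  "Act (product_presheaf F G) a b f x = (Act F a b f (fst x), Act G a b f (snd x))"
  by (simp_all add: product_presheaf_def)

lemma product_presheaf:
  assumes F: "linear_presheaf R C F" and G: "linear_presheaf R C G"
  shows "linear_presheaf R C (product_presheaf F G)"
proof -
  interpret F: linear_presheaf R C F by fact
  interpret G: linear_presheaf R C G by fact
  show ?thesis
  proof (rule linear_presheaf.intro[OF linear_category_axioms], rule linear_presheaf_axioms.intro)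
    fix a assume a: "a \<in> Obj C"
    interpret FM: module R "Val F a" by (rule F.val_module[OF a])
    interpret GM: module R "Val G a" by (rule G.val_module[OF a])
    have "abelian_group (Val (product_presheaf F G) a)"
    proof (rule abelian_groupI)
      fix x assume "x \<in> el (product_presheaf F G) a"
      then show "\<exists>y\<in>el (product_presheaf F G) a. y \<oplus>\<^bsub>Val (product_presheaf F G) a\<^esub> x = elzero (product_presheaf F G) a"
        by (intro bexI[of _ "(\<ominus>\<^bsub>Val F a\<^esub> fst x, \<ominus>\<^bsub>Val G a\<^esub> snd x)"]) (auto simp: FM.M.l_neg GM.M.l_neg)
    qed (auto simp: FM.M.a_assoc GM.M.a_assoc intro: FM.M.a_comm GM.M.a_comm)
    then show "module R (Val (product_presheaf F G) a)"
      by (rule moduleI[OF cring_R])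
        (auto simp: FM.smult_l_distr FM.smult_r_distr FM.smult_assoc1 GM.smult_l_distr GM.smult_r_distr GM.smult_assoc1)
  next
    fix a b f assume ab: "a \<in> Obj C" "b \<in> Obj C" "f \<in> Hom C a b"
    then show "Act (product_presheaf F G) a b f \<in> mod_hom R (Val (product_presheaf F G) b) (Val (product_presheaf F G) a)"
      by (intro mod_homI)
        (auto simp: F.act_closed F.act_el_add F.act_el_smult G.act_closed G.act_el_add G.act_el_smult)
  qed (auto simp: F.act_id F.act_comp F.act_add F.act_smult G.act_id G.act_comp G.act_add G.act_smult)
qed

lemma product_presheaf_lex:
  assumes F: "lex F" and G: "lex G" shows "lex (product_presheaf F G)"
proof (rule lexI)
  show "linear_presheaf R C (product_presheaf F G)" by (rule product_presheaf[OF lex_psh[OF F] lex_psh[OF G]])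
  fix w v u p q assume o: "w \<in> Obj C" "v \<in> Obj C" "u \<in> Obj C" and c: "is_cokernel C w v u p q"
  {
    fix y assume y: "y \<in> el (product_presheaf F G) u"
      and z: "Act (product_presheaf F G) v u q y = elzero (product_presheaf F G) v"
    have "fst y = elzero F u" by (rule lex_zeroD[OF F c o]) (use y z in \<open>simp_all add: mem_Times_iff\<close>)
    moreover have "snd y = elzero G u" by (rule lex_zeroD[OF G c o]) (use y z in \<open>simp_all add: mem_Times_iff\<close>)
    ultimately show "y = elzero (product_presheaf F G) u" by (simp add: prod_eq_iff)
  }
  fix x assume "x \<in> el (product_presheaf F G) v" "Act (product_presheaf F G) w v p x = elzero (product_presheaf F G) w"
  then have x: "fst x \<in> el F v" "Act F w v p (fst x) = elzero F w" "snd x \<in> el G v" "Act G w v p (snd x) = elzero G w"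
    by (simp_all add: mem_Times_iff)
  obtain y where y: "y \<in> el F u" "Act F v u q y = fst x" using lex_factor[OF F c o x(1,2)] .
  obtain y' where y': "y' \<in> el G u" "Act G v u q y' = snd x" using lex_factor[OF G c o x(3,4)] .
  show "\<exists>y\<in>el (product_presheaf F G) u. Act (product_presheaf F G) v u q y = x"
    using y y' by (intro bexI[of _ "(y, y')"]) simp_all
qed

end

context small_cocomplete_category
begin

interpretation ind: linear_category R ind by (rule ind_linear_category)

lemma ind_biproduct_exists:
  assumes F: "lex F" and G: "lex G"
  obtains S i j p q where "is_biproduct ind F G S i j p q"
proof -
  interpret F: linear_presheaf R C F using F by (rule lex_psh)
  interpret G: linear_presheaf R C G using G by (rule lex_psh)
  let ?P = "product_presheaf F G"
  have P: "linear_presheaf R C ?P" by (rule product_presheaf[OF F.linear_presheaf_axioms G.linear_presheaf_axioms])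
  have "el ?P a \<lesssim> (UNIV :: 'u set)" for a
    unfolding product_presheaf_simps
    by (rule Times_lepoll_UNIV[OF universe_infinite]) (simp_all add: subset_imp_lepoll)
  then obtain S :: "('o, 'm, 'r, 'u) presheaf" and t where S: "linear_presheaf R C S"
    and t: "presheaf_map ?P S t" and bij: "\<And>a. a \<in> Obj C \<Longrightarrow> bij_betw (t a) (el ?P a) (el S a)"
    using presheaf_transport[OF P] by blast
  let ?t' = "\<lambda>a. inv_into (el ?P a) (t a)"
  have t': "presheaf_map S ?P ?t'" by (rule presheaf_map_inverse[OF P t bij])
  have t't: "?t' a (t a x) = x" if "a \<in> Obj C" "x \<in> el ?P a" for a x
    using bij_betw_inv_into_left[OF bij[OF that(1)] that(2)] .
  have tt': "t a (?t' a x) = x" if "a \<in> Obj C" "x \<in> el S a" for a x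
    using bij_betw_inv_into_right[OF bij[OF that(1)] that(2)] .
  have Sl: "lex S" by (rule lex_retract[OF S product_presheaf_lex[OF F G] t' t tt'])
  have inj1: "presheaf_map F ?P (\<lambda>a x. (x, elzero G a))"
    by (rule presheaf_mapI)
      (simp_all add: G.el_zero G.act_zero module_l_zero[OF G.val_module] module.smult_r_null[OF G.val_module])
  have inj2: "presheaf_map G ?P (\<lambda>a x. (elzero F a, x))"
    by (rule presheaf_mapI)
      (simp_all add: F.el_zero F.act_zero module_l_zero[OF F.val_module] module.smult_r_null[OF F.val_module])
  have proj1: "presheaf_map ?P F (\<lambda>a. fst)" by (rule presheaf_mapI) (simp_all add: mem_Times_iff)
  have proj2: "presheaf_map ?P G (\<lambda>a. snd)" by (rule presheaf_mapI) (simp_all add: mem_Times_iff)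
  define i where "i = nt F (\<lambda>a x. t a (x, elzero G a))"
  define j where "j = nt G (\<lambda>a x. t a (elzero F a, x))"
  define p where "p = nt S (\<lambda>a x. fst (?t' a x))"
  define q where "q = nt S (\<lambda>a x. snd (?t' a x))"
  have h: "i \<in> nat_trans R C F S" "j \<in> nat_trans R C G S" "p \<in> nat_trans R C S F" "q \<in> nat_trans R C S G"
    unfolding i_def j_def p_def q_def
    by (rule nt_nat_trans[OF F.linear_presheaf_axioms presheaf_map_comp[OF inj1 t]]
        nt_nat_trans[OF G.linear_presheaf_axioms presheaf_map_comp[OF inj2 t]]
        nt_nat_trans[OF S presheaf_map_comp[OF t' proj1]] nt_nat_trans[OF S presheaf_map_comp[OF t' proj2]])+
  have cl: "t a (x, y) \<in> el S a" if "a \<in> Obj C" "x \<in> el F a" "y \<in> el G a" for a x y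
    using presheaf_map_closed[OF t that(1), of "(x, y)"] that by simp
  have cl': "?t' a x \<in> el ?P a" if "a \<in> Obj C" "x \<in> el S a" for a x
    using presheaf_map_closed[OF t' that] .
  have "Comp ind F S F p i = Id ind F"
    by (rule ind_comp_eqI[OF F h(1,3)])
      (use t't in \<open>simp_all add: i_def p_def cl F.el_zero G.el_zero nat_trans_id F.linear_presheaf_axioms\<close>)
  moreover have "Comp ind G S G q j = Id ind G"
    by (rule ind_comp_eqI[OF G h(2,4)])
      (use t't in \<open>simp_all add: j_def q_def cl F.el_zero G.el_zero nat_trans_id G.linear_presheaf_axioms\<close>)
  moreover have "Comp ind S F S i p \<oplus>\<^bsub>HomMod ind S S\<^esub> Comp ind S G S j q = Id ind S"
  proof (rule nat_trans_ext)
    have "Comp ind S F S i p \<in> Hom ind S S" "Comp ind S G S j q \<in> Hom ind S S"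
      using nat_trans_comp[OF S h(3,1)] nat_trans_comp[OF S h(4,2)] by simp_all
    then have "Comp ind S F S i p \<oplus>\<^bsub>HomMod ind S S\<^esub> Comp ind S G S j q \<in> Hom ind S S"
      using ind.add_hom[of S S] Sl by (simp del: ind_simps(3,4))
    then show "Comp ind S F S i p \<oplus>\<^bsub>HomMod ind S S\<^esub> Comp ind S G S j q \<in> nat_trans R C S S" by simp
    show "Id ind S \<in> nat_trans R C S S" using nat_trans_id[OF S] by simp
    fix a x assume a: "a \<in> Obj C" "x \<in> el S a"
    obtain y z where yz: "?t' a x = (y, z)" "y \<in> el F a" "z \<in> el G a" using cl'[OF a] by auto
    have "t a (y, elzero G a) \<oplus>\<^bsub>Val S a\<^esub> t a (elzero F a, z) = t a (?t' a x)"
      using presheaf_map_add[OF t a(1), of "(y, elzero G a)" "(elzero F a, z)"] yz a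
      by (simp add: F.el_zero G.el_zero module_l_zero[OF G.val_module] module_r_zero[OF F.val_module])
    then show "(Comp ind S F S i p \<oplus>\<^bsub>HomMod ind S S\<^esub> Comp ind S G S j q) a x = Id ind S a x"
      using a yz tt'[OF a] by (simp add: nat_trans_module_simps i_def j_def p_def q_def)
  qed
  ultimately have "is_biproduct ind F G S i j p q"
    using Sl h by (simp add: is_biproduct_def del: ind_simps(4,5))
  then show thesis by (rule that)
qed

lemma ind_kernel:
  assumes F: "lex F" and G: "lex G" and \<alpha>: "\<alpha> \<in> nat_trans R C F G"
  defines "K \<equiv> kernel_presheaf F G \<alpha>"
  shows "lex K" "is_kernel ind K F G (nt K (\<lambda>a x. x)) \<alpha>"
proof -
  show K: "lex K" unfolding K_def using F G \<alpha> by (rule kernel_presheaf_lex)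
  have i: "nt K (\<lambda>a x. x) \<in> nat_trans R C K F"
    by (rule nt_nat_trans[OF lex_psh[OF K]], rule presheaf_mapI) (simp_all add: K_def)
  show "is_kernel ind K F G (nt K (\<lambda>a x. x)) \<alpha>"
  proof (rule ind.is_kernelI)
    show "Comp ind K F G \<alpha> (nt K (\<lambda>a x. x)) = \<zero>\<^bsub>HomMod ind K G\<^esub>"
      by (subst ind_comp_zero_iff[OF K G i \<alpha>]) (simp add: K_def)
    show "is_mono ind K F (nt K (\<lambda>a x. x))"
      unfolding is_mono_def
    proof (intro conjI ballI impI)
      fix H g h assume "H \<in> Obj ind" "g \<in> Hom ind H K" "h \<in> Hom ind H K"
        and eq: "Comp ind H K F (nt K (\<lambda>a x. x)) g = Comp ind H K F (nt K (\<lambda>a x. x)) h"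
      then have g: "g \<in> nat_trans R C H K" "h \<in> nat_trans R C H K" by simp_all
      show "g = h"
      proof (rule nat_trans_ext[OF g])
        fix a x assume a: "a \<in> Obj C" "x \<in> el H a"
        show "g a x = h a x"
          using ind_comp_eqD[OF eq a] a nat_trans_closed[OF g(1) a] nat_trans_closed[OF g(2) a] by simp
      qed
    qed (use i in simp)
    fix H g assume "H \<in> Obj ind" "g \<in> Hom ind H F" and eq: "Comp ind H F G \<alpha> g = \<zero>\<^bsub>HomMod ind H G\<^esub>"
    then have H: "lex H" and g: "g \<in> nat_trans R C H F" by simp_all
    have z: "\<alpha> a (g a x) = elzero G a" if "a \<in> Obj C" "x \<in> el H a" for a x
      using eq that ind_comp_zero_iff[OF H G g \<alpha>] by blast
    have gK: "g \<in> nat_trans R C H K"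
      unfolding nat_trans_iff
    proof (intro conjI)
      show "presheaf_map H K g"
        by (rule presheaf_mapI)
          (simp_all add: K_def z nat_trans_closed[OF g] nat_trans_add[OF g] nat_trans_smult[OF g] nat_trans_act[OF g])
    qed (use g in \<open>auto simp: nat_trans_iff\<close>)
    have "Comp ind H K F (nt K (\<lambda>a x. x)) g = g"
      by (rule ind_comp_eqI[OF H gK i g]) (simp add: nat_trans_closed[OF gK])
    then show "\<exists>h. h \<in> Hom ind H K \<and> Comp ind H K F (nt K (\<lambda>a x. x)) h = g" using gK by auto
  qed (use F G K \<alpha> in simp_all)
qed

lemma ind_mono_zeroD:
  assumes F: "lex F" and G: "lex G" and mono: "is_mono ind F G \<alpha>" and a: "a \<in> Obj C" "x \<in> el F a"
    and z: "\<alpha> a x = elzero G a"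
  shows "x = elzero F a"
proof -
  interpret F: linear_presheaf R C F using F by (rule lex_psh)
  interpret G: linear_presheaf R C G using G by (rule lex_psh)
  have \<alpha>: "\<alpha> \<in> nat_trans R C F G" using mono by (simp add: is_mono_def)
  have n: "Yelt a F x \<in> nat_trans R C (Y a) F" using Yelt_nat[OF a(1) F.linear_presheaf_axioms a(2)] .
  have "\<alpha> b (Yelt a F x b y) = elzero G b" if b: "b \<in> Obj C" "y \<in> el (Y a) b" for b y
  proof -
    obtain f where f: "f \<in> Hom C b a" "y = \<theta> a b f" using represents_elE[OF Y_represents[OF a(1)] b] .
    then show ?thesis
      using a b z by (simp add: Yelt_apply F.linear_presheaf_axioms nat_trans_act[OF \<alpha>] G.act_zero)
  qed
  then have "Comp ind (Y a) F G \<alpha> (Yelt a F x) = \<zero>\<^bsub>HomMod ind (Y a) G\<^esub>"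
    using ind_comp_zero_iff[OF Y_lex[OF a(1)] G n \<alpha>] by blast
  then have "Yelt a F x = \<zero>\<^bsub>HomMod ind (Y a) F\<^esub>"
    using ind.is_monoD[OF mono, of "Y a" "Yelt a F x"] F G n Y_lex[OF a(1)] by simp
  then have "Yelt a F x a (\<theta> a a (Id C a)) = elzero F a"
    using a by (simp add: nat_trans_zero_apply \<theta>_closed id_closed)
  then show ?thesis
    using a by (simp add: Yelt_apply F.linear_presheaf_axioms id_closed F.act_id)
qed

lemma ind_cokernel_zero_stage:
  assumes F: "lex F" and G: "lex G" and \<alpha>: "\<alpha> \<in> nat_trans R C F G"
  obtains K \<tau> where "lex K" "is_cokernel ind F G K \<alpha> \<tau>"
    "\<And>a y. \<lbrakk>a \<in> Obj C; y \<in> el G a; \<tau> a y = elzero K a\<rbrakk>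
      \<Longrightarrow> \<exists>u e k y' v p x j. cokernel_stage F G \<alpha> u e k y' v p x \<and> j \<in> Hom C a u \<and> Act G a u j y' = y \<and> Comp C a u e k j = hzero a e"
proof (rule ind_cokernel_exists[OF F G \<alpha>])
  fix K \<tau>
  assume K: "lex K" "is_cokernel ind F G K \<alpha> \<tau>"
    and ev: "\<And>a b z q y. \<lbrakk>a \<in> Obj C; b \<in> Obj C; z \<in> el K a; q \<in> Hom C b a; y \<in> el G b; Act K b a q z = \<tau> b y\<rbrakk>
      \<Longrightarrow> \<exists>u e k y' v p x j d. cokernel_stage F G \<alpha> u e k y' v p x \<and> j \<in> Hom C b u \<and> Act G b u j y' = y \<and>
        d \<in> Hom C a e \<and> Comp C b u e k j = Comp C b a e d q"
  interpret K: linear_presheaf R C K using K(1) by (rule lex_psh)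
  show thesis
  proof (rule that[OF K])
    fix a y assume a: "a \<in> Obj C" "y \<in> el G a" and z: "\<tau> a y = elzero K a"
    have "Act K a a (hzero a a) (elzero K a) = \<tau> a y"
      using a z by (simp add: K.act_zero zero_hom)
    from ev[OF a(1) a(1) K.el_zero[OF a(1)] zero_hom[OF a(1) a(1)] a(2) this]
    obtain u e k y' v p x j d where s: "cokernel_stage F G \<alpha> u e k y' v p x" "j \<in> Hom C a u" "Act G a u j y' = y"
      and d: "d \<in> Hom C a e" "Comp C a u e k j = Comp C a a e d (hzero a a)" by blast
    have "Comp C a u e k j = hzero a e" using d a cokernel_stageD(2)[OF s(1)] by (simp add: comp_zero_right)
    then show "\<exists>u e k y' v p x j. cokernel_stage F G \<alpha> u e k y' v p x \<and> j \<in> Hom C a u \<and> Act G a u j y' = y \<and> Comp C a u e k j = hzero a e"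
      using s by blast
  qed
qed

end

section \<open>Ind-objects of an ind-abelian category\<close>

lemma (in linear_category) is_epi_comp:
  assumes "is_epi C a b f" "is_epi C b c g" "a \<in> Obj C" "b \<in> Obj C" "c \<in> Obj C"
  shows "is_epi C a c (Comp C a b c g f)"
proof (rule is_epiI)
  have fg: "f \<in> Hom C a b" "g \<in> Hom C b c" using assms by (auto simp: is_epi_def)
  then show "Comp C a b c g f \<in> Hom C a c" using assms by (simp add: comp_closed)
  fix d h assume d: "d \<in> Obj C" "h \<in> Hom C c d" "Comp C a c d h (Comp C a b c g f) = hzero a d"
  then have "Comp C b c d h g = hzero b d"
    using is_epiD[OF assms(1,3,4) d(1)] assms fg by (simp add: comp_assoc comp_closed)
  then show "h = hzero c d" using is_epiD[OF assms(2,4,5) d(1,2)] by simp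
qed (use assms in auto)

locale ind_abelian_category = small_cocomplete_category R C U
  for R :: "('r, 'k) ring_scheme" (structure) and C :: "('o, 'm, 'r, 'z) lcat_scheme" and U :: "'u itself" +
  assumes ind_abelian: "ind_abelian R C"
begin

interpretation ind: linear_category R ind by (rule ind_linear_category)

lemma epi_hom: "is_epi C b a e \<Longrightarrow> e \<in> Hom C b a"
  by (simp add: is_epi_def)

lemma epi_regular:
  assumes "is_epi C b a e" "b \<in> Obj C" "a \<in> Obj C"
  obtains w d where "w \<in> Obj C" "is_cokernel C w b a d e"
  using assms ind_abelian unfolding ind_abelian_def by blast

lemma exact_lift:
  assumes "is_cokernel C w v u p q" "w \<in> Obj C" "v \<in> Obj C" "u \<in> Obj C"
    "a \<in> Obj C" "f \<in> Hom C a v" "Comp C a v u q f = hzero a u"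
  obtains b p' f' where "b \<in> Obj C" "is_epi C b a p'" "f' \<in> Hom C b w" "Comp C b a v f p' = Comp C b w v p f'"
  using assms ind_abelian unfolding ind_abelian_def by blast

lemma epi_pullback:
  assumes e: "is_epi C b a e" and o: "b \<in> Obj C" "a \<in> Obj C" "a' \<in> Obj C" and f: "f \<in> Hom C a' a"
  obtains c e' f' where "c \<in> Obj C" "is_epi C c a' e'" "f' \<in> Hom C c b" "Comp C c a' a f e' = Comp C c b a e f'"
proof -
  note eh = epi_hom[OF e]
  obtain u k where u: "u \<in> Obj C" "is_cokernel C b a u e k" using cokernel_exists[OF o(1,2) eh] .
  note k = cokernelD[OF u(2)]
  have "k = hzero a u" using is_epiD[OF e o(1,2) u(1) k(2,3)] .
  then have "Comp C a' a u k f = hzero a' u" using o u f by (simp add: comp_zero_left)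
  then show thesis using exact_lift[OF u(2) o(1,2) u(1) o(3) f] that by metis
qed

lemma epi_refine:
  assumes e: "is_epi C b a e" "is_epi C b' a e'" and o: "b \<in> Obj C" "b' \<in> Obj C" "a \<in> Obj C"
  obtains c g g' where "c \<in> Obj C" "g \<in> Hom C c b" "g' \<in> Hom C c b'" "Comp C c b a e g = Comp C c b' a e' g'"
    "is_epi C c a (Comp C c b a e g)"
proof -
  obtain c g' g where c: "c \<in> Obj C" "is_epi C c b' g'" "g \<in> Hom C c b" "Comp C c b' a e' g' = Comp C c b a e g"
    using epi_pullback[OF e(1) o(1,3,2) epi_hom[OF e(2)]] .
  show thesis
    using that[OF c(1,3) epi_hom[OF c(2)] c(4)[symmetric]] is_epi_comp[OF c(2) e(2) c(1) o(2,3)] c(4) by simp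
qed

lemma lex_epi_cancel:
  assumes "lex H" "is_epi C b a e" "b \<in> Obj C" "a \<in> Obj C" "z \<in> el H a" "z' \<in> el H a" "Act H b a e z = Act H b a e z'"
  shows "z = z'"
proof -
  obtain w d where "w \<in> Obj C" "is_cokernel C w b a d e" using epi_regular[OF assms(2-4)] .
  then show ?thesis using lex_cancel[OF assms(1)] assms by metis
qed

lemma lex_epi_descend:
  assumes H: "lex H" and e: "is_epi C b a e" and o: "b \<in> Obj C" "a \<in> Obj C" and x: "x \<in> el H b"
    and comp: "\<And>w d. \<lbrakk>w \<in> Obj C; d \<in> Hom C w b; Comp C w b a e d = hzero w a\<rbrakk> \<Longrightarrow> Act H w b d x = elzero H w"
  obtains z where "z \<in> el H a" "Act H b a e z = x"
proof -
  obtain w d where w: "w \<in> Obj C" "is_cokernel C w b a d e" using epi_regular[OF e o] .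
  then show thesis using lex_factor[OF H w(2,1) o x] comp[OF w(1)] cokernelD[OF w(2)] that by metis
qed

lemma ind_cokernel_local:
  assumes F: "lex F" and G: "lex G" and \<alpha>: "\<alpha> \<in> nat_trans R C F G"
  obtains K \<tau> where "lex K" "is_cokernel ind F G K \<alpha> \<tau>"
    "\<And>a y. \<lbrakk>a \<in> Obj C; y \<in> el G a; \<tau> a y = elzero K a\<rbrakk>
      \<Longrightarrow> \<exists>b\<in>Obj C. \<exists>e x. is_epi C b a e \<and> x \<in> el F b \<and> \<alpha> b x = Act G b a e y"
proof (rule ind_cokernel_zero_stage[OF F G \<alpha>])
  interpret F: linear_presheaf R C F using F by (rule lex_psh)
  interpret G: linear_presheaf R C G using G by (rule lex_psh)
  fix K \<tau>
  assume K: "lex K" "is_cokernel ind F G K \<alpha> \<tau>"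
    and zs: "\<And>a y. \<lbrakk>a \<in> Obj C; y \<in> el G a; \<tau> a y = elzero K a\<rbrakk>
      \<Longrightarrow> \<exists>u e k y' v p x j. cokernel_stage F G \<alpha> u e k y' v p x \<and> j \<in> Hom C a u \<and> Act G a u j y' = y \<and> Comp C a u e k j = hzero a e"
  show thesis
  proof (rule that[OF K])
    fix a y assume a: "a \<in> Obj C" "y \<in> el G a" and z: "\<tau> a y = elzero K a"
    from zs[OF a z] obtain u c v k p y' x j where s: "u \<in> Obj C" "c \<in> Obj C" "v \<in> Obj C" "is_cokernel C v u c p k"
      "y' \<in> el G u" "x \<in> el F v" "Act G v u p y' = \<alpha> v x" "j \<in> Hom C a u" "Act G a u j y' = y"
      "Comp C a u c k j = hzero a c" unfolding cokernel_stage_def by blast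
    note pk = cokernelD[OF s(4)]
    obtain b e f where b: "b \<in> Obj C" "is_epi C b a e" "f \<in> Hom C b v" "Comp C b a u j e = Comp C b v u p f"
      using exact_lift[OF s(4,3,1,2) a(1) s(8,10)] .
    note eh = epi_hom[OF b(2)]
    have "Act G b a e y = Act G b u (Comp C b a u j e) y'"
      using s a b(1-3) eh by (simp add: G.act_comp)
    also have "\<dots> = Act G b v f (\<alpha> v x)"
      unfolding b(4) using s b pk by (simp add: G.act_comp)
    also have "\<dots> = \<alpha> b (Act F b v f x)"
      using s b by (simp add: nat_trans_act[OF \<alpha>])
    finally show "\<exists>b\<in>Obj C. \<exists>e x. is_epi C b a e \<and> x \<in> el F b \<and> \<alpha> b x = Act G b a e y"
      using b F.act_closed[OF b(1) s(3) b(3) s(6)] by metis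
  qed
qed

lemma ind_mono_normal:
  assumes F: "lex F" and G: "lex G" and mono: "is_mono ind F G \<alpha>"
  obtains K \<tau> where "lex K" "is_kernel ind F G K \<alpha> \<tau>"
proof -
  interpret F: linear_presheaf R C F using F by (rule lex_psh)
  interpret G: linear_presheaf R C G using G by (rule lex_psh)
  have \<alpha>: "\<alpha> \<in> nat_trans R C F G" using mono by (simp add: is_mono_def)
  have inj: "x = x'" if "a \<in> Obj C" "x \<in> el F a" "x' \<in> el F a" "\<alpha> a x = \<alpha> a x'" for a x x'
    using mod_hom_injD[OF F.val_module G.val_module presheaf_map_hom[OF nat_trans_map[OF \<alpha>]]]
      ind_mono_zeroD[OF F G mono] that by blast
  obtain K \<tau> where K: "lex K" and \<tau>: "is_cokernel ind F G K \<alpha> \<tau>"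
    and loc: "\<And>a y. \<lbrakk>a \<in> Obj C; y \<in> el G a; \<tau> a y = elzero K a\<rbrakk>
      \<Longrightarrow> \<exists>b\<in>Obj C. \<exists>e x. is_epi C b a e \<and> x \<in> el F b \<and> \<alpha> b x = Act G b a e y"
    by (rule ind_cokernel_local[OF F G \<alpha>]) (rule that; blast)
  have \<tau>h: "\<tau> \<in> nat_trans R C G K" using ind.cokernelD(2)[OF \<tau>] by simp
  have img: "\<exists>x\<in>el F a. \<alpha> a x = y" if a: "a \<in> Obj C" "y \<in> el G a" "\<tau> a y = elzero K a" for a y
  proof -
    obtain b e x where b: "b \<in> Obj C" "is_epi C b a e" "x \<in> el F b" "\<alpha> b x = Act G b a e y" using loc[OF a] by blast
    note eh = epi_hom[OF b(2)]
    have "Act F w b d x = elzero F w"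
      if w: "w \<in> Obj C" "d \<in> Hom C w b" "Comp C w b a e d = hzero w a" for w d
    proof (rule ind_mono_zeroD[OF F G mono w(1) F.act_closed[OF w(1) b(1) w(2) b(3)]])
      have "\<alpha> w (Act F w b d x) = Act G w a (Comp C w b a e d) y"
        unfolding G.act_comp[OF w(1) b(1) a(1) w(2) eh a(2)] using b w(1,2) by (simp add: nat_trans_act[OF \<alpha>])
      then show "\<alpha> w (Act F w b d x) = elzero G w" using a w by (simp add: G.act_hzero)
    qed
    then obtain z where z: "z \<in> el F a" "Act F b a e z = x"
      using lex_epi_descend[OF F b(2,1) a(1) b(3)] by metis
    have "\<alpha> a z = y"
      by (rule lex_epi_cancel[OF G b(2,1) a(1) nat_trans_closed[OF \<alpha> a(1) z(1)] a(2)])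
        (use nat_trans_act[OF \<alpha> b(1) a(1) eh z(1)] z b in simp)
    then show ?thesis using z by blast
  qed
  have "is_kernel ind F G K \<alpha> \<tau>"
  proof (rule ind.is_kernelI)
    fix H g assume "H \<in> Obj ind" "g \<in> Hom ind H G" and eq: "Comp ind H G K \<tau> g = \<zero>\<^bsub>HomMod ind H K\<^esub>"
    then have H: "lex H" and g: "g \<in> nat_trans R C H G" by simp_all
    interpret H: linear_presheaf R C H using H by (rule lex_psh)
    have "\<exists>x\<in>el F a. \<alpha> a x = g a y" if "a \<in> Obj C" "y \<in> el H a" for a y
      using img[OF that(1) nat_trans_closed[OF g that]] eq ind_comp_zero_iff[OF H K g \<tau>h] that by blast
    then obtain h where h: "\<And>a y. \<lbrakk>a \<in> Obj C; y \<in> el H a\<rbrakk> \<Longrightarrow> h a y \<in> el F a"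
        "\<And>a y. \<lbrakk>a \<in> Obj C; y \<in> el H a\<rbrakk> \<Longrightarrow> \<alpha> a (h a y) = g a y"
      by metis
    have "presheaf_map H F h"
    proof (rule presheaf_mapI)
      fix a y assume a: "a \<in> Obj C" "y \<in> el H a"
      show "h a y \<in> el F a" by (rule h(1)[OF a])
      show "h a (y \<oplus>\<^bsub>Val H a\<^esub> y') = h a y \<oplus>\<^bsub>Val F a\<^esub> h a y'" if "y' \<in> el H a" for y'
        by (rule inj[OF a(1)])
          (use a that in \<open>simp_all add: h H.el_add F.el_add nat_trans_add[OF \<alpha>] nat_trans_add[OF g]\<close>)
      show "h a (r \<odot>\<^bsub>Val H a\<^esub> y) = r \<odot>\<^bsub>Val F a\<^esub> h a y" if "r \<in> carrier R" for r
        by (rule inj[OF a(1)])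
          (use a that in \<open>simp_all add: h H.el_smult F.el_smult nat_trans_smult[OF \<alpha>] nat_trans_smult[OF g]\<close>)
      show "h b (Act H b a f y) = Act F b a f (h a y)" if "b \<in> Obj C" "f \<in> Hom C b a" for b f
        by (rule inj[OF that(1)])
          (use a that in \<open>simp_all add: h H.act_closed F.act_closed nat_trans_act[OF \<alpha>] nat_trans_act[OF g]\<close>)
    qed
    then have n: "nt H h \<in> nat_trans R C H F" by (rule nt_nat_trans[OF H.linear_presheaf_axioms])
    have "Comp ind H F G \<alpha> (nt H h) = g" by (rule ind_comp_eqI[OF H n \<alpha> g]) (simp add: h)
    then show "\<exists>h. h \<in> Hom ind H F \<and> Comp ind H F G \<alpha> h = g" using n by auto
  qed (use F G K \<tau>h mono ind.cokernelD(3)[OF \<tau>] in \<open>simp_all del: ind_simps(3,4)\<close>)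
  then show thesis using that K by blast
qed

lemma ind_epi_conormal:
  assumes F: "lex F" and G: "lex G" and epi: "is_epi ind F G \<alpha>"
  obtains K i where "lex K" "is_cokernel ind K F G i \<alpha>"
proof -
  interpret F: linear_presheaf R C F using F by (rule lex_psh)
  interpret G: linear_presheaf R C G using G by (rule lex_psh)
  have \<alpha>: "\<alpha> \<in> nat_trans R C F G" using epi by (simp add: is_epi_def)
  obtain T \<tau> where T: "lex T" and \<tau>: "is_cokernel ind F G T \<alpha> \<tau>"
    and loc: "\<And>a y. \<lbrakk>a \<in> Obj C; y \<in> el G a; \<tau> a y = elzero T a\<rbrakk>
      \<Longrightarrow> \<exists>b\<in>Obj C. \<exists>e x. is_epi C b a e \<and> x \<in> el F b \<and> \<alpha> b x = Act G b a e y"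
    by (rule ind_cokernel_local[OF F G \<alpha>]) (rule that; blast)
  have "\<tau> = \<zero>\<^bsub>HomMod ind G T\<^esub>"
    by (rule ind.is_epiD[OF epi]) (use F G T ind.cokernelD[OF \<tau>] in \<open>simp_all del: ind_simps(3,4)\<close>)
  then have cover: "\<exists>b\<in>Obj C. \<exists>e x. is_epi C b a e \<and> x \<in> el F b \<and> \<alpha> b x = Act G b a e y"
    if "a \<in> Obj C" "y \<in> el G a" for a y
    using loc[OF that] that by (simp add: nat_trans_zero_apply)
  define K where "K = kernel_presheaf F G \<alpha>"
  define i where "i = nt K (\<lambda>a x. x)"
  have K: "lex K" and ker: "is_kernel ind K F G i \<alpha>" unfolding K_def i_def using ind_kernel[OF F G \<alpha>] by auto
  have i: "i \<in> nat_trans R C K F" using ind.kernelD(1)[OF ker] by simp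
  have "is_cokernel ind K F G i \<alpha>"
  proof (rule ind.is_cokernelI)
    fix H \<beta> assume "H \<in> Obj ind" "\<beta> \<in> Hom ind F H" and eq: "Comp ind K F H \<beta> i = \<zero>\<^bsub>HomMod ind K H\<^esub>"
    then have H: "lex H" and \<beta>: "\<beta> \<in> nat_trans R C F H" by simp_all
    interpret H: linear_presheaf R C H using H by (rule lex_psh)
    have \<beta>_zero: "\<beta> a x = elzero H a" if "a \<in> Obj C" "x \<in> el F a" "\<alpha> a x = elzero G a" for a x
    proof -
      have "\<beta> a (i a x) = elzero H a"
        using eq ind_comp_zero_iff[OF K H i \<beta>] that by (simp add: K_def)
      then show ?thesis using that by (simp add: i_def K_def)
    qed
    have \<beta>_cong: "\<beta> a x = \<beta> a x'" if a: "a \<in> Obj C" "x \<in> el F a" "x' \<in> el F a" and eq: "\<alpha> a x = \<alpha> a x'" for a x x'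
    proof -
      have d: "mdiff R (Val F a) x x' \<in> el F a" by (rule mdiff_closed[OF F.val_module[OF a(1)] a(2,3)])
      have "\<alpha> a (mdiff R (Val F a) x x') = elzero G a"
        using a eq mod_hom_mdiff[OF F.val_module[OF a(1)] presheaf_map_hom[OF nat_trans_map[OF \<alpha>] a(1)] a(2,3)]
        by (simp add: mdiff_eq_zero_iff[OF G.val_module] nat_trans_closed[OF \<alpha>])
      then have "\<beta> a (mdiff R (Val F a) x x') = elzero H a" by (rule \<beta>_zero[OF a(1) d])
      then show ?thesis
        using a mod_hom_mdiff[OF F.val_module[OF a(1)] presheaf_map_hom[OF nat_trans_map[OF \<beta>] a(1)] a(2,3)]
        by (simp add: mdiff_eq_zero_iff[OF H.val_module] nat_trans_closed[OF \<beta>])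
    qed
    \<comment> \<open>\<open>P a y z\<close>: on a cover of \<open>a\<close>, \<open>y\<close> lifts along \<open>\<alpha>\<close> and \<open>\<beta>\<close> sends the lift to the restriction of \<open>z\<close>.\<close>
    define P where "P a y z \<longleftrightarrow> z \<in> el H a \<and> (\<exists>b\<in>Obj C. \<exists>e x. is_epi C b a e \<and> x \<in> el F b \<and>
        \<alpha> b x = Act G b a e y \<and> Act H b a e z = \<beta> b x)" for a y z
    have P_ex: "\<exists>z. P a y z" if a: "a \<in> Obj C" "y \<in> el G a" for a y
    proof -
      obtain b e x where b: "b \<in> Obj C" "is_epi C b a e" "x \<in> el F b" "\<alpha> b x = Act G b a e y" using cover[OF a] by blast
      note eh = epi_hom[OF b(2)]
      have "Act H w b d (\<beta> b x) = elzero H w"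
        if w: "w \<in> Obj C" "d \<in> Hom C w b" "Comp C w b a e d = hzero w a" for w d
      proof -
        have "\<alpha> w (Act F w b d x) = Act G w a (Comp C w b a e d) y"
          unfolding G.act_comp[OF w(1) b(1) a(1) w(2) eh a(2)] using b w by (simp add: nat_trans_act[OF \<alpha>])
        then have "\<alpha> w (Act F w b d x) = elzero G w" using a w by (simp add: G.act_hzero)
        then have "\<beta> w (Act F w b d x) = elzero H w" using b w by (intro \<beta>_zero) (simp_all add: F.act_closed)
        then show ?thesis using b w by (simp add: nat_trans_act[OF \<beta>])
      qed
      then obtain z where "z \<in> el H a" "Act H b a e z = \<beta> b x"
        using lex_epi_descend[OF H b(2,1) a(1) nat_trans_closed[OF \<beta> b(1,3)]] by metis
      then show ?thesis using b unfolding P_def by blast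
    qed
    have P_common: "\<exists>c\<in>Obj C. \<exists>e x x'. is_epi C c a e \<and> x \<in> el F c \<and> x' \<in> el F c \<and>
        \<alpha> c x = Act G c a e y \<and> \<alpha> c x' = Act G c a e y' \<and> Act H c a e z = \<beta> c x \<and> Act H c a e z' = \<beta> c x'"
      if a: "a \<in> Obj C" "y \<in> el G a" "y' \<in> el G a" and "P a y z" "P a y' z'" for a y y' z z'
    proof -
      obtain b e x where b: "b \<in> Obj C" "is_epi C b a e" "x \<in> el F b" "\<alpha> b x = Act G b a e y"
        "Act H b a e z = \<beta> b x" and z: "z \<in> el H a" using \<open>P a y z\<close> unfolding P_def by blast
      obtain b' e' x' where b': "b' \<in> Obj C" "is_epi C b' a e'" "x' \<in> el F b'" "\<alpha> b' x' = Act G b' a e' y'"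
        "Act H b' a e' z' = \<beta> b' x'" and z': "z' \<in> el H a" using \<open>P a y' z'\<close> unfolding P_def by blast
      note eh = epi_hom[OF b(2)] epi_hom[OF b'(2)]
      obtain c g g' where c: "c \<in> Obj C" "g \<in> Hom C c b" "g' \<in> Hom C c b'"
        "Comp C c b a e g = Comp C c b' a e' g'" "is_epi C c a (Comp C c b a e g)"
        using epi_refine[OF b(2) b'(2) b(1) b'(1) a(1)] .
      have "\<alpha> c (Act F c b g x) = Act G c a (Comp C c b a e g) y"
        "Act H c a (Comp C c b a e g) z = \<beta> c (Act F c b g x)"
        unfolding G.act_comp[OF c(1) b(1) a(1) c(2) eh(1) a(2)] H.act_comp[OF c(1) b(1) a(1) c(2) eh(1) z]
        using b c by (simp_all add: nat_trans_act[OF \<alpha>] nat_trans_act[OF \<beta>])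
      moreover have "\<alpha> c (Act F c b' g' x') = Act G c a (Comp C c b a e g) y'"
        "Act H c a (Comp C c b a e g) z' = \<beta> c (Act F c b' g' x')"
        unfolding c(4) G.act_comp[OF c(1) b'(1) a(1) c(3) eh(2) a(3)] H.act_comp[OF c(1) b'(1) a(1) c(3) eh(2) z']
        using b' c by (simp_all add: nat_trans_act[OF \<alpha>] nat_trans_act[OF \<beta>])
      ultimately show ?thesis
        using c b b' F.act_closed by blast
    qed
    have P_unique: "z = z'" if a: "a \<in> Obj C" "y \<in> el G a" and P: "P a y z" "P a y z'" for a y z z'
    proof -
      obtain c e x x' where c: "c \<in> Obj C" "is_epi C c a e" "x \<in> el F c" "x' \<in> el F c"
        "\<alpha> c x = Act G c a e y" "\<alpha> c x' = Act G c a e y" "Act H c a e z = \<beta> c x" "Act H c a e z' = \<beta> c x'"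
        using P_common[OF a a(2) P] by blast
      have "Act H c a e z = Act H c a e z'" using c \<beta>_cong[OF c(1,3,4)] by simp
      then show ?thesis using lex_epi_cancel[OF H c(2,1) a(1)] P unfolding P_def by blast
    qed
    obtain n where n: "\<And>a y. \<lbrakk>a \<in> Obj C; y \<in> el G a\<rbrakk> \<Longrightarrow> P a y (n a y)" using P_ex by metis
    have n_eq: "n a y = z" if "a \<in> Obj C" "y \<in> el G a" "P a y z" for a y z
      using P_unique n that by blast
    have nc: "n a y \<in> el H a" if "a \<in> Obj C" "y \<in> el G a" for a y using n[OF that] by (simp add: P_def)
    have "presheaf_map G H n"
    proof (rule presheaf_mapI)
      fix a y assume a: "a \<in> Obj C" "y \<in> el G a"
      show "n a y \<in> el H a" by (rule nc[OF a])
      {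
        fix y' assume y': "y' \<in> el G a"
        obtain c e x x' where c: "c \<in> Obj C" "is_epi C c a e" "x \<in> el F c" "x' \<in> el F c"
          "\<alpha> c x = Act G c a e y" "\<alpha> c x' = Act G c a e y'" "Act H c a e (n a y) = \<beta> c x" "Act H c a e (n a y') = \<beta> c x'"
          using P_common[OF a y' n[OF a] n[OF a(1) y']] by blast
        note eh = epi_hom[OF c(2)]
        have "\<alpha> c (x \<oplus>\<^bsub>Val F c\<^esub> x') = Act G c a e (y \<oplus>\<^bsub>Val G a\<^esub> y')"
          "Act H c a e (n a y \<oplus>\<^bsub>Val H a\<^esub> n a y') = \<beta> c (x \<oplus>\<^bsub>Val F c\<^esub> x')"
          using c a y' eh nc by (simp_all add: nat_trans_add[OF \<alpha>] nat_trans_add[OF \<beta>] G.act_el_add H.act_el_add)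
        moreover have "n a y \<oplus>\<^bsub>Val H a\<^esub> n a y' \<in> el H a" using a y' nc by (simp add: H.el_add)
        ultimately have "P a (y \<oplus>\<^bsub>Val G a\<^esub> y') (n a y \<oplus>\<^bsub>Val H a\<^esub> n a y')"
          unfolding P_def using c F.el_add[OF c(1,3,4)] by blast
        then show "n a (y \<oplus>\<^bsub>Val G a\<^esub> y') = n a y \<oplus>\<^bsub>Val H a\<^esub> n a y'" using n_eq a y' G.el_add by blast
      }
      obtain b e x where b: "b \<in> Obj C" "is_epi C b a e" "x \<in> el F b" "\<alpha> b x = Act G b a e y"
        "Act H b a e (n a y) = \<beta> b x" using n[OF a] unfolding P_def by blast
      note eh = epi_hom[OF b(2)]
      {
        fix r assume r: "r \<in> carrier R"
        have "\<alpha> b (r \<odot>\<^bsub>Val F b\<^esub> x) = Act G b a e (r \<odot>\<^bsub>Val G a\<^esub> y)"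
          "Act H b a e (r \<odot>\<^bsub>Val H a\<^esub> n a y) = \<beta> b (r \<odot>\<^bsub>Val F b\<^esub> x)"
          using b a r eh nc by (simp_all add: nat_trans_smult[OF \<alpha>] nat_trans_smult[OF \<beta>] G.act_el_smult H.act_el_smult)
        moreover have "r \<odot>\<^bsub>Val H a\<^esub> n a y \<in> el H a" using a r nc by (simp add: H.el_smult)
        ultimately have "P a (r \<odot>\<^bsub>Val G a\<^esub> y) (r \<odot>\<^bsub>Val H a\<^esub> n a y)"
          unfolding P_def using b F.el_smult[OF b(1) r b(3)] by blast
        then show "n a (r \<odot>\<^bsub>Val G a\<^esub> y) = r \<odot>\<^bsub>Val H a\<^esub> n a y" using n_eq a r G.el_smult by blast
      }
      fix a' f assume a': "a' \<in> Obj C" "f \<in> Hom C a' a"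
      obtain c e' f' where c: "c \<in> Obj C" "is_epi C c a' e'" "f' \<in> Hom C c b" "Comp C c a' a f e' = Comp C c b a e f'"
        using epi_pullback[OF b(2,1) a(1) a'] .
      note e'h = epi_hom[OF c(2)]
      have "\<alpha> c (Act F c b f' x) = Act G c a (Comp C c b a e f') y"
        unfolding G.act_comp[OF c(1) b(1) a(1) c(3) eh a(2)] using b c by (simp add: nat_trans_act[OF \<alpha>])
      then have 1: "\<alpha> c (Act F c b f' x) = Act G c a' e' (Act G a' a f y)"
        unfolding c(4)[symmetric] using a a' c(1-3) e'h by (simp add: G.act_comp)
      have "Act H c a (Comp C c b a e f') (n a y) = \<beta> c (Act F c b f' x)"
        unfolding H.act_comp[OF c(1) b(1) a(1) c(3) eh nc[OF a]] using b c by (simp add: nat_trans_act[OF \<beta>])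
      then have 2: "Act H c a' e' (Act H a' a f (n a y)) = \<beta> c (Act F c b f' x)"
        unfolding c(4)[symmetric] using a a' c(1-3) e'h nc by (simp add: H.act_comp)
      have "P a' (Act G a' a f y) (Act H a' a f (n a y))"
        unfolding P_def using 1 2 c H.act_closed[OF a'(1) a(1) a'(2) nc[OF a]] F.act_closed[OF c(1) b(1) c(3) b(3)] by blast
      then show "n a' (Act G a' a f y) = Act H a' a f (n a y)"
        using n_eq a' G.act_closed[OF a'(1) a(1) a'(2) a(2)] by blast
    qed
    then have nn: "nt G n \<in> nat_trans R C G H" by (rule nt_nat_trans[OF G.linear_presheaf_axioms])
    have "n a (\<alpha> a x) = \<beta> a x" if a: "a \<in> Obj C" "x \<in> el F a" for a x
    proof (rule n_eq[OF a(1) nat_trans_closed[OF \<alpha> a]])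
      have "is_epi C a a (Id C a)" using a by (auto simp: is_epi_def id_closed id_right)
      then show "P a (\<alpha> a x) (\<beta> a x)"
        unfolding P_def using a nat_trans_closed[OF \<beta> a] H.act_id[OF a(1) nat_trans_closed[OF \<beta> a]]
          G.act_id[OF a(1) nat_trans_closed[OF \<alpha> a]] by metis
    qed
    then have "Comp ind F G H (nt G n) \<alpha> = \<beta>"
      by (intro ind_comp_eqI[OF F \<alpha> nn \<beta>]) (simp add: nat_trans_closed[OF \<alpha>])
    then show "\<exists>h. h \<in> Hom ind G H \<and> Comp ind F G H h \<alpha> = \<beta>" using nn by auto
  qed (use F G K i epi ind.kernelD(3)[OF ker] in \<open>simp_all del: ind_simps(3,4)\<close>)
  then show thesis using that K by blast
qed

theorem Ind_abelian: "abelian R ind"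
  unfolding abelian_def
proof (intro conjI ballI allI impI)
  show "linear_category R ind" by (rule ind_linear_category)
  obtain c where "c \<in> Obj C" using object_exists by blast
  then have Yc: "lex (Y c)" by (rule Y_lex)
  then have "Id ind (Y c) \<in> nat_trans R C (Y c) (Y c)" using ind.id_closed[of "Y c"] by simp
  then obtain Z k where Z: "lex Z" "is_cokernel ind (Y c) (Y c) Z (Id ind (Y c)) k"
    using ind_cokernel_exists[OF Yc Yc] by metis
  have "is_zero_object ind Z"
    by (rule ind.is_zero_objectI) (use Z ind.cokernel_identity_zero[OF _ _ Z(2)] Yc in \<open>simp_all del: ind_simps(3,4,5)\<close>)
  then show "\<exists>z. is_zero_object ind z" by blast
  fix F G assume "F \<in> Obj ind" "G \<in> Obj ind"
  then have F: "lex F" and G: "lex G" by simp_all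
  show "\<exists>s i j p q. is_biproduct ind F G s i j p q" using ind_biproduct_exists[OF F G] by metis
  {
    fix \<alpha> assume "\<alpha> \<in> Hom ind F G"
    then have \<alpha>: "\<alpha> \<in> nat_trans R C F G" by simp
    show "\<exists>k\<in>Obj ind. \<exists>i. is_kernel ind k F G i \<alpha>" using ind_kernel[OF F G \<alpha>] by auto
    show "\<exists>c\<in>Obj ind. \<exists>q. is_cokernel ind F G c \<alpha> q" using ind_cokernel_exists[OF F G \<alpha>] by (metis ind_simps(1) mem_Collect_eq)
  }
  fix \<alpha>
  show "\<exists>c\<in>Obj ind. \<exists>g. is_kernel ind F G c \<alpha> g" if "is_mono ind F G \<alpha>"
    using ind_mono_normal[OF F G that] by (metis ind_simps(1) mem_Collect_eq)
  show "\<exists>c\<in>Obj ind. \<exists>g. is_cokernel ind c F G g \<alpha>" if "is_epi ind F G \<alpha>"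
    using ind_epi_conormal[OF F G that] by (metis ind_simps(1) mem_Collect_eq)
qed

end

section \<open>Abelian categories of ind-objects\<close>

text \<open>
  With \<open>I\<close> the image of \<open>h\<close>, this says that the composite of \<open>w\<close> with \<open>X \<rightarrow> I\<close> is an epimorphism if
  \<open>I\<close> lies in the kernel of the cokernel of \<open>h \<circ> w\<close>.
\<close>

lemma (in linear_category) abelian_exactness:
  assumes ab: "abelian R C"
    and o: "k \<in> Obj C" "X \<in> Obj C" "Y \<in> Obj C" "T \<in> Obj C" "W \<in> Obj C" "Q \<in> Obj C"
    and ker: "is_kernel C k X Y i h" and t: "t \<in> Hom C X T" "Comp C k X T t i = hzero k T"
    and w: "w \<in> Hom C W X" and coker: "is_cokernel C W Y Q (Comp C W X Y h w) q"
    and qh: "Comp C X Y Q q h = hzero X Q" and tw: "Comp C W X T t w = hzero W T"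
  shows "t = hzero X T"
proof -
  have kernels: "\<And>a b f. \<lbrakk>a \<in> Obj C; b \<in> Obj C; f \<in> Hom C a b\<rbrakk> \<Longrightarrow> \<exists>k\<in>Obj C. \<exists>i. is_kernel C k a b i f"
    and cokernels: "\<And>a b f. \<lbrakk>a \<in> Obj C; b \<in> Obj C; f \<in> Hom C a b\<rbrakk> \<Longrightarrow> \<exists>c\<in>Obj C. \<exists>q. is_cokernel C a b c f q"
    and normal: "\<And>a b f. \<lbrakk>a \<in> Obj C; b \<in> Obj C; is_mono C a b f\<rbrakk> \<Longrightarrow> \<exists>c\<in>Obj C. \<exists>g. is_kernel C a b c f g"
    and conormal: "\<And>a b f. \<lbrakk>a \<in> Obj C; b \<in> Obj C; is_epi C a b f\<rbrakk> \<Longrightarrow> \<exists>c\<in>Obj C. \<exists>g. is_cokernel C c a b g f"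
    using ab unfolding abelian_def by blast+
  note ih = kernelD[OF ker] and q = cokernelD(2)[OF coker]
  obtain I e where I: "I \<in> Obj C" "is_cokernel C k X I i e" using cokernels[OF o(1,2) ih(1)] by blast
  note e = cokernelD[OF I(2)]
  have e_epi: "is_epi C X I e" using cokernel_epi[OF I(2) o(1,2) I(1)] .
  obtain m where m: "m \<in> Hom C I Y" "Comp C X I Y m e = h" using cokernel_factor[OF I(2) o(3) ih(2,3)] .
  obtain t' where t': "t' \<in> Hom C I T" "Comp C X I T t' e = t" using cokernel_factor[OF I(2) o(4) t] .
  have m_mono: "is_mono C I Y m"
  proof (rule is_monoI[OF I(1) o(3) m(1)])
    fix Z x assume x: "Z \<in> Obj C" "x \<in> Hom C Z I" "Comp C Z I Y m x = hzero Z Y"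
    obtain J y where J: "J \<in> Obj C" "is_cokernel C Z I J x y" using cokernels[OF x(1) I(1) x(2)] by blast
    note y = cokernelD[OF J(2)]
    obtain m' where m': "m' \<in> Hom C J Y" "Comp C I J Y m' y = m" using cokernel_factor[OF J(2) o(3) m(1) x(3)] .
    have "is_epi C X J (Comp C X I J y e)"
      by (rule is_epi_comp[OF e_epi cokernel_epi[OF J(2) x(1) I(1) J(1)] o(2) I(1) J(1)])
    then obtain N z where N: "N \<in> Obj C" "is_cokernel C N X J z (Comp C X I J y e)" using conormal[OF o(2) J(1)] by blast
    note z = cokernelD[OF N(2)]
    have "Comp C N X Y h z = Comp C N J Y m' (Comp C N X J (Comp C X I J y e) z)"
      using N o I J e y(1,2) z(1) m(1) m'(1) by (simp add: comp_assoc comp_closed flip: m(2) m'(2))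
    then have "Comp C N X Y h z = hzero N Y" using z(3) N J o m' by (simp add: comp_zero_right)
    then obtain s where s: "s \<in> Hom C N k" "Comp C N k X i s = z" using kernel_factor[OF ker N(1) z(1)] by blast
    have "Comp C N X I e z = Comp C N k I (Comp C k X I e i) s"
      using N o I e ih s(1) by (simp add: comp_assoc flip: s(2))
    then have "Comp C N X I e z = hzero N I" using e(3) N o I s by (simp add: comp_zero_left)
    then obtain r where r: "r \<in> Hom C J I" "Comp C X J I r (Comp C X I J y e) = e"
      using cokernel_factor[OF N(2) I(1) e(2)] by blast
    have "Comp C X I I (Comp C I J I r y) e = Comp C X I I (Id C I) e"
      using r o I J e y by (simp add: comp_assoc id_left)
    then have "Comp C I J I r y = Id C I"
      using e_epi I r(1) y J(1) unfolding is_epi_def by (meson comp_closed id_closed)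
    then have "x = Comp C Z I I (Comp C I J I r y) x" using x I by (simp add: id_left)
    also have "\<dots> = Comp C Z J I r (Comp C Z I J y x)" using x I J r y(1,2) by (simp add: comp_assoc)
    also have "\<dots> = hzero Z I" using y(3) x J I r by (simp add: comp_zero_right)
    finally show "x = hzero Z I" .
  qed
  obtain K \<kappa> where K: "K \<in> Obj C" "is_kernel C K I T \<kappa> t'" using kernels[OF I(1) o(4) t'(1)] by blast
  note \<kappa> = kernelD[OF K(2)]
  have \<kappa>_mono: "is_mono C K I \<kappa>" using kernel_mono[OF K(2,1) I(1) o(4)] .
  have m\<kappa>: "Comp C K I Y m \<kappa> \<in> Hom C K Y" using K I o m \<kappa> by (simp add: comp_closed)
  have "is_mono C K Y (Comp C K I Y m \<kappa>)"
  proof (rule is_monoI[OF K(1) o(3) m\<kappa>])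
    fix Z x assume x: "Z \<in> Obj C" "x \<in> Hom C Z K" "Comp C Z K Y (Comp C K I Y m \<kappa>) x = hzero Z Y"
    then have "Comp C Z I Y m (Comp C Z K I \<kappa> x) = hzero Z Y" using K I o m \<kappa> by (simp add: comp_assoc)
    then have "Comp C Z K I \<kappa> x = hzero Z I"
      using is_monoD[OF m_mono I(1) o(3) x(1)] comp_closed[OF x(1) K(1) I(1) x(2) \<kappa>(1)] by blast
    then show "x = hzero Z K" using is_monoD[OF \<kappa>_mono K(1) I(1) x(1,2)] by blast
  qed
  then obtain G g where G: "G \<in> Obj C" "is_kernel C K Y G (Comp C K I Y m \<kappa>) g" using normal[OF K(1) o(3)] by blast
  note g = kernelD[OF G(2)]
  have "Comp C W I T t' (Comp C W X I e w) = hzero W T" using tw t' o I e w by (simp add: comp_assoc)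
  then obtain r where r: "r \<in> Hom C W K" "Comp C W K I \<kappa> r = Comp C W X I e w"
    using kernel_factor[OF K(2) o(5) comp_closed[OF o(5,2) I(1) w e(2)]] by blast
  have "Comp C W X Y h w = Comp C W I Y m (Comp C W X I e w)"
    using o I e w m by (simp add: comp_assoc)
  also have "\<dots> = Comp C W K Y (Comp C K I Y m \<kappa>) r"
    using o I K \<kappa> m r(1) by (simp add: comp_assoc flip: r(2))
  finally have "Comp C W Y G g (Comp C W X Y h w) = Comp C W K G (Comp C K Y G g (Comp C K I Y m \<kappa>)) r"
    using o G g K m\<kappa> r(1) by (simp add: comp_assoc)
  then have "Comp C W Y G g (Comp C W X Y h w) = hzero W G"
    using g(3) o K G r(1) by (simp add: comp_zero_left)
  then obtain g' where g': "g' \<in> Hom C Q G" "Comp C Y Q G g' q = g" using cokernel_factor[OF coker G(1) g(2)] by blast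
  have "Comp C X I G (Comp C I Y G g m) e = Comp C X Q G g' (Comp C X Y Q q h)"
    using o G(1) I(1) e(2) q g'(1) m(1) by (simp add: comp_assoc comp_closed flip: g'(2) m(2))
  then have "Comp C X I G (Comp C I Y G g m) e = hzero X G" using qh o G g' by (simp add: comp_zero_right)
  then have "Comp C I Y G g m = hzero I G"
    using is_epiD[OF e_epi o(2) I(1) G(1)] comp_closed[OF I(1) o(3) G(1) m(1) g(2)] by blast
  then obtain s where s: "s \<in> Hom C I K" "Comp C I K Y (Comp C K I Y m \<kappa>) s = m"
    using kernel_factor[OF G(2) I(1) m(1)] by blast
  have "Comp C I I Y m (Comp C I K I \<kappa> s) = Comp C I I Y m (Id C I)"
    using s o I K \<kappa> m by (simp add: comp_assoc id_right)
  then have \<kappa>s: "Comp C I K I \<kappa> s = Id C I"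
    using m_mono I s(1) \<kappa> K(1) unfolding is_mono_def by (meson comp_closed id_closed)
  have "t' = Comp C I I T t' (Comp C I K I \<kappa> s)" unfolding \<kappa>s using o I t' by (simp add: id_right)
  also have "\<dots> = Comp C I K T (Comp C K I T t' \<kappa>) s" using o I K s(1) \<kappa> t' by (simp add: comp_assoc)
  also have "\<dots> = hzero I T" using \<kappa>(3) o I K s(1) by (simp add: comp_zero_left)
  finally show ?thesis using t'(2) o I e by (simp add: comp_zero_left)
qed

context small_cocomplete_category
begin

interpretation ind: linear_category R ind by (rule ind_linear_category)

lemma Y_map_apply:
  "\<lbrakk>c \<in> Obj C; n \<in> nat_trans R C (Y c) H; a \<in> Obj C; f \<in> Hom C a c\<rbrakk>
    \<Longrightarrow> n a (\<theta> c a f) = Act H a c f (n c (\<theta> c c (Id C c)))"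
  by (rule represents_map_apply[OF Y_represents nat_trans_map])

lemma Y_elE:
  assumes "c \<in> Obj C" "a \<in> Obj C" "x \<in> el (Y c) a"
  obtains f where "f \<in> Hom C a c" "x = \<theta> c a f"
  using represents_elE[OF Y_represents[OF assms(1)] assms(2,3)] .

lemma Ymap_comp:
  assumes o: "a \<in> Obj C" "b \<in> Obj C" "c \<in> Obj C" and fg: "f \<in> Hom C a b" "g \<in> Hom C b c"
  shows "Comp ind (Y a) (Y b) (Y c) (Ymap b c g) (Ymap a b f) = Ymap a c (Comp C a b c g f)"
proof (rule ind_comp_eqI[OF Y_lex[OF o(1)] Ymap_nat[OF o(1,2) fg(1)] Ymap_nat[OF o(2,3) fg(2)]
      Ymap_nat[OF o(1,3) comp_closed[OF o fg]]])
  fix d x assume d: "d \<in> Obj C" "x \<in> el (Y a) d"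
  obtain h where "h \<in> Hom C d a" "x = \<theta> a d h" using Y_elE[OF o(1) d] .
  then show "Ymap b c g d (Ymap a b f d x) = Ymap a c (Comp C a b c g f) d x"
    using o fg d by (simp add: Ymap_apply comp_closed comp_assoc)
qed

lemma Ymap_zero:
  assumes "a \<in> Obj C" "b \<in> Obj C"
  shows "Ymap a b (hzero a b) = \<zero>\<^bsub>HomMod ind (Y a) (Y b)\<^esub>"
proof (rule nat_trans_ext[OF Ymap_nat[OF assms zero_hom[OF assms]]])
  show "\<zero>\<^bsub>HomMod ind (Y a) (Y b)\<^esub> \<in> nat_trans R C (Y a) (Y b)"
    using ind.zero_hom[of "Y a" "Y b"] assms Y_lex by simp
  fix d x assume d: "d \<in> Obj C" "x \<in> el (Y a) d"
  obtain h where "h \<in> Hom C d a" "x = \<theta> a d h" using Y_elE[OF assms(1) d] .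
  then show "Ymap a b (hzero a b) d x = (\<zero>\<^bsub>HomMod ind (Y a) (Y b)\<^esub>) d x"
    using assms d by (simp add: Ymap_apply zero_hom comp_zero_left \<theta>_zero nat_trans_zero_apply \<theta>_closed)
qed

lemma Y_zeroI:
  assumes "c \<in> Obj C" "lex H" "n \<in> nat_trans R C (Y c) H" "n c (\<theta> c c (Id C c)) = elzero H c"
  shows "n = \<zero>\<^bsub>HomMod ind (Y c) H\<^esub>"
proof (rule nat_trans_ext[OF assms(3)])
  show "\<zero>\<^bsub>HomMod ind (Y c) H\<^esub> \<in> nat_trans R C (Y c) H"
    using ind.zero_hom[of "Y c" H] assms Y_lex by simp
  fix a x assume a: "a \<in> Obj C" "x \<in> el (Y c) a"
  obtain f where "f \<in> Hom C a c" "x = \<theta> c a f" using Y_elE[OF assms(1) a] .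
  then show "n a x = (\<zero>\<^bsub>HomMod ind (Y c) H\<^esub>) a x"
    using assms a Y_map_apply[OF assms(1,3) a(1)] linear_presheaf.act_zero[OF lex_psh[OF assms(2)]]
    by (simp add: nat_trans_zero_apply)
qed

lemma lex_epi_zeroD:
  assumes H: "lex H" and q: "is_epi C v u q" and o: "v \<in> Obj C" "u \<in> Obj C"
    and y: "y \<in> el H u" "Act H v u q y = elzero H v"
  shows "y = elzero H u"
proof -
  have qh: "q \<in> Hom C v u" using q by (simp add: is_epi_def)
  obtain e k where e: "e \<in> Obj C" "is_cokernel C v u e q k" using cokernel_exists[OF o qh] .
  note k = cokernelD[OF e(2)]
  have k0: "k = hzero u e" using is_epiD[OF q o e(1) k(2,3)] .
  obtain z where "z \<in> el H e" "Act H u e k z = y" using lex_factor[OF H e(2) o e(1) y] .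
  then show ?thesis using linear_presheaf.act_hzero[OF lex_psh[OF H] o(2) e(1)] k0 by simp
qed

lemma Ymap_epi:
  assumes q: "is_epi C v u q" and o: "v \<in> Obj C" "u \<in> Obj C"
  shows "is_epi ind (Y v) (Y u) (Ymap v u q)"
proof (rule ind.is_epiI)
  have qh: "q \<in> Hom C v u" using q by (simp add: is_epi_def)
  note n = Ymap_nat[OF o qh]
  fix H g assume "H \<in> Obj ind" "g \<in> Hom ind (Y u) H"
    and eq: "Comp ind (Y v) (Y u) H g (Ymap v u q) = \<zero>\<^bsub>HomMod ind (Y v) H\<^esub>"
  then have H: "lex H" and g: "g \<in> nat_trans R C (Y u) H" by simp_all
  have "g v (Ymap v u q v (\<theta> v v (Id C v))) = elzero H v"
    using eq ind_comp_zero_iff[OF Y_lex[OF o(1)] H n g] o by (simp add: \<theta>_closed id_closed)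
  then have "g v (\<theta> u v q) = elzero H v" using o qh by (simp add: Ymap_apply id_closed id_right)
  then have "Act H v u q (g u (\<theta> u u (Id C u))) = elzero H v" using Y_map_apply[OF o(2) g o(1) qh] by simp
  then have "g u (\<theta> u u (Id C u)) = elzero H u"
    using lex_epi_zeroD[OF H q o] nat_trans_closed[OF g o(2) \<theta>_closed[OF o(2,2) id_closed[OF o(2)]]] by blast
  then show "g = \<zero>\<^bsub>HomMod ind (Y u) H\<^esub>" by (rule Y_zeroI[OF o(2) H g])
qed (use o q in \<open>simp_all add: Y_lex Ymap_nat is_epi_def\<close>)

lemma Ymap_cokernel:
  assumes pq: "is_cokernel C w v u p q" and o: "w \<in> Obj C" "v \<in> Obj C" "u \<in> Obj C"
  shows "is_cokernel ind (Y w) (Y v) (Y u) (Ymap w v p) (Ymap v u q)"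
proof (rule ind.is_cokernelI)
  note c = cokernelD[OF pq]
  show "Comp ind (Y w) (Y v) (Y u) (Ymap v u q) (Ymap w v p) = \<zero>\<^bsub>HomMod ind (Y w) (Y u)\<^esub>"
    using Ymap_comp[OF o c(1,2)] Ymap_zero[OF o(1,3)] c(3) by simp
  show "is_epi ind (Y v) (Y u) (Ymap v u q)" by (rule Ymap_epi[OF cokernel_epi[OF pq o] o(2,3)])
  fix H g assume "H \<in> Obj ind" "g \<in> Hom ind (Y v) H"
    and eq: "Comp ind (Y w) (Y v) H g (Ymap w v p) = \<zero>\<^bsub>HomMod ind (Y w) H\<^esub>"
  then have H: "lex H" and g: "g \<in> nat_trans R C (Y v) H" by simp_all
  have gv: "g v (\<theta> v v (Id C v)) \<in> el H v" by (rule nat_trans_closed[OF g o(2) \<theta>_closed[OF o(2,2) id_closed[OF o(2)]]])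
  have "g w (Ymap w v p w (\<theta> w w (Id C w))) = elzero H w"
    using eq ind_comp_zero_iff[OF Y_lex[OF o(1)] H Ymap_nat[OF o(1,2) c(1)] g] o by (simp add: \<theta>_closed id_closed)
  then have "g w (\<theta> v w p) = elzero H w" using o c by (simp add: Ymap_apply id_closed id_right)
  then have "Act H w v p (g v (\<theta> v v (Id C v))) = elzero H w" using Y_map_apply[OF o(2) g o(1) c(1)] by simp
  then obtain y where y: "y \<in> el H u" "Act H v u q y = g v (\<theta> v v (Id C v))" using lex_factor[OF H pq o gv] by blast
  note n = Yelt_nat[OF o(3) lex_psh[OF H] y(1)]
  have "Comp ind (Y v) (Y u) H (Yelt u H y) (Ymap v u q) = g"
  proof (rule ind_comp_eqI[OF Y_lex[OF o(2)] Ymap_nat[OF o(2,3) c(2)] n g])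
    fix a x assume a: "a \<in> Obj C" "x \<in> el (Y v) a"
    obtain f where f: "f \<in> Hom C a v" "x = \<theta> v a f" using Y_elE[OF o(2) a] .
    show "Yelt u H y a (Ymap v u q a x) = g a x"
      using a o c f y Y_map_apply[OF o(2) g a(1) f(1)] linear_presheaf.act_comp[OF lex_psh[OF H] a(1) o(2,3) f(1) c(2) y(1)]
      by (simp add: Ymap_apply Yelt_apply lex_psh[OF H] comp_closed)
  qed
  then show "\<exists>h. h \<in> Hom ind (Y u) H \<and> Comp ind (Y v) (Y u) H h (Ymap v u q) = g" using n by auto
qed (use o cokernelD[OF pq] in \<open>simp_all add: Y_lex Ymap_nat\<close>)

lemma Ind_abelian_epi_regular:
  assumes ab: "abelian R ind" and q: "is_epi C v u q" and o: "v \<in> Obj C" "u \<in> Obj C"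
  shows "\<exists>w\<in>Obj C. \<exists>p. is_cokernel C w v u p q"
proof -
  have qh: "q \<in> Hom C v u" using q by (simp add: is_epi_def)
  obtain F g where "F \<in> Obj ind" and g: "is_cokernel ind F (Y v) (Y u) g (Ymap v u q)"
    using ab Ymap_epi[OF q o] Y_lex[OF o(1)] Y_lex[OF o(2)] unfolding abelian_def by (metis ind_simps(1) mem_Collect_eq)
  then have F: "lex F" by simp
  have gh: "g \<in> nat_trans R C F (Y v)" using ind.cokernelD(1)[OF g] by simp
  have qg: "Ymap v u q a (g a x) = elzero (Y u) a" if "a \<in> Obj C" "x \<in> el F a" for a x
    using ind.cokernelD(3)[OF g] ind_comp_zero_iff[OF F Y_lex[OF o(2)] gh Ymap_nat[OF o qh]] that by blast
  note idv = \<theta>_closed[OF o(1,1) id_closed[OF o(1)]] and idu = \<theta>_closed[OF o(2,2) id_closed[OF o(2)]]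
  show ?thesis
  proof (rule ind_cokernel_exists[OF F Y_lex[OF o(1)] gh])
    fix K \<tau>
    assume K: "lex K" and \<tau>: "is_cokernel ind F (Y v) K g \<tau>"
      and ev: "\<And>a b z q y. \<lbrakk>a \<in> Obj C; b \<in> Obj C; z \<in> el K a; q \<in> Hom C b a; y \<in> el (Y v) b; Act K b a q z = \<tau> b y\<rbrakk>
      \<Longrightarrow> \<exists>u e k y' v' p x j d. cokernel_stage F (Y v) g u e k y' v' p x \<and> j \<in> Hom C b u \<and> Act (Y v) b u j y' = y \<and>
        d \<in> Hom C a e \<and> Comp C b u e k j = Comp C b a e d q"
    note t = ind.cokernelD[OF \<tau>]
    obtain s where "s \<in> Hom ind (Y u) K" and sq: "Comp ind (Y v) (Y u) K s (Ymap v u q) = \<tau>"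
      using ind.cokernel_factor[OF g _ t(2,3)] K by auto
    then have s: "s \<in> nat_trans R C (Y u) K" by simp
    let ?z = "s u (\<theta> u u (Id C u))"
    have "Act K v u q ?z = s v (\<theta> u v q)" using Y_map_apply[OF o(2) s o(1) qh] by simp
    also have "\<dots> = s v (Ymap v u q v (\<theta> v v (Id C v)))" using o qh by (simp add: Ymap_apply id_closed id_right)
    also have "\<dots> = \<tau> v (\<theta> v v (Id C v))" by (rule ind_comp_eqD[OF sq o(1) idv])
    finally have "Act K v u q ?z = \<tau> v (\<theta> v v (Id C v))" .
    from ev[OF o(2,1) nat_trans_closed[OF s o(2) idu] qh idv this]
    obtain u' e v' k p y' x j d where c: "u' \<in> Obj C" "e \<in> Obj C" "v' \<in> Obj C" "is_cokernel C v' u' e p k"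
      and y': "y' \<in> el (Y v) u'" and x: "x \<in> el F v'" "Act (Y v) v' u' p y' = g v' x"
      and j: "j \<in> Hom C v u'" "Act (Y v) v u' j y' = \<theta> v v (Id C v)"
      and d: "d \<in> Hom C u e" "Comp C v u' e k j = Comp C v u e d q" unfolding cokernel_stage_def by blast
    note pk = cokernelD[OF c(4)]
    obtain f where f: "f \<in> Hom C u' v" "y' = \<theta> v u' f" using Y_elE[OF o(1) c(1) y'] .
    have fj: "Comp C v u' v f j = Id C v"
      using j f o c by (simp add: \<theta>_act \<theta>_eq_iff comp_closed id_closed)
    let ?p = "Comp C v' u' v f p"
    have p: "?p \<in> Hom C v' v" using c f o pk by (simp add: comp_closed)
    have "\<theta> v v' ?p = g v' x" using x f o c pk by (simp add: \<theta>_act)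
    then have "\<theta> u v' (Comp C v' v u q ?p) = \<theta> u v' (hzero v' u)"
      using qg[OF c(3) x(1)] Ymap_apply[OF o qh c(3) p] o c by (simp add: \<theta>_zero)
    then have qp: "Comp C v' v u q ?p = hzero v' u"
      using \<theta>_eq_iff[OF o(2) c(3) comp_closed[OF c(3) o p qh] zero_hom[OF c(3) o(2)]] by blast
    have "is_cokernel C v' v u ?p q"
    proof (rule is_cokernelI[OF c(3) o p qp q])
      fix T h assume h: "T \<in> Obj C" "h \<in> Hom C v T" "Comp C v' v T h ?p = hzero v' T"
      then have "Comp C v' u' T (Comp C u' v T h f) p = hzero v' T" using o c f pk by (simp add: comp_assoc)
      then obtain b where b: "b \<in> Hom C e T" "Comp C u' e T b k = Comp C u' v T h f"
        using cokernel_factor[OF c(4) h(1) comp_closed[OF c(1) o(1) h(1) f(1) h(2)]] by blast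
      have "h = Comp C v v T h (Comp C v u' v f j)" unfolding fj using o h by (simp add: id_right)
      also have "\<dots> = Comp C v u' T (Comp C u' e T b k) j" unfolding b(2) using o h c f j by (simp add: comp_assoc)
      also have "\<dots> = Comp C v e T b (Comp C v u e d q)" unfolding d(2)[symmetric] using o h c b(1) pk j by (simp add: comp_assoc)
      also have "\<dots> = Comp C v u T (Comp C u e T b d) q" using o h c b(1) d qh by (simp add: comp_assoc)
      finally show "\<exists>n. n \<in> Hom C u T \<and> Comp C v u T n q = h"
        using comp_closed[OF o(2) c(2) h(1) d(1) b(1)] by metis
    qed
    then show ?thesis using c(3) by blast
  qed
qed

lemma Ind_abelian_exact_lift:
  assumes ab: "abelian R ind" and pq: "is_cokernel C w v u p q" and o: "w \<in> Obj C" "v \<in> Obj C" "u \<in> Obj C"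
    and a: "a \<in> Obj C" and f: "f \<in> Hom C a v" and qf: "Comp C a v u q f = hzero a u"
  shows "\<exists>b\<in>Obj C. \<exists>p' f'. is_epi C b a p' \<and> f' \<in> Hom C b w \<and> Comp C b a v f p' = Comp C b w v p f'"
proof -
  note c = cokernelD[OF pq]
  obtain s i1 i2 p1 p2 where bp: "is_biproduct C a w s i1 i2 p1 p2"
    and orth: "Comp C a s w p2 i1 = hzero a w" "Comp C w s a p1 i2 = hzero w a" using biproduct_exists[OF a o(1)] .
  have h: "s \<in> Obj C" "i1 \<in> Hom C a s" "i2 \<in> Hom C w s" "p1 \<in> Hom C s a" "p2 \<in> Hom C s w"
    "Comp C a s a p1 i1 = Id C a" "Comp C w s w p2 i2 = Id C w" using bp by (auto simp: is_biproduct_def)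
  let ?h1 = "Comp C s a v f p1" and ?h2 = "Comp C s w v p p2"
  let ?h = "?h1 \<oplus>\<^bsub>HomMod C s v\<^esub> ?h2"
  have hh: "?h1 \<in> Hom C s v" "?h2 \<in> Hom C s v" using h a o f c by (simp_all add: comp_closed)
  then have hs: "?h \<in> Hom C s v" using h o by (simp add: add_hom)
  have "Comp C w s v ?h1 i2 = hzero w v" "Comp C w s v ?h2 i2 = p"
    using comp_assoc[OF o(1) h(1) a o(2) h(3,4) f, symmetric] comp_assoc[OF o(1) h(1) o(1,2) h(3,5) c(1), symmetric]
      h orth a o f c by (simp_all add: comp_zero_right id_right)
  then have hi2: "Comp C w s v ?h i2 = p"
    using comp_add_left[OF o(1) h(1) o(2) h(3) hh] o c by (simp add: hom_l_zero)
  have "Comp C s v u q ?h1 = hzero s u" "Comp C s v u q ?h2 = hzero s u"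
    using comp_assoc[OF h(1) a o(2,3) h(4) f c(2)] comp_assoc[OF h(1) o h(5) c(1,2)] h a o c qf
    by (simp_all add: comp_zero_left)
  then have qh: "Comp C s v u q ?h = hzero s u"
    using comp_add_right[OF h(1) o(2,3) hh c(2)] h o by (simp add: hom_l_zero zero_hom)
  note Yo = Y_lex[OF h(1)] Y_lex[OF a] Y_lex[OF o(1)] Y_lex[OF o(2)] Y_lex[OF o(3)]
  note Yh = Ymap_nat[OF h(1) o(2) hs] and Yp1 = Ymap_nat[OF h(1) a h(4)]
  obtain P i where "P \<in> Obj ind" and ker: "is_kernel ind P (Y s) (Y v) i (Ymap s v ?h)"
    using ab Yo Yh unfolding abelian_def by (metis ind_simps(1,2) mem_Collect_eq)
  then have P: "lex P" by simp
  have i: "i \<in> nat_trans R C P (Y s)" using ind.kernelD(1)[OF ker] by simp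
  define \<alpha> where "\<alpha> = Comp ind P (Y s) (Y a) (Ymap s a p1) i"
  have \<alpha>: "\<alpha> \<in> nat_trans R C P (Y a)" unfolding \<alpha>_def using nat_trans_comp[OF lex_psh[OF P] i Yp1] by simp
  show ?thesis
  proof (rule ind_cokernel_zero_stage[OF P Yo(2) \<alpha>])
    fix K \<tau>
    assume K: "lex K" and coker: "is_cokernel ind P (Y a) K \<alpha> \<tau>"
      and zs: "\<And>b y. \<lbrakk>b \<in> Obj C; y \<in> el (Y a) b; \<tau> b y = elzero K b\<rbrakk>
        \<Longrightarrow> \<exists>u e k y' v p x j. cokernel_stage P (Y a) \<alpha> u e k y' v p x \<and> j \<in> Hom C b u \<and> Act (Y a) b u j y' = y \<and> Comp C b u e k j = hzero b e"
    note t = ind.cokernelD[OF coker]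
    define \<sigma> where "\<sigma> = Comp ind (Y s) (Y a) K \<tau> (Ymap s a p1)"
    have \<sigma>: "\<sigma> \<in> Hom ind (Y s) K" unfolding \<sigma>_def by (rule ind.comp_closed) (use Yo K Yp1 t in simp_all)
    have "\<sigma> = \<zero>\<^bsub>HomMod ind (Y s) K\<^esub>"
    proof (rule ind.abelian_exactness[OF ab _ _ _ _ _ _ ker \<sigma>])
      show "Comp ind P (Y s) K \<sigma> i = \<zero>\<^bsub>HomMod ind P K\<^esub>"
        unfolding \<sigma>_def t(3)[symmetric] unfolding \<alpha>_def
        by (rule ind.comp_assoc[symmetric]) (use P Yo K i Yp1 t(2) in simp_all)
      show "Ymap w s i2 \<in> Hom ind (Y w) (Y s)" using Ymap_nat[OF o(1) h(1,3)] by simp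
      show "is_cokernel ind (Y w) (Y v) (Y u) (Comp ind (Y w) (Y s) (Y v) (Ymap s v ?h) (Ymap w s i2)) (Ymap v u q)"
        unfolding Ymap_comp[OF o(1) h(1) o(2) h(3) hs] hi2 by (rule Ymap_cokernel[OF pq o])
      show "Comp ind (Y s) (Y v) (Y u) (Ymap v u q) (Ymap s v ?h) = \<zero>\<^bsub>HomMod ind (Y s) (Y u)\<^esub>"
        unfolding Ymap_comp[OF h(1) o(2,3) hs c(2)] qh by (rule Ymap_zero[OF h(1) o(3)])
      have "Comp ind (Y w) (Y s) K \<sigma> (Ymap w s i2)
          = Comp ind (Y w) (Y a) K \<tau> (Comp ind (Y w) (Y s) (Y a) (Ymap s a p1) (Ymap w s i2))"
        unfolding \<sigma>_def by (rule ind.comp_assoc[symmetric])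
          (use Yo K Yp1 Ymap_nat[OF o(1) h(1,3)] t(2) in simp_all)
      also have "\<dots> = \<zero>\<^bsub>HomMod ind (Y w) K\<^esub>"
        unfolding Ymap_comp[OF o(1) h(1) a h(3,4)] orth(2) Ymap_zero[OF o(1) a]
        by (rule ind.comp_zero_right) (use Yo K t(2) in simp_all)
      finally show "Comp ind (Y w) (Y s) K \<sigma> (Ymap w s i2) = \<zero>\<^bsub>HomMod ind (Y w) K\<^esub>" .
    qed (use P Yo K in simp_all)
    then have "\<sigma> a (\<theta> s a i1) = elzero K a" using a h by (simp add: nat_trans_zero_apply \<theta>_closed)
    then have "\<tau> a (\<theta> a a (Id C a)) = elzero K a"
      using a h by (simp add: \<sigma>_def Ymap_apply \<theta>_closed)
    from zs[OF a \<theta>_closed[OF a a id_closed[OF a]] this]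
    obtain u' e b k r y' x j where d: "u' \<in> Obj C" "e \<in> Obj C" "b \<in> Obj C" "is_cokernel C b u' e r k"
      and y': "y' \<in> el (Y a) u'" and x: "x \<in> el P b" "Act (Y a) b u' r y' = \<alpha> b x"
      and j: "j \<in> Hom C a u'" "Act (Y a) a u' j y' = \<theta> a a (Id C a)" "Comp C a u' e k j = hzero a e" unfolding cokernel_stage_def by blast
    note rk = cokernelD[OF d(4)]
    obtain g where g: "g \<in> Hom C u' a" "y' = \<theta> a u' g" using Y_elE[OF a d(1) y'] .
    have gj: "Comp C a u' a g j = Id C a"
      using j g a d by (simp add: \<theta>_act \<theta>_eq_iff comp_closed id_closed)
    let ?p' = "Comp C b u' a g r"
    have p': "?p' \<in> Hom C b a" using d a g rk by (simp add: comp_closed)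
    have epi: "is_epi C b a ?p'"
    proof (rule is_epiI[OF d(3) a p'])
      fix T n assume n: "T \<in> Obj C" "n \<in> Hom C a T" "Comp C b a T n ?p' = hzero b T"
      then have "Comp C b u' T (Comp C u' a T n g) r = hzero b T" using a d g rk by (simp add: comp_assoc)
      then obtain l where l: "l \<in> Hom C e T" "Comp C u' e T l k = Comp C u' a T n g"
        using cokernel_factor[OF d(4) n(1) comp_closed[OF d(1) a n(1) g(1) n(2)]] by blast
      have "n = Comp C a a T n (Comp C a u' a g j)" unfolding gj using a n by (simp add: id_right)
      also have "\<dots> = Comp C a u' T (Comp C u' e T l k) j" unfolding l(2) using a n d g j by (simp add: comp_assoc)
      also have "\<dots> = Comp C a e T l (Comp C a u' e k j)" using a n d l(1) rk j(1) by (simp add: comp_assoc)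
      also have "\<dots> = hzero a T" unfolding j(3) using a n d l(1) by (simp add: comp_zero_right)
      finally show "n = hzero a T" .
    qed
    obtain \<xi> where \<xi>: "\<xi> \<in> Hom C b s" "i b x = \<theta> s b \<xi>" using Y_elE[OF h(1) d(3) nat_trans_closed[OF i d(3) x(1)]] .
    have "\<alpha> b x = \<theta> a b (Comp C b s a p1 \<xi>)"
      using d x \<xi> h a by (simp add: \<alpha>_def Ymap_apply)
    then have p1\<xi>: "Comp C b s a p1 \<xi> = ?p'"
      using x(2) g a d rk h \<xi> by (simp add: \<theta>_act \<theta>_eq_iff comp_closed)
    have "Ymap s v ?h b (i b x) = elzero (Y v) b"
      using ind.kernelD(3)[OF ker] ind_comp_zero_iff[OF P Yo(4) i Yh] d(3) x(1) by blast
    then have "\<theta> v b (Comp C b s v ?h \<xi>) = \<theta> v b (hzero b v)"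
      using h o hs d \<xi> by (simp add: Ymap_apply \<theta>_zero)
    then have "Comp C b s v ?h \<xi> = hzero b v"
      using \<theta>_eq_iff[OF o(2) d(3) comp_closed[OF d(3) h(1) o(2) \<xi>(1) hs] zero_hom[OF d(3) o(2)]] by blast
    then have sum: "Comp C b a v f ?p' \<oplus>\<^bsub>HomMod C b v\<^esub> Comp C b w v p (Comp C b s w p2 \<xi>) = hzero b v"
      using comp_add_left[OF d(3) h(1) o(2) \<xi>(1) hh] comp_assoc[OF d(3) h(1) a o(2) \<xi>(1) h(4) f]
        comp_assoc[OF d(3) h(1) o(1,2) \<xi>(1) h(5) c(1)] p1\<xi> by simp
    interpret M: module R "HomMod C b v" by (rule hom_module[OF d(3) o(2)])
    have p2\<xi>: "Comp C b s w p2 \<xi> \<in> Hom C b w" using d h o \<xi> by (simp add: comp_closed)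
    let ?f' = "(\<ominus> \<one>) \<odot>\<^bsub>HomMod C b w\<^esub> Comp C b s w p2 \<xi>"
    have f': "?f' \<in> Hom C b w" using smult_hom[OF d(3) o(1) p2\<xi>] by simp
    have cl: "Comp C b a v f ?p' \<in> carrier (HomMod C b v)" "Comp C b w v p (Comp C b s w p2 \<xi>) \<in> carrier (HomMod C b v)"
      using d a o f p' c p2\<xi> by (simp_all add: carrier_hom comp_closed)
    have "Comp C b w v p ?f' = (\<ominus> \<one>) \<odot>\<^bsub>HomMod C b v\<^esub> Comp C b w v p (Comp C b s w p2 \<xi>)"
      using comp_smult_right[OF d(3) o(1,2) p2\<xi> c(1)] by simp
    also have "\<dots> = \<ominus>\<^bsub>HomMod C b v\<^esub> Comp C b w v p (Comp C b s w p2 \<xi>)"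
      using cl by (simp add: M.smult_l_minus)
    also have "\<dots> = Comp C b a v f ?p'" using M.M.minus_equality[OF sum cl(2,1)] .
    finally have "Comp C b a v f ?p' = Comp C b w v p ?f'" by simp
    then show ?thesis using d(3) epi f' by blast
  qed
qed

theorem abelian_Ind_imp_ind_abelian:
  assumes "abelian R ind" shows "ind_abelian R C"
  unfolding ind_abelian_def
  using linear_category_axioms cocomplete Ind_abelian_epi_regular[OF assms] Ind_abelian_exact_lift[OF assms] by blast

end

theorem theorem1p3:
  fixes R :: "('r, 'k) ring_scheme"
    and A :: "('o, 'm, 'r, 'z) lcat_scheme"
  assumes "cring R"
    and "linear_category R A"
    and "finitely_cocomplete A"
    and "small_cat TYPE('u) A"
  shows "ind_abelian R A \<longleftrightarrow>
    abelian R (Ind R A :: (('o, 'm, 'r, 'u) presheaf, 'o \<Rightarrow> 'u \<Rightarrow> 'u, 'r) lcat)"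
proof -
  interpret small_cocomplete_category R A "TYPE('u)"
    by (intro small_cocomplete_category.intro cocomplete_linear_category.intro
        cocomplete_linear_category_axioms.intro small_cocomplete_category_axioms.intro assms)
  show ?thesis
  proof
    assume "ind_abelian R A"
    then interpret ind_abelian_category R A "TYPE('u)" by unfold_locales
    show "abelian R ind" by (rule Ind_abelian)
  qed (rule abelian_Ind_imp_ind_abelian)
qed

end
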